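(* Let $s\in\mathbb{N}$, $s\ge 1$, and let $M$ be an Oeljeklaus–Toma manifold of type $(s,1)$ (of real dimension $2s+2$), viewed as a solvmanifold $\Gamma\backslash G$ and equipped with the LCK structure $(J,g)$ described in the context. Then the holonomy group of its Bismut connection $\nabla^b$ is $\operatorname{Hol}^b(M)=\operatorname{U}(s+1)$; that is, there is no reduction of the Bismut holonomy.
   Context: Oeljeklaus–Toma (OT) manifolds of type $(s,1)$ are the compact complex manifolds $(\mathbb{H}^s\times\mathbb{C})/(U\ltimes\mathcal{O}_K)$, where $K$ is a number field with exactly $s$ real embeddings and $2$ complex (conjugate) embeddings, $\mathcal{O}_K$ is its ring of integers, and $U$ is a finite-index subgroup of the group of units that are positive in all real embeddings. By a result of Kasuya such a manifold is a solvmanifold $M=\Gamma\backslash G$, $\Gamma$ a co-compact discrete subgroup of a simply connected solvable Lie group $G$ whose Lie algebra $\mathfrak{g}$ has a basis $\{A_1,\dots,A_s,B_1,\dots,B_s,C_1,C_2\}$ with non-zero brackets $$[A_i,B_i]=B_i,\quad [A_i,C_1]=-\tfrac12C_1+r_iC_2,\quad [A_i,C_2]=-r_iC_1-\tfrac12C_2,\qquad i=1,\dots,s,$$ for some real numbers $r_1,\dots,r_s$. The complex structure on $M$ is induced by the left invariant one on $G$ given by $JA_i=B_i$ ($1\le i\le s$), $JC_1=C_2$, $J^2=-\mathrm{Id}$. The metric $g$ on $M$ is induced by the left invariant metric on $G$ whose only non-zero values on the basis are $g(A_i,A_i)=g(B_i,B_i)=2$, $g(A_i,A_j)=g(B_i,B_j)=1$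 for $i\ne j$, and $g(C_1,C_1)=g(C_2,C_2)=1$. Equivalently, the fundamental form $\omega=g(J\cdot,\cdot)$ is $\omega=2\sum_i\alpha_i\wedge\beta_i+\sum_{i\ne j}\alpha_i\wedge\beta_j+\gamma_1\wedge\gamma_2$, where $\{\alpha_i,\beta_i,\gamma_1,\gamma_2\}$ is the dual basis. This structure is LCK (locally conformally Kähler): $d\omega=\theta\wedge\omega$ with closed Lee form $\theta=\alpha_1+\dots+\alpha_s$. The Bismut connection $\nabla^b$ of a Hermitian manifold $(M,J,g)$ is the unique connection with $\nabla^b g=0$, $\nabla^b J=0$ and totally skew-symmetric torsion: $g(\nabla^b_XY,Z)=g(\nabla^g_XY,Z)+\tfrac12 d\omega(JX,JY,JZ)$, with $\nabla^g$ the Levi-Civita connection. Its holonomy group on a manifold of real dimension $2s+2$ is a subgroup of $\operatorname{U}(s+1)$. *)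

theory Defs
  imports "HOL-Analysis.Analysis" "HOL-Algebra.Coset"
begin

section \<open>Connections and holonomy on quotients of a Euclidean space\<close>

text \<open>
  The simply connected groups below are diffeomorphic to a Euclidean space, so one global chart
  suffices: the manifold is a Euclidean space \<open>'a\<close>, every tangent space is \<open>'a\<close>, vector fields are
  maps \<open>'a \<Rightarrow> 'a\<close>, and tensor fields are functions of a base point followed by tangent vectors.
\<close>

primrec Ck :: "nat \<Rightarrow> ('a::real_normed_vector \<Rightarrow> 'b::real_normed_vector) \<Rightarrow> bool" where
  "Ck 0 f \<longleftrightarrow> continuous_on UNIV f"
| "Ck (Suc k) f \<longleftrightarrow>
     (\<forall>x. f differentiable (at x)) \<and> (\<forall>v. Ck k (\<lambda>x. frechet_derivative f (at x) v))"

definition smooth :: "('a::real_normed_vector \<Rightarrow> 'b::real_normed_vector) \<Rightarrow> bool" where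
  "smooth f \<longleftrightarrow> (\<forall>k. Ck k f)"

definition lie_bracket :: "('a::real_normed_vector \<Rightarrow> 'a) \<Rightarrow> ('a \<Rightarrow> 'a) \<Rightarrow> 'a \<Rightarrow> 'a" where
  "lie_bracket X Y p =
     frechet_derivative Y (at p) (X p) - frechet_derivative X (at p) (Y p)"

text \<open>
  A connection on the tangent bundle is represented by its Christoffel symbols
  \<open>D p u v\<close> in the global chart.
\<close>

type_synonym 'a christoffel = "'a \<Rightarrow> 'a \<Rightarrow> 'a \<Rightarrow> 'a"

definition affine_connection :: "'a::real_normed_vector christoffel \<Rightarrow> bool" where
  "affine_connection D \<longleftrightarrow> (\<forall>p. bilinear (D p)) \<and> (\<forall>u v. smooth (\<lambda>p. D p u v))"

definition cov_deriv ::
  "'a::real_normed_vector christoffel \<Rightarrow> ('a \<Rightarrow> 'a) \<Rightarrow> ('a \<Rightarrow> 'a) \<Rightarrow> 'a \<Rightarrow> 'a" where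
  "cov_deriv D X Y p = frechet_derivative Y (at p) (X p) + D p (X p) (Y p)"

definition torsion ::
  "'a::real_normed_vector christoffel \<Rightarrow> ('a \<Rightarrow> 'a) \<Rightarrow> ('a \<Rightarrow> 'a) \<Rightarrow> 'a \<Rightarrow> 'a" where
  "torsion D X Y p = cov_deriv D X Y p - cov_deriv D Y X p - lie_bracket X Y p"

definition metric_parallel ::
  "('a::real_normed_vector \<Rightarrow> 'a \<Rightarrow> 'a \<Rightarrow> real) \<Rightarrow> 'a christoffel \<Rightarrow> bool" where
  "metric_parallel g D \<longleftrightarrow>
     (\<forall>X Y Z p. smooth X \<longrightarrow> smooth Y \<longrightarrow> smooth Z \<longrightarrow>
        frechet_derivative (\<lambda>q. g q (Y q) (Z q)) (at p) (X p)
          = g p (cov_deriv D X Y p) (Z p) + g p (Y p) (cov_deriv D X Z p))"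

definition endomorphism_parallel ::
  "('a::real_normed_vector \<Rightarrow> 'a \<Rightarrow> 'a) \<Rightarrow> 'a christoffel \<Rightarrow> bool" where
  "endomorphism_parallel J D \<longleftrightarrow>
     (\<forall>X Y p. smooth X \<longrightarrow> smooth Y \<longrightarrow>
        cov_deriv D X (\<lambda>q. J q (Y q)) p = J p (cov_deriv D X Y p))"

text \<open>Skew-symmetry of \<open>g(T(X,Y),Z)\<close> in \<open>X, Y\<close> is automatic.\<close>

definition skew_torsion ::
  "('a::real_normed_vector \<Rightarrow> 'a \<Rightarrow> 'a \<Rightarrow> real) \<Rightarrow> 'a christoffel \<Rightarrow> bool" where
  "skew_torsion g D \<longleftrightarrow>
     (\<forall>X Y Z p. smooth X \<longrightarrow> smooth Y \<longrightarrow> smooth Z \<longrightarrow>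
        g p (torsion D X Y p) (Z p) = - g p (torsion D X Z p) (Y p))"

definition bismut_connection ::
  "('a::real_normed_vector \<Rightarrow> 'a \<Rightarrow> 'a \<Rightarrow> real) \<Rightarrow> ('a \<Rightarrow> 'a \<Rightarrow> 'a) \<Rightarrow> 'a christoffel" where
  "bismut_connection g J =
     (THE D. affine_connection D \<and> metric_parallel g D \<and> endomorphism_parallel J D \<and>
             skew_torsion g D)"

text \<open>
  \<open>S\<close> contains the break points. On a closed interval without interior break points the path is
  smooth up to the end points, i.e. it extends to a smooth curve on the real line.
\<close>

definition piecewise_smooth_path :: "(real \<Rightarrow> 'a::real_normed_vector) \<Rightarrow> bool" where
  "piecewise_smooth_path c \<longleftrightarrow>
     (\<exists>S. finite S \<and>
       (\<forall>a b. 0 \<le> a \<longrightarrow> a < b \<longrightarrow> b \<le> 1 \<longrightarrow> {a<..<b} \<inter> S = {} \<longrightarrow>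
          (\<exists>f. smooth f \<and> (\<forall>t\<in>{a..b}. c t = f t))))"

definition parallel_along ::
  "'a::real_normed_vector christoffel \<Rightarrow> (real \<Rightarrow> 'a) \<Rightarrow> (real \<Rightarrow> 'a) \<Rightarrow> bool" where
  "parallel_along D c V \<longleftrightarrow>
     continuous_on {0..1} V \<and>
     (\<exists>S. finite S \<and>
       (\<forall>t\<in>{0..1} - S. \<exists>w. (c has_vector_derivative w) (at t within {0..1}) \<and>
          (V has_vector_derivative - D (c t) w (V t)) (at t within {0..1})))"

text \<open>
  Let \<open>\<Gamma>\<close> be a group of deck transformations preserving \<open>D\<close>. A loop based at the image of \<open>p\<close> in the
  quotient by \<open>\<Gamma>\<close> is the projection of a path from \<open>p\<close> to some \<open>\<phi> p\<close> with \<open>\<phi> \<in> \<Gamma>\<close>, and the tangent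
  spaces at \<open>p\<close> and \<open>\<phi> p\<close> are both identified with that of the quotient, hence with each other by
  the differential of \<open>\<phi>\<close>. The set below is thus the holonomy group of the connection induced on
  the quotient at the image of \<open>p\<close>, acting on the tangent space there.
\<close>

definition quotient_holonomy_group ::
  "('a::real_normed_vector \<Rightarrow> 'a) set \<Rightarrow> 'a christoffel \<Rightarrow> 'a \<Rightarrow> ('a \<Rightarrow> 'a) set" where
  "quotient_holonomy_group \<Gamma> D p =
     {A. \<exists>\<phi>\<in>\<Gamma>. \<exists>c. piecewise_smooth_path c \<and> c 0 = p \<and> c 1 = \<phi> p \<and>
        (\<forall>v. \<exists>V. parallel_along D c V \<and> V 0 = v \<and>
           V 1 = frechet_derivative \<phi> (at p) (A v))}"

text \<open>The unitary group of a tangent space, for a Hermitian inner product \<open>h\<close> and its complex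
  structure \<open>J\<close>.\<close>

definition unitary_group ::
  "('a::real_vector \<Rightarrow> 'a \<Rightarrow> real) \<Rightarrow> ('a \<Rightarrow> 'a) \<Rightarrow> ('a \<Rightarrow> 'a) set" where
  "unitary_group h J =
     {A. linear A \<and> (\<forall>u v. h (A u) (A v) = h u v) \<and> (\<forall>u. A (J u) = J (A u))}"


section \<open>The Lie group and its left invariant Hermitian structure\<close>

text \<open>
  The point \<open>(t, b, z)\<close> has coordinates along the \<open>A\<^sub>i\<close>, the \<open>B\<^sub>i\<close>, and \<open>C\<^sub>1, C\<^sub>2\<close> (real and imaginary
  part). The integer \<open>s\<close> is \<open>CARD('s)\<close>; the neutral element is \<open>0\<close>.
\<close>

type_synonym 's ot_group = "(real^'s) \<times> (real^'s) \<times> complex"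

definition ot_weight :: "real^'s::finite \<Rightarrow> real^'s \<Rightarrow> complex" where
  "ot_weight r t = (\<Sum>i\<in>UNIV. (- 1 / 2 + \<i> * complex_of_real (r $ i)) * complex_of_real (t $ i))"

definition ot_char :: "real^'s::finite \<Rightarrow> real^'s \<Rightarrow> complex" where
  "ot_char r t = exp (ot_weight r t)"

fun ot_mult :: "real^'s::finite \<Rightarrow> 's ot_group \<Rightarrow> 's ot_group \<Rightarrow> 's ot_group" where
  "ot_mult r (t, b, z) (t', b', z') =
     (t + t', (\<chi> i. b $ i + exp (t $ i) * b' $ i), z + ot_char r t * z')"

fun ot_inv :: "real^'s::finite \<Rightarrow> 's ot_group \<Rightarrow> 's ot_group" where
  "ot_inv r (t, b, z) = (- t, (\<chi> i. - exp (- t $ i) * b $ i), - ot_char r (- t) * z)"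

definition left_invariant_field ::
  "real^'s::finite \<Rightarrow> 's ot_group \<Rightarrow> 's ot_group \<Rightarrow> 's ot_group" where
  "left_invariant_field r v p = frechet_derivative (ot_mult r p) (at 0) v"

text \<open>The differential at \<open>p\<close> of the left translation taking \<open>p\<close> to \<open>0\<close>.\<close>

definition maurer_cartan ::
  "real^'s::finite \<Rightarrow> 's ot_group \<Rightarrow> 's ot_group \<Rightarrow> 's ot_group" where
  "maurer_cartan r p u = frechet_derivative (ot_mult r (ot_inv r p)) (at p) u"

definition basis_A :: "'s::finite \<Rightarrow> 's ot_group" where "basis_A i = (axis i 1, 0, 0)"
definition basis_B :: "'s::finite \<Rightarrow> 's ot_group" where "basis_B i = (0, axis i 1, 0)"
definition basis_C1 :: "'s::finite ot_group" where "basis_C1 = (0, 0, 1)"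
definition basis_C2 :: "'s::finite ot_group" where "basis_C2 = (0, 0, \<i>)"

fun lie_metric :: "'s::finite ot_group \<Rightarrow> 's ot_group \<Rightarrow> real" where
  "lie_metric (a, b, z) (a', b', z') =
     (\<Sum>i\<in>UNIV. \<Sum>j\<in>UNIV. (if i = j then 2 else 1) * (a $ i * a' $ j + b $ i * b' $ j))
       + (Re z * Re z' + Im z * Im z')"

fun lie_complex_structure :: "'s::finite ot_group \<Rightarrow> 's ot_group" where
  "lie_complex_structure (a, b, z) = (- b, a, \<i> * z)"

definition ot_metric ::
  "real^'s::finite \<Rightarrow> 's ot_group \<Rightarrow> 's ot_group \<Rightarrow> 's ot_group \<Rightarrow> real" where
  "ot_metric r p u v = lie_metric (maurer_cartan r p u) (maurer_cartan r p v)"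

definition ot_complex_structure ::
  "real^'s::finite \<Rightarrow> 's ot_group \<Rightarrow> 's ot_group \<Rightarrow> 's ot_group" where
  "ot_complex_structure r p u =
     left_invariant_field r (lie_complex_structure (maurer_cartan r p u)) p"


subsection \<open>Group laws, structure constants, and values on the basis\<close>

lemma linear_ot_weight: "linear (ot_weight r)"
  by (rule linearI)
     (simp_all add: ot_weight_def distrib_left sum.distrib sum_distrib_left mult.left_commute
       scaleR_conv_of_real [where 'a = complex])

lemma ot_weight_axis: "ot_weight r (axis i 1) = - 1 / 2 + \<i> * complex_of_real (r $ i)"
proof -
  have "(- 1 / 2 + \<i> * complex_of_real (r $ j)) * complex_of_real (axis i 1 $ j)
      = (if j = i then - 1 / 2 + \<i> * complex_of_real (r $ j) else 0)" for j
    by (simp add: axis_def)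
  then show ?thesis
    by (simp add: ot_weight_def)
qed

lemma ot_char_0 [simp]: "ot_char r 0 = 1"
  by (simp add: ot_char_def linear_0 [OF linear_ot_weight])

lemma ot_char_add: "ot_char r (t + t') = ot_char r t * ot_char r t'"
  by (simp add: ot_char_def exp_add linear_add [OF linear_ot_weight])

lemma ot_char_minus: "ot_char r (- t) * ot_char r t = 1"
  by (simp add: ot_char_add [symmetric])

lemma ot_mult_assoc: "ot_mult r (ot_mult r p q) x = ot_mult r p (ot_mult r q x)"
  by (cases p; cases q; cases x)
     (simp add: ot_char_add vec_eq_iff exp_add algebra_simps)

lemma ot_mult_0_left: "ot_mult r 0 p = p"
  by (cases p) (simp add: zero_prod_def vec_eq_iff)

lemma ot_mult_inv_left: "ot_mult r (ot_inv r p) p = 0"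
  by (cases p) (simp add: zero_prod_def vec_eq_iff)

definition ot_scale :: "real^'s::finite \<Rightarrow> real^'s \<Rightarrow> 's ot_group \<Rightarrow> 's ot_group" where
  "ot_scale r t v = (fst v, (\<chi> i. exp (t $ i) * fst (snd v) $ i), ot_char r t * snd (snd v))"

lemma has_derivative_ot_mult:
  "(ot_mult r p has_derivative ot_scale r (fst p)) (at q)"
proof -
  have lin: "linear (ot_scale r (fst p))"
    by (rule linearI) (auto simp: ot_scale_def vec_eq_iff algebra_simps)
  have eq: "ot_mult r p = (\<lambda>x. p + ot_scale r (fst p) x)"
    by (rule ext, cases p) (auto simp: ot_scale_def vec_eq_iff)
  show ?thesis
    unfolding eq
    by (rule has_derivative_add [of "\<lambda>_. p" "\<lambda>_. 0", simplified])
       (rule linear_imp_has_derivative [OF lin])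
qed

lemma frechet_derivative_ot_mult:
  "frechet_derivative (ot_mult r p) (at q) = ot_scale r (fst p)"
  by (rule frechet_derivative_at [OF has_derivative_ot_mult, symmetric])

lemma left_invariant_field_eq: "left_invariant_field r v p = ot_scale r (fst p) v"
  by (simp add: left_invariant_field_def frechet_derivative_ot_mult)

lemma has_derivative_ot_char:
  "(ot_char r has_derivative (\<lambda>h. ot_weight r h * ot_char r t)) (at t)"
proof -
  have "(ot_weight r has_derivative ot_weight r) (at t)"
    by (rule linear_imp_has_derivative [OF linear_ot_weight])
  from has_derivative_compose [OF this DERIV_exp [unfolded has_field_derivative_def]]
  show ?thesis
    by (simp add: ot_char_def [abs_def] mult.commute)
qed

lemma has_derivative_left_invariant_field:
  "(left_invariant_field r v has_derivative
     (\<lambda>h. (0, (\<chi> i. fst h $ i * exp (fst p $ i) * fst (snd v) $ i),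
           ot_weight r (fst h)
             * ot_char r (fst p) * snd (snd v)))) (at p)"
proof -
  have 1: "((\<lambda>x::'a ot_group. (\<chi> i. exp (fst x $ i) * fst (snd v) $ i)) has_derivative
      (\<lambda>h. (\<chi> i. fst h $ i * exp (fst p $ i) * fst (snd v) $ i))) (at p)"
  proof (subst has_derivative_componentwise_within, rule ballI)
    fix e :: "real^'a" assume "e \<in> Basis"
    then obtain i where e: "e = axis i 1"
      by (auto simp: Basis_vec_def)
    have "((\<lambda>x::'a ot_group. fst x $ i) has_derivative (\<lambda>h. fst h $ i)) (at p)"
      by (intro bounded_linear_imp_has_derivative
          bounded_linear_compose [OF bounded_linear_vec_nth bounded_linear_fst])
    from has_derivative_mult_left [OF has_derivative_compose [OF this
          DERIV_exp [unfolded has_field_derivative_def]], of "fst (snd v) $ i"]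
    show "((\<lambda>x::'a ot_group. (\<chi> i. exp (fst x $ i) * fst (snd v) $ i) \<bullet> e) has_derivative
      (\<lambda>h. (\<chi> i. fst h $ i * exp (fst p $ i) * fst (snd v) $ i) \<bullet> e)) (at p)"
      by (simp add: e inner_axis mult.commute)
  qed
  have 2: "((\<lambda>x::'a ot_group. ot_char r (fst x)) has_derivative
      (\<lambda>h. ot_weight r (fst h)
             * ot_char r (fst p))) (at p)"
    using has_derivative_compose [OF has_derivative_fst [OF has_derivative_ident]
        has_derivative_ot_char [of r "fst p"]] by simp
  show ?thesis
    unfolding left_invariant_field_eq [abs_def] ot_scale_def
    by (intro has_derivative_Pair has_derivative_const 1 has_derivative_mult_left 2)
qed

lemma lie_bracket_left_invariant:
  "lie_bracket (left_invariant_field r v) (left_invariant_field r w) =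
   left_invariant_field r
     (0, (\<chi> i. fst v $ i * fst (snd w) $ i - fst w $ i * fst (snd v) $ i),
      ot_weight r (fst v) * snd (snd w)
      - ot_weight r (fst w) * snd (snd v))"
proof
  fix p
  have F: "frechet_derivative (left_invariant_field r v) (at p) =
     (\<lambda>h. (0, (\<chi> i. fst h $ i * exp (fst p $ i) * fst (snd v) $ i),
           ot_weight r (fst h)
             * ot_char r (fst p) * snd (snd v)))" for v
    by (rule frechet_derivative_at [OF has_derivative_left_invariant_field, symmetric])
  show "lie_bracket (left_invariant_field r v) (left_invariant_field r w) p =
    left_invariant_field r
     (0, (\<chi> i. fst v $ i * fst (snd w) $ i - fst w $ i * fst (snd v) $ i),
      ot_weight r (fst v) * snd (snd w)
      - ot_weight r (fst w) * snd (snd v)) p"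
    unfolding lie_bracket_def F
    by (simp add: left_invariant_field_eq ot_scale_def vec_eq_iff algebra_simps)
qed

lemma ot_brackets:
  fixes r :: "real^'s::finite" and i j :: 's
  shows "lie_bracket (left_invariant_field r (basis_A i)) (left_invariant_field r (basis_A j)) = (\<lambda>_. 0)"
    and "lie_bracket (left_invariant_field r (basis_A i)) (left_invariant_field r (basis_B j)) =
           (if i = j then left_invariant_field r (basis_B i) else (\<lambda>_. 0))"
    and "lie_bracket (left_invariant_field r (basis_A i)) (left_invariant_field r basis_C1) =
           left_invariant_field r (- (1/2) *\<^sub>R basis_C1 + r $ i *\<^sub>R basis_C2)"
    and "lie_bracket (left_invariant_field r (basis_A i)) (left_invariant_field r basis_C2) =
           left_invariant_field r (- (r $ i) *\<^sub>R basis_C1 - (1/2) *\<^sub>R basis_C2)"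
    and "lie_bracket (left_invariant_field r (basis_B i)) (left_invariant_field r (basis_B j)) = (\<lambda>_. 0)"
    and "lie_bracket (left_invariant_field r (basis_B i)) (left_invariant_field r basis_C1) = (\<lambda>_. 0)"
    and "lie_bracket (left_invariant_field r (basis_B i)) (left_invariant_field r basis_C2) = (\<lambda>_. 0)"
    and "lie_bracket (left_invariant_field r basis_C1) (left_invariant_field r basis_C2) = (\<lambda>_. 0)"
  by (auto simp: lie_bracket_left_invariant basis_A_def basis_B_def basis_C1_def basis_C2_def
      ot_weight_axis [unfolded axis_def] linear_0 [OF linear_ot_weight] left_invariant_field_eq ot_scale_def fun_eq_iff
      vec_eq_iff zero_prod_def scaleR_conv_of_real axis_def algebra_simps)

lemma lie_metric_basis:
  fixes i j :: "'s::finite"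
  shows "lie_metric (basis_A i) (basis_A j) = (if i = j then 2 else 1)"
    and "lie_metric (basis_B i) (basis_B j) = (if i = j then 2 else 1)"
    and "lie_metric (basis_C1 :: 's ot_group) basis_C1 = 1"
    and "lie_metric (basis_C2 :: 's ot_group) basis_C2 = 1"
    and "lie_metric (basis_C1 :: 's ot_group) basis_C2 = 0"
    and "lie_metric (basis_A i) (basis_B j) = 0"
    and "lie_metric (basis_A i) basis_C1 = 0" and "lie_metric (basis_A i) basis_C2 = 0"
    and "lie_metric (basis_B i) basis_C1 = 0" and "lie_metric (basis_B i) basis_C2 = 0"
proof -
  have *: "(\<Sum>k\<in>UNIV. \<Sum>l\<in>UNIV. (if k = l then 2 else 1) * (axis i 1 $ k * axis j 1 $ l :: real))
      = (if i = j then 2 else 1)"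
    by (simp add: axis_def if_distrib [of "\<lambda>x. _ * x"] sum.delta cong: if_cong)
  show "lie_metric (basis_A i) (basis_A j) = (if i = j then 2 else 1)"
    and "lie_metric (basis_B i) (basis_B j) = (if i = j then 2 else 1)"
    using * by (simp_all add: basis_A_def basis_B_def)
qed (simp_all add: basis_A_def basis_B_def basis_C1_def basis_C2_def)

lemma lie_complex_structure_basis:
  "lie_complex_structure (basis_A i) = basis_B i"
  "lie_complex_structure basis_C1 = basis_C2"
  "lie_complex_structure (lie_complex_structure v) = - v"
  by (cases v; simp add: basis_A_def basis_B_def basis_C1_def basis_C2_def)+


section \<open>Number fields and the lattice\<close>

definition number_field :: "'k::field_char_0 itself \<Rightarrow> bool" where
  "number_field _ \<longleftrightarrow>
     (\<exists>B :: 'k set. finite B \<and> module.span (\<lambda>(q::rat) x. of_rat q * x) B = UNIV)"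

definition field_embedding :: "('k::field \<Rightarrow> complex) \<Rightarrow> bool" where
  "field_embedding f \<longleftrightarrow>
     f 1 = 1 \<and> (\<forall>x y. f (x + y) = f x + f y) \<and> (\<forall>x y. f (x * y) = f x * f y)"

definition real_embedding :: "('k::field \<Rightarrow> complex) \<Rightarrow> bool" where
  "real_embedding f \<longleftrightarrow> field_embedding f \<and> range f \<subseteq> \<real>"

definition positive_units :: "'k::field_char_0 monoid" where
  "positive_units =
     \<lparr>carrier = {u. u \<noteq> 0 \<and> algebraic_int u \<and> algebraic_int (inverse u) \<and>
                    (\<forall>f. real_embedding f \<longrightarrow> 0 < Re (f u))},
      mult = (*), one = 1\<rparr>"

text \<open>
  The image in the group above of the semidirect product of \<open>U\<close> and the ring of integers, when
  \<open>\<tau> u = ot_char r (\<chi> i. ln (Re (\<sigma> i u)))\<close> for \<open>u \<in> U\<close>; such an \<open>r\<close> turns the Oeljeklaus--Toma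
  manifold into a solvmanifold. The map sending \<open>(t, b, z)\<close> to \<open>((\<i> exp t\<^sub>i - b\<^sub>i)\<^sub>i, - z)\<close> is
  biholomorphic onto the product of upper half planes and a complex line, and it intertwines left
  translation by the lattice element of \<open>(u, a)\<close> with
  \<open>(w, z) \<mapsto> ((\<sigma>\<^sub>i(u) w\<^sub>i - \<sigma>\<^sub>i(a))\<^sub>i, \<tau>(u) z - \<tau>(a))\<close>.
\<close>

definition ot_lattice ::
  "('s::finite \<Rightarrow> 'k::field_char_0 \<Rightarrow> complex) \<Rightarrow> ('k \<Rightarrow> complex) \<Rightarrow> 'k set \<Rightarrow> 's ot_group set" where
  "ot_lattice \<sigma> \<tau> U =
     {((\<chi> i. ln (Re (\<sigma> i u))), (\<chi> i. Re (\<sigma> i a)), \<tau> a) | u a. u \<in> U \<and> algebraic_int a}"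

end

theory Submission
  imports Defs
begin

text \<open>
  In the left trivialisation the Bismut connection is an explicit bilinear map
  \<open>\<Lambda> : \<gg> \<times> \<gg> \<rightarrow> \<gg>\<close>, and the transport of a path composed of one-parameter subgroups is a product of
  exponentials of operators \<open>\<Lambda>(X)\<close>. Parallel transport and left translations are unitary, which gives
  one inclusion.

  For the other one, loops in \<open>G\<close> itself suffice. Their transports form a subgroup \<open>H\<close> of the unitary
  group, and the derivatives at \<open>0\<close> of the continuous curves in \<open>H\<close> starting at the identity form a
  real Lie algebra. The loops \<open>exp(A) exp(xX) exp(-A) exp(-x Ad(exp A) X)\<close> show that it contains
  \<open>\<Lambda>(B)\<close> and \<open>\<Lambda>(C)\<close> for all \<open>B\<close> in the span of the \<open>B\<^sub>i\<close> and \<open>C\<close> in the span of \<open>C\<^sub>1, C\<^sub>2\<close>. Writing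
  \<open>E(u, v) = u v\<^sup>* - v u\<^sup>*\<close>, one has \<open>\<Lambda>(c C\<^sub>1) = E(c C\<^sub>1, e) / 2\<close> with \<open>e\<close> dual to the Lee form, and
  \<open>\<Lambda>(B) e\<close> is a multiple of \<open>B\<close>; hence brackets produce every \<open>E(u, v)\<close> up to the trace, and \<open>\<Lambda>(\<Sum>B\<^sub>i)\<close>
  has non-zero trace. So the Lie algebra is the full unitary one. By a Brouwer-type open mapping
  theorem, \<open>H\<close> then contains a neighbourhood of the identity, hence all complex reflections, and these
  generate the unitary group.
\<close>

section \<open>Complex matrices\<close>

text \<open>The group \<open>H\<close> is not assumed closed, so the closed subgroup theorem is out
  of reach, and its tangent vectors come from curves with a derivative at \<open>0\<close> only,
  which rules out the inverse function theorem. The open mapping theorem asks for continuity and one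
  derivative at one point; the chart that goes with it is the skew-Hermitian part, which determines
  a unitary matrix near the identity.

  No curvature is computed. \<open>Ad(exp a)\<close> scales \<open>B_i\<close> by
  \<open>exp(a_i)\<close> and the \<open>C\<close> line by a factor of modulus
  \<open>exp(-\<Sum>a_i / 2)\<close>. Transport along \<open>a\<close> rotates the \<open>C\<close>
  line by the phase of that same factor, so the phases coming from the \<open>r_i\<close> match and
  only the modulus decides. As it can be chosen different from 1, comparing \<open>X\<close> with
  its image under \<open>Ad(exp a)\<close> isolates \<open>\<Lambda>(B)\<close> and
  \<open>\<Lambda>(C)\<close>.

  The matrices \<open>E(u, v)\<close> with orthogonal \<open>u, v\<close> and their brackets all
  have trace zero. The trace is therefore an obstruction of its own, and a single element of
  non-zero trace removes it.\<close>

definition cadjoint :: "complex^'n^'m \<Rightarrow> complex^'m^'n" where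
  "cadjoint A = (\<chi> i j. cnj (A $ j $ i))"

definition unitary_matrix :: "complex^'n::finite^'n \<Rightarrow> bool" where
  "unitary_matrix A \<longleftrightarrow> cadjoint A ** A = mat 1"

definition cinner :: "complex^'n::finite \<Rightarrow> complex^'n \<Rightarrow> complex" where
  "cinner x y = (\<Sum>i\<in>UNIV. x $ i * cnj (y $ i))"

definition outer :: "complex^'n \<Rightarrow> complex^'n \<Rightarrow> complex^'n^'n" where
  "outer u v = (\<chi> i j. u $ i * cnj (v $ j))"

definition skew_outer :: "complex^'n \<Rightarrow> complex^'n \<Rightarrow> complex^'n^'n" where
  "skew_outer u v = outer u v - outer v u"

lemma bilinear_matrix_mult: "bilinear ((**) :: complex^'n::finite^'n \<Rightarrow> _ \<Rightarrow> complex^'n^'n)"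
  unfolding bilinear_def
  by (intro conjI allI linearI matrix_add_ldistrib;
      simp add: matrix_matrix_mult_def vec_eq_iff sum.distrib distrib_right scaleR_sum_right)

interpretation matrix_mult: bounded_bilinear "(**) :: complex^'n::finite^'n \<Rightarrow> _ \<Rightarrow> complex^'n^'n"
  using bilinear_conv_bounded_bilinear bilinear_matrix_mult by blast

lemma linear_cadjoint: "linear (cadjoint :: complex^'n::finite^'n \<Rightarrow> _)"
  by (rule linearI) (auto simp: cadjoint_def vec_eq_iff)

lemma bounded_linear_cadjoint: "bounded_linear (cadjoint :: complex^'n::finite^'n \<Rightarrow> _)"
  using linear_cadjoint linear_conv_bounded_linear by blast

lemmas cadjoint_diff = linear_diff [OF linear_cadjoint]
  and cadjoint_scaleR = linear_scale [OF linear_cadjoint]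

lemma cadjoint_mult: "cadjoint (A ** B) = cadjoint B ** cadjoint A"
  for A B :: "complex^'n::finite^'n"
  by (simp add: cadjoint_def matrix_matrix_mult_def vec_eq_iff mult.commute)

lemma cadjoint_mat_1 [simp]: "cadjoint (mat 1) = mat 1"
  by (simp add: cadjoint_def mat_def vec_eq_iff)

lemma cadjoint_cadjoint [simp]: "cadjoint (cadjoint A) = A"
  by (simp add: cadjoint_def vec_eq_iff)

lemma unitary_matrix_right: "unitary_matrix A \<Longrightarrow> A ** cadjoint A = mat 1"
  by (simp add: unitary_matrix_def matrix_left_right_inverse)

lemma unitary_matrix_cadjoint: "unitary_matrix A \<Longrightarrow> unitary_matrix (cadjoint A)"
  by (simp add: unitary_matrix_def matrix_left_right_inverse)

lemma unitary_matrix_mult: "unitary_matrix A \<Longrightarrow> unitary_matrix B \<Longrightarrow> unitary_matrix (A ** B)"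
  using matrix_mul_assoc [of "cadjoint B" "cadjoint A" "A ** B"] matrix_mul_assoc [of "cadjoint A" A B]
  by (simp add: unitary_matrix_def cadjoint_mult)

lemma cinner_cadjoint: "cinner (A *v x) y = cinner x (cadjoint A *v y)"
proof -
  have "cinner (A *v x) y = (\<Sum>i\<in>UNIV. \<Sum>j\<in>UNIV. A $ i $ j * x $ j * cnj (y $ i))"
    by (simp add: cinner_def matrix_vector_mult_def sum_distrib_right)
  also have "\<dots> = (\<Sum>j\<in>UNIV. \<Sum>i\<in>UNIV. A $ i $ j * x $ j * cnj (y $ i))"
    by (rule sum.swap)
  also have "\<dots> = cinner x (cadjoint A *v y)"
    by (simp add: cinner_def matrix_vector_mult_def cadjoint_def sum_distrib_left mult_ac)
  finally show ?thesis .
qed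

lemma unitary_cinner: "unitary_matrix A \<Longrightarrow> cinner (A *v x) (A *v y) = cinner x y"
  by (simp add: cinner_cadjoint matrix_vector_mul_assoc unitary_matrix_def)

lemma cinner_commute: "cinner y x = cnj (cinner x y)"
  by (simp add: cinner_def mult.commute)

lemma cinner_simps [simp]:
  "cinner (x + y) z = cinner x z + cinner y z" "cinner (x - y) z = cinner x z - cinner y z"
  "cinner z (x + y) = cinner z x + cinner z y" "cinner z (x - y) = cinner z x - cinner z y"
  "cinner (c *s x) y = c * cinner x y" "cinner x (c *s y) = cnj c * cinner x y"
  "cinner 0 x = 0" "cinner x 0 = 0"
  by (simp_all add: cinner_def sum.distrib sum_subtractf sum_distrib_left algebra_simps)

lemma cinner_axis [simp]: "cinner x (axis i 1) = x $ i"
proof -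
  have "x $ j * cnj (axis i 1 $ j) = (if j = i then x $ j else 0)" for j
    by (simp add: axis_def)
  then show ?thesis
    by (simp add: cinner_def)
qed

lemma Re_cinner: "Re (cinner x y) = x \<bullet> y"
  by (simp add: cinner_def inner_vec_def inner_complex_def)

lemma cinner_self: "cinner x x = of_real ((norm x)\<^sup>2)"
proof -
  have "cnj (cinner x x) = cinner x x"
    using cinner_commute [of x x] by simp
  then have "Im (cinner x x) = 0"
    by (metis add.inverse_inverse cnj.simps(2) neg_equal_zero)
  moreover have "Re (cinner x x) = (norm x)\<^sup>2"
    by (simp add: Re_cinner power2_norm_eq_inner)
  ultimately show ?thesis
    by (simp add: complex_eq_iff)
qed

lemma unitary_norm:
  assumes "unitary_matrix A"
  shows "norm (A *v x) = norm x"
proof -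
  have "complex_of_real ((norm (A *v x))\<^sup>2) = complex_of_real ((norm x)\<^sup>2)"
    using unitary_cinner [OF assms, of x x] by (simp only: cinner_self)
  then show ?thesis
    by (simp only: of_real_eq_iff power2_eq_iff_nonneg norm_ge_zero)
qed

lemma outer_mult_vector: "outer u v *v x = cinner x v *s u"
  by (simp add: outer_def matrix_vector_mult_def cinner_def vec_eq_iff sum_distrib_left
      sum_distrib_right mult_ac)

lemma matrix_mult_outer: "A ** outer u v = outer (A *v u) v"
  by (simp add: outer_def matrix_matrix_mult_def matrix_vector_mult_def vec_eq_iff
      sum_distrib_left mult_ac)

lemma outer_mult_matrix: "outer u v ** cadjoint A = outer u (A *v v)"
  by (simp add: outer_def matrix_matrix_mult_def matrix_vector_mult_def vec_eq_iff cadjoint_def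
      sum_distrib_left mult_ac)

text \<open>Conjugation acts on each slot of \<open>skew_outer\<close>, so its infinitesimal form is
  a Leibniz rule. For skew-Hermitian \<open>A\<close> the left side is a commutator; every bracket
  below is evaluated this way.\<close>

lemma skew_outer_conj:
  "A ** skew_outer u v + skew_outer u v ** cadjoint A = skew_outer (A *v u) v + skew_outer u (A *v v)"
  by (simp add: skew_outer_def matrix_mult.diff_left matrix_mult.diff_right matrix_mult_outer
      outer_mult_matrix)

lemma skew_outer_add:
  "skew_outer u (v + w) = skew_outer u v + skew_outer u w"
  "skew_outer (v + w) u = skew_outer v u + skew_outer w u"
  "skew_outer u (v - w) = skew_outer u v - skew_outer u w"
  "skew_outer (v - w) u = skew_outer v u - skew_outer w u"
  by (simp_all add: skew_outer_def outer_def vec_eq_iff algebra_simps)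

lemma skew_outer_scaleR:
  "skew_outer (a *\<^sub>R u) v = a *\<^sub>R skew_outer u v" "skew_outer u (a *\<^sub>R v) = a *\<^sub>R skew_outer u v"
  by (simp_all add: skew_outer_def outer_def vec_eq_iff algebra_simps)

lemma skew_outer_minus: "skew_outer (- u) v = - skew_outer u v"
  by (simp add: skew_outer_def outer_def vec_eq_iff)

lemma skew_outer_scale: "skew_outer u (c *s v) = skew_outer (cnj c *s u) v"
  by (simp add: skew_outer_def outer_def vec_eq_iff algebra_simps)

lemma skew_outer_commute: "skew_outer v u = - skew_outer u v"
  by (simp add: skew_outer_def)

lemma skew_outer_0 [simp]: "skew_outer 0 u = 0" "skew_outer u 0 = 0"
  by (simp_all add: skew_outer_def outer_def vec_eq_iff)

lemma skew_outer_mult_vector: "skew_outer u v *v x = cinner x v *s u - cinner x u *s v"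
  by (simp add: skew_outer_def matrix_vector_mult_diff_rdistrib outer_mult_vector)

text \<open>The double sum is \<open>K - cadjoint K\<close>, that is \<open>2 K\<close>, hence the
  factor 1/2. Membership in a real subspace is thereby reduced to elementary
  \<open>skew_outer\<close> matrices.\<close>

lemma skew_hermitian_decompose:
  fixes K :: "complex^'n::finite^'n"
  assumes "cadjoint K = - K"
  shows "K = (1/2) *\<^sub>R (\<Sum>j\<in>UNIV. \<Sum>k\<in>UNIV. skew_outer (K $ j $ k *s axis j 1) (axis k 1))"
proof -
  have *: "skew_outer (K $ j $ k *s axis j 1) (axis k 1) $ a $ b
      = (if j = a then if k = b then K $ j $ k else 0 else 0)
        - (if k = a then if j = b then cnj (K $ j $ k) else 0 else 0)" for j k a b
    by (simp add: skew_outer_def outer_def axis_def)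
  have "(\<Sum>j\<in>UNIV. \<Sum>k\<in>UNIV. skew_outer (K $ j $ k *s axis j 1) (axis k 1)) $ a $ b
      = K $ a $ b - cnj (K $ b $ a)" for a b
  proof -
    have 1: "(\<Sum>j\<in>UNIV. \<Sum>k\<in>UNIV. (if j = a then if k = b then K $ j $ k else 0 else 0)) = K $ a $ b"
      by (subst sum.swap) simp
    have 2: "(\<Sum>j\<in>UNIV. \<Sum>k\<in>UNIV. (if k = a then if j = b then cnj (K $ j $ k) else 0 else 0))
       = cnj (K $ b $ a)"
      by simp
    show ?thesis
      by (simp only: sum_component * sum_subtractf 1 2)
  qed
  moreover have "cnj (K $ b $ a) = - (K $ a $ b)" for a b
    using arg_cong [OF assms, of "\<lambda>X. X $ a $ b"] by (simp add: cadjoint_def)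
  ultimately show ?thesis
    by (simp add: vec_eq_iff)
qed

section \<open>Hermitian and skew-Hermitian parts of a unitary matrix\<close>

definition skew_part :: "complex^'n::finite^'n \<Rightarrow> complex^'n^'n" where
  "skew_part Y = (1/2) *\<^sub>R (Y - cadjoint Y)"
definition herm_part :: "complex^'n::finite^'n \<Rightarrow> complex^'n^'n" where
  "herm_part Y = (1/2) *\<^sub>R (Y + cadjoint Y)"

lemma bounded_linear_skew_part: "bounded_linear skew_part"
    unfolding skew_part_def
    by (intro bounded_linear_const_scaleR bounded_linear_sub bounded_linear_ident
        bounded_linear_cadjoint)
lemma half_eq: "(1/2) *\<^sub>R (x + x) = (x::'a::real_vector)"
  by (simp flip: scaleR_2)

lemma cadjoint_skew_part: "cadjoint (skew_part Y) = - skew_part Y"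
  by (simp add: skew_part_def cadjoint_diff cadjoint_scaleR scaleR_diff_right)
lemma skew_part_skew: "cadjoint Y = - Y \<Longrightarrow> skew_part Y = Y"
  by (simp add: skew_part_def half_eq)
lemma skew_part_skew_part: "skew_part (skew_part Y) = skew_part Y"
  by (simp add: skew_part_skew cadjoint_skew_part)
lemma skew_part_add_herm_part: "herm_part Y + skew_part Y = Y"
  "herm_part Y - skew_part Y = cadjoint Y"
  by (simp_all add: skew_part_def herm_part_def half_eq flip: scaleR_add_right scaleR_diff_right)

lemma norm_cadjoint: "norm (cadjoint X) = norm X"
      proof -
        have "(norm (cadjoint X))\<^sup>2 = (norm X)\<^sup>2"
          unfolding power2_norm_eq_inner inner_vec_def
          by (subst sum.swap) (simp add: cadjoint_def inner_complex_def)
        then show ?thesis by simp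
      qed

text \<open>Write \<open>Y = h + k\<close> with adjoint \<open>h - k\<close>. In the average of
  \<open>cadjoint Y ** Y\<close> and \<open>Y ** cadjoint Y\<close> the mixed terms cancel, which
  leaves \<open>h ** h - k ** k\<close>.\<close>

lemma herm_part_square:
  assumes "unitary_matrix Y"
  shows "herm_part Y ** herm_part Y = mat 1 + skew_part Y ** skew_part Y"
proof -
  let ?h = "herm_part Y" and ?k = "skew_part Y"
  have "(?h - ?k) ** (?h + ?k) = mat 1"
    using assms unfolding skew_part_add_herm_part unitary_matrix_def .
  moreover have "(?h + ?k) ** (?h - ?k) = mat 1"
    using unitary_matrix_right [OF assms] unfolding skew_part_add_herm_part .
  moreover have "2 *\<^sub>R (?h ** ?h) =
          (?h - ?k) ** (?h + ?k) + (?h + ?k) ** (?h - ?k) + 2 *\<^sub>R (?k ** ?k)"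
    by (simp only: matrix_mult.add_left matrix_mult.add_right matrix_mult.diff_left
            matrix_mult.diff_right scaleR_2) simp
  ultimately have "2 *\<^sub>R (?h ** ?h) = 2 *\<^sub>R (mat 1 + ?k ** ?k)"
    by (simp add: scaleR_2)
  then show ?thesis by simp
qed
lemma norm_herm_part_diff: "norm (herm_part Y - mat 1) \<le> norm (Y - mat 1)"
    proof -
      have "herm_part Y - mat 1 = (1/2) *\<^sub>R ((Y - mat 1) + cadjoint (Y - mat 1))"
        using half_eq [of "mat 1 :: complex^'a^'a"]
        by (simp add: herm_part_def cadjoint_diff flip: scaleR_diff_right) (simp add: scaleR_diff_right scaleR_add_right)
      then show ?thesis
        using norm_triangle_ineq [of "Y - mat 1" "cadjoint (Y - mat 1)"] norm_cadjoint [of "Y - mat 1"]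
        by simp
    qed

text \<open>By \<open>herm_part_square\<close> the Hermitian part is a square root of a matrix fixed
  by the skew part, and close to the identity such a root is unique. So the skew part is a local
  chart of the unitary group.\<close>

lemma unitary_determined_by_skew_part:
  obtains \<eta> where "\<eta> > 0"
    "\<And>(A :: complex^'n::finite^'n) B. unitary_matrix A \<Longrightarrow> unitary_matrix B \<Longrightarrow>
       norm (A - mat 1) < \<eta> \<Longrightarrow> norm (B - mat 1) < \<eta> \<Longrightarrow> skew_part A = skew_part B \<Longrightarrow> A = B"
proof -
  from matrix_mult.pos_bounded [where 'n = 'n] obtain C
    where C: "C > 0" "\<And>(X :: complex^'n^'n) (Y :: complex^'n^'n). norm (X ** Y) \<le> norm X * norm Y * C"
    by auto
  show ?thesis
  proof (rule that)
    show "1 / C > 0"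
      using C by simp
    fix A B :: "complex^'n^'n"
    assume A: "unitary_matrix A" "norm (A - mat 1) < 1 / C"
      and B: "unitary_matrix B" "norm (B - mat 1) < 1 / C" and eq: "skew_part A = skew_part B"
    let ?h = herm_part
    define D where "D = ?h A - ?h B"
    define a b where "a = ?h A - mat 1" and "b = ?h B - mat 1"
    \<comment> \<open>Equality of the squares reads \<open>?h A ** D + D ** ?h B = 0\<close>.
      Splitting the identity off both factors makes \<open>2 D\<close> equal to a term whose norm is
      below \<open>2 * norm D\<close> unless \<open>D = 0\<close>; the radius \<open>1 / C\<close>
      is chosen for this.\<close>
    have "?h A ** ?h A - ?h B ** ?h B = 0"
      using herm_part_square [OF A(1)] herm_part_square [OF B(1)] eq by simp
    moreover have "?h A ** ?h A - ?h B ** ?h B = ?h A ** D + D ** ?h B"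
      by (simp add: D_def matrix_mult.diff_left matrix_mult.diff_right)
    moreover have "?h A ** D = a ** D + D" "D ** ?h B = D ** b + D"
      unfolding a_def b_def by (simp_all only: matrix_mult.diff_left matrix_mult.diff_right
          matrix_mul_lid matrix_mul_rid diff_add_cancel)
    ultimately have "2 *\<^sub>R D + (a ** D + D ** b) = 0"
      unfolding scaleR_2 by (simp only: add_ac)
    then have "2 *\<^sub>R D = - (a ** D + D ** b)"
      by (rule eq_neg_iff_add_eq_0 [THEN iffD2])
    then have "2 * norm D = norm (a ** D + D ** b)"
      using norm_scaleR [of 2 D] norm_minus_cancel [of "a ** D + D ** b"] by simp
    also have "\<dots> \<le> norm a * norm D * C + norm D * norm b * C"
      by (intro norm_triangle_mono C)
    also have "\<dots> = (norm a + norm b) * C * norm D"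
      by (simp add: algebra_simps)
    finally have le: "2 * norm D \<le> (norm a + norm b) * C * norm D" .
    have "norm a + norm b < 2 * (1 / C)"
      using norm_herm_part_diff [of A] norm_herm_part_diff [of B] A B
      unfolding a_def b_def by linarith
    then have lt: "(norm a + norm b) * C < 2"
      using C by (simp add: field_simps)
    have "norm D = 0"
    proof (rule ccontr)
      assume "norm D \<noteq> 0"
      then have "(norm a + norm b) * C * norm D < 2 * norm D"
        using lt by (intro mult_strict_right_mono) auto
      with le show False by simp
    qed
    then have "?h A = ?h B"
      by (simp add: D_def)
    then show "A = B"
      using skew_part_add_herm_part(1) eq by metis
  qed
qed


section \<open>Complex reflections\<close>

text \<open>For a unit vector \<open>v\<close> this has eigenvalue \<open>c\<close> on the line of
  \<open>v\<close> and is the identity on the orthogonal complement.\<close>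

definition reflect :: "complex^'n::finite \<Rightarrow> complex \<Rightarrow> complex^'n^'n" where
  "reflect v c = mat 1 + outer ((c - 1) *s v) v"

lemma reflect_1 [simp]: "reflect v 1 = mat 1"
  by (simp add: reflect_def outer_def vec_eq_iff)

lemma reflect_mult_vector: "reflect v c *v x = x + ((c - 1) * cinner x v) *s v"
  by (simp add: reflect_def matrix_vector_mult_add_rdistrib outer_mult_vector)
     (simp add: vec_eq_iff algebra_simps)

lemma reflect_mult:
  assumes "norm v = 1"
  shows "reflect v a ** reflect v b = reflect v (a * b)"
proof (rule matrix_eq [THEN iffD2], rule allI)
  fix x
  have "cinner v v = 1"
    by (simp add: cinner_self assms)
  then show "(reflect v a ** reflect v b) *v x = reflect v (a * b) *v x"
    by (simp add: reflect_mult_vector flip: matrix_vector_mul_assoc)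
       (simp add: vec_eq_iff algebra_simps)
qed

lemma cadjoint_reflect: "cadjoint (reflect v c) = reflect v (cnj c)"
  by (simp add: reflect_def cadjoint_def outer_def mat_def vec_eq_iff algebra_simps)

lemma unitary_reflect:
  assumes "norm v = 1" "norm c = 1"
  shows "unitary_matrix (reflect v c)"
proof -
  have "cnj c * c = 1"
    using assms(2) by (metis complex_norm_square mult.commute of_real_1 one_power2)
  then show ?thesis
    by (simp add: unitary_matrix_def cadjoint_reflect reflect_mult [OF assms(1)])
qed

lemma tendsto_reflect: "(reflect v \<longlongrightarrow> reflect v c) (at c)"
proof -
  have "linear (\<lambda>c. outer (c *s v) v)"
    by (rule linearI) (auto simp: outer_def vec_eq_iff algebra_simps)
  then have "bounded_linear (\<lambda>c. outer (c *s v) v)"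
    by (simp add: linear_conv_bounded_linear)
  then have "((\<lambda>c. outer ((c - 1) *s v) v) \<longlongrightarrow> outer ((c - 1) *s v) v) (at c)"
    by (rule bounded_linear.tendsto) (intro tendsto_intros)
  then show ?thesis
    unfolding reflect_def [abs_def] by (intro tendsto_intros)
qed

text \<open>With \<open>\<zeta> = 1 - \<langle>x, y\<rangle>\<close> one has \<open>|x - y|\<^sup>2 = \<zeta> + cnj \<zeta>\<close>, so the reflection in the direction of
  \<open>x - y\<close> with eigenvalue \<open>- cnj \<zeta> / \<zeta>\<close> maps \<open>x\<close> to \<open>y\<close>.\<close>

lemma reflect_transitive:
  assumes "norm x = 1" "norm y = 1" "x \<noteq> y"
  obtains v c where "norm v = 1" "norm c = 1" "reflect v c *v x = y"
    "\<And>u. cinner u x = 0 \<Longrightarrow> cinner u y = 0 \<Longrightarrow> reflect v c *v u = u"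
proof -
  define d where "d = x - y"
  define \<zeta> where "\<zeta> = 1 - cinner x y"
  define v where "v = complex_of_real (1 / norm d) *s d"
  define c where "c = - (cnj \<zeta> / \<zeta>)"
  have d: "norm d > 0"
    using assms by (simp add: d_def)
  have x: "cinner x x = 1" "cinner y y = 1"
    by (simp_all add: cinner_self assms)
  have "cinner d d = \<zeta> + cnj \<zeta>"
    by (simp add: d_def \<zeta>_def x cinner_commute [of y x])
  then have dd: "complex_of_real ((norm d)\<^sup>2) = \<zeta> + cnj \<zeta>"
    by (simp add: cinner_self)
  then have "\<zeta> \<noteq> 0"
    using d by auto
  have "norm v = norm d * \<bar>1 / norm d\<bar>"
  proof -
    have "v = (1 / norm d) *\<^sub>R d"
      unfolding v_def vec_eq_iff vector_smult_component vector_scaleR_component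
      by (simp add: scaleR_conv_of_real)
    then show ?thesis
      by simp
  qed
  then have v: "norm v = 1"
    using d by simp
  have xd: "cinner x d = \<zeta>"
    by (simp add: d_def \<zeta>_def x)
  have "((c - 1) * cinner x v) *s v = (((c - 1) * \<zeta>) / complex_of_real ((norm d)\<^sup>2)) *s d"
    by (simp add: v_def xd power2_eq_square vec_eq_iff)
  also have "(c - 1) * \<zeta> = - complex_of_real ((norm d)\<^sup>2)"
    unfolding dd using \<open>\<zeta> \<noteq> 0\<close> by (simp add: c_def field_simps)
  finally have "((c - 1) * cinner x v) *s v = - d"
    using d by simp
  then have "reflect v c *v x = y"
    by (simp add: reflect_mult_vector d_def)
  moreover have "norm c = 1"
    using \<open>\<zeta> \<noteq> 0\<close> by (simp add: c_def norm_divide)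
  moreover have "reflect v c *v u = u" if "cinner u x = 0" "cinner u y = 0" for u
    using that by (simp add: reflect_mult_vector v_def d_def)
  ultimately show ?thesis
    using v that by blast
qed

section \<open>The tangent space of a subgroup of the unitary group\<close>

locale unitary_subgroup =
  fixes H :: "(complex^'n::finite^'n) set"
  assumes one: "mat 1 \<in> H"
    and mult: "A \<in> H \<Longrightarrow> B \<in> H \<Longrightarrow> A ** B \<in> H"
    and adj: "A \<in> H \<Longrightarrow> cadjoint A \<in> H"
    and unitary: "A \<in> H \<Longrightarrow> unitary_matrix A"
begin

text \<open>The curves are defined on the whole line so that they can be reparametrised by
  \<open>c * t\<close>. Continuity together with a derivative at \<open>0\<close> survives products
  and conjugation, and suffices for the open mapping argument.\<close>

definition tangent :: "(complex^'n^'n) set" where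
  "tangent = {F. \<exists>\<gamma>. range \<gamma> \<subseteq> H \<and> continuous_on UNIV \<gamma> \<and> \<gamma> 0 = mat 1 \<and>
     (\<gamma> has_vector_derivative F) (at (0::real))}"

lemma tangentI:
  assumes "\<And>t. \<gamma> t \<in> H" "continuous_on UNIV \<gamma>" "\<gamma> 0 = mat 1"
    "(\<gamma> has_vector_derivative F) (at (0::real))"
  shows "F \<in> tangent"
  using assms by (auto simp: tangent_def)

lemma tangentE:
  assumes "F \<in> tangent"
  obtains \<gamma> where "\<And>t. \<gamma> t \<in> H" "continuous_on UNIV \<gamma>" "\<gamma> 0 = mat 1"
    "(\<gamma> has_vector_derivative F) (at (0::real))"
  using assms by (auto simp: tangent_def)

text \<open>Products of curves through the identity add their derivatives, and a linear change of
  parameter scales them.\<close>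

lemma subspace_tangent: "subspace tangent"
proof (rule subspaceI)
  show "0 \<in> tangent"
    by (rule tangentI [of "\<lambda>_. mat 1"]) (auto simp: one)
next
  fix F G assume "F \<in> tangent" "G \<in> tangent"
  then obtain f g where f: "\<And>t. f t \<in> H" "continuous_on UNIV f" "f 0 = mat 1"
      "(f has_vector_derivative F) (at (0::real))"
    and g: "\<And>t. g t \<in> H" "continuous_on UNIV g" "g 0 = mat 1"
      "(g has_vector_derivative G) (at (0::real))"
    by (metis tangentE)
  have "((\<lambda>t. f t ** g t) has_vector_derivative F + G) (at 0)"
    using matrix_mult.has_vector_derivative [OF f(4) g(4)] by (simp add: f g add.commute)
  then show "F + G \<in> tangent"
    by (intro tangentI [of "\<lambda>t. f t ** g t"] mult f g matrix_mult.continuous_on)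
      (auto simp: f g)
next
  fix F c assume "F \<in> tangent"
  then obtain f where f: "\<And>t. f t \<in> H" "continuous_on UNIV f" "f 0 = mat 1"
      "(f has_vector_derivative F) (at (0::real))"
    by (metis tangentE)
  have "((\<lambda>t. c * t) has_vector_derivative c) (at (0::real))"
    by (auto intro!: derivative_eq_intros)
  from vector_diff_chain_at [OF this, of f F] have "((\<lambda>t. f (c * t)) has_vector_derivative c *\<^sub>R F) (at 0)"
    by (simp add: f o_def)
  then show "c *\<^sub>R F \<in> tangent"
    by (intro tangentI [of "\<lambda>t. f (c * t)"] f continuous_on_compose2 [OF f(2)] continuous_intros)
      (auto simp: f)
qed

text \<open>A subspace of a finite-dimensional space is closed, so the limit of difference quotients
  stays in it. This turns a curve of tangent vectors into a new tangent vector.\<close>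

lemma derivative_in_tangent:
  assumes "\<And>t. f t \<in> tangent" "(f has_vector_derivative F) (at (0::real))"
  shows "F \<in> tangent"
proof (rule Lim_in_closed_set [OF closed_subspace [OF subspace_tangent]])
  show "((\<lambda>t. (f t - f 0) /\<^sub>R t) \<longlongrightarrow> F) (at 0)"
  proof (rule Lim_null_comparison [THEN Lim_null [THEN iffD2]])
    show "((\<lambda>t. norm (f t - f 0 - t *\<^sub>R F) / norm t) \<longlongrightarrow> 0) (at 0)"
      using assms(2) by (simp add: has_vector_derivative_def has_derivative_iff_norm)
    have "norm ((f t - f 0) /\<^sub>R t - F) = norm (f t - f 0 - t *\<^sub>R F) / norm t" if "t \<noteq> 0" for t
    proof -
      have "(f t - f 0) /\<^sub>R t - F = (f t - f 0 - t *\<^sub>R F) /\<^sub>R t"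
        using that by (simp add: scaleR_diff_right)
      then show ?thesis
        by (simp add: divide_inverse mult.commute)
    qed
    then show "\<forall>\<^sub>F t in at 0. norm ((f t - f 0) /\<^sub>R t - F) \<le> norm (f t - f 0 - t *\<^sub>R F) / norm t"
      by (auto simp: eventually_at_filter)
  qed
  show "\<forall>\<^sub>F t in at 0. (f t - f 0) /\<^sub>R t \<in> tangent"
    by (intro always_eventually allI subspace_scale subspace_diff subspace_tangent assms)
qed simp

text \<open>Differentiate the curve \<open>g t ** F ** cadjoint (g t)\<close> of tangent vectors at
  \<open>0\<close>. Since \<open>G\<close> is skew-Hermitian this is the commutator; the form with
  \<open>cadjoint G\<close> spares a proof of that and fits \<open>skew_outer_conj\<close>.\<close>

lemma tangent_bracket:
  assumes "G \<in> tangent" "F \<in> tangent"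
  shows "G ** F + F ** cadjoint G \<in> tangent"
proof -
  obtain g where g: "\<And>t. g t \<in> H" "continuous_on UNIV g" "g 0 = mat 1"
      "(g has_vector_derivative G) (at (0::real))"
    using assms by (metis tangentE)
  obtain f where f: "\<And>t. f t \<in> H" "continuous_on UNIV f" "f 0 = mat 1"
      "(f has_vector_derivative F) (at (0::real))"
    using assms by (metis tangentE)
  have 1: "g t ** F ** cadjoint (g t) \<in> tangent" for t
  proof (rule tangentI)
    show "g t ** f x ** cadjoint (g t) \<in> H" for x
      by (intro mult adj f g)
    show "continuous_on UNIV (\<lambda>x. g t ** f x ** cadjoint (g t))"
      by (intro matrix_mult.continuous_on f continuous_intros)
    show "g t ** f 0 ** cadjoint (g t) = mat 1"
      by (simp add: f unitary_matrix_right unitary g)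
    show "((\<lambda>x. g t ** f x ** cadjoint (g t)) has_vector_derivative g t ** F ** cadjoint (g t)) (at 0)"
      by (intro bounded_linear.has_vector_derivative [OF matrix_mult.bounded_linear_left]
          bounded_linear.has_vector_derivative [OF matrix_mult.bounded_linear_right] f)
  qed
  have "((\<lambda>t. (g t ** F) ** cadjoint (g t)) has_vector_derivative
      (g 0 ** F) ** cadjoint G + (G ** F) ** cadjoint (g 0)) (at 0)"
    by (intro matrix_mult.has_vector_derivative bounded_linear.has_vector_derivative [OF bounded_linear_cadjoint] g
          bounded_linear.has_vector_derivative [OF matrix_mult.bounded_linear_left])
  then have "((\<lambda>t. (g t ** F) ** cadjoint (g t)) has_vector_derivative
      G ** F + F ** cadjoint G) (at 0)"
    by (simp add: g add.commute)
  from derivative_in_tangent [OF 1 this] show ?thesis .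
qed

text \<open>Coordinates of the second kind: over an orthonormal basis, multiply the curves tangent
  to \<open>P b\<close>, each run for time \<open>Y \<bullet> b\<close>.\<close>

lemma tangent_map:
  fixes P :: "complex^'n^'n \<Rightarrow> complex^'n^'n"
  assumes P: "linear P" "range P \<subseteq> tangent"
  shows "\<exists>\<Phi>. range \<Phi> \<subseteq> H \<and> continuous_on UNIV \<Phi> \<and> \<Phi> 0 = mat 1 \<and> (\<Phi> has_derivative P) (at 0)"
proof -
  have "\<exists>\<Phi>. range \<Phi> \<subseteq> H \<and> continuous_on UNIV \<Phi> \<and> \<Phi> 0 = mat 1 \<and>
      (\<Phi> has_derivative (\<lambda>Y. \<Sum>b\<in>B. (Y \<bullet> b) *\<^sub>R P b)) (at 0)" if "finite B" for B
    using that
  proof (induction B rule: finite_induct)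
    case empty
    show ?case
      by (rule exI [of _ "\<lambda>_. mat 1"]) (simp add: one image_subset_iff)
  next
    case (insert b B)
    then obtain \<Phi> where \<Phi>: "range \<Phi> \<subseteq> H" "continuous_on UNIV \<Phi>" "\<Phi> 0 = mat 1"
        "(\<Phi> has_derivative (\<lambda>Y. \<Sum>b\<in>B. (Y \<bullet> b) *\<^sub>R P b)) (at 0)"
      by blast
    have "P b \<in> tangent"
      using P by blast
    then obtain f where f: "\<And>t. f t \<in> H" "continuous_on UNIV f" "f 0 = mat 1"
        "(f has_vector_derivative P b) (at (0::real))"
      by (metis tangentE)
    have "((\<lambda>Y. f (Y \<bullet> b)) has_derivative (\<lambda>Y. (Y \<bullet> b) *\<^sub>R P b)) (at 0)"
      by (rule has_derivative_compose [of "\<lambda>Y. Y \<bullet> b" "\<lambda>Y. Y \<bullet> b"])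
        (use f(4) in \<open>auto simp: has_vector_derivative_def intro!: derivative_eq_intros\<close>)
    from matrix_mult.FDERIV [OF this \<Phi>(4)]
    have "((\<lambda>Y. f (Y \<bullet> b) ** \<Phi> Y) has_derivative (\<lambda>Y. \<Sum>b\<in>insert b B. (Y \<bullet> b) *\<^sub>R P b)) (at 0)"
      using insert.hyps by (simp add: f \<Phi> add.commute)
    moreover have "continuous_on UNIV (\<lambda>Y. f (Y \<bullet> b) ** \<Phi> Y)"
      by (intro matrix_mult.continuous_on \<Phi> continuous_on_compose2 [OF f(2)] continuous_intros) auto
    ultimately show ?case
      using \<Phi> f by (intro exI [of _ "\<lambda>Y. f (Y \<bullet> b) ** \<Phi> Y"]) (auto intro!: mult)
  qed
  from this [OF finite_Basis] show ?thesis
    by (simp add: linear_sum [OF P(1), symmetric] linear_scale [OF P(1), symmetric]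
        euclidean_representation)
qed

text \<open>The skew parts of the \<open>\<Phi> Y\<close> with small \<open>Y\<close> fill a
  neighbourhood of \<open>0\<close> among skew-Hermitian matrices. A unitary \<open>A\<close> near
  the identity thus shares its skew part with some nearby \<open>\<Phi> Y\<close>, hence equals
  it.\<close>

lemma contains_neighbourhood:
  assumes full: "\<And>K. cadjoint K = - K \<Longrightarrow> K \<in> tangent"
  obtains \<delta> where "\<delta> > 0" "\<And>A. unitary_matrix A \<Longrightarrow> norm (A - mat 1) < \<delta> \<Longrightarrow> A \<in> H"
proof -
  interpret P: bounded_linear "skew_part :: complex^'n^'n \<Rightarrow> _"
    by (rule bounded_linear_skew_part)
  have "range skew_part \<subseteq> tangent"
    by (auto intro!: full cadjoint_skew_part)
  from tangent_map [OF P.linear this] obtain \<Phi>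
    where \<Phi>: "range \<Phi> \<subseteq> H" "continuous_on UNIV \<Phi>" "\<Phi> 0 = mat 1" "(\<Phi> has_derivative skew_part) (at 0)"
    by blast
  obtain \<eta> where "\<eta> > 0" and inj: "\<And>(A :: complex^'n^'n) B. unitary_matrix A \<Longrightarrow> unitary_matrix B \<Longrightarrow>
       norm (A - mat 1) < \<eta> \<Longrightarrow> norm (B - mat 1) < \<eta> \<Longrightarrow> skew_part A = skew_part B \<Longrightarrow> A = B"
    using unitary_determined_by_skew_part by blast
  have "\<exists>\<epsilon>>0. \<forall>Y. dist Y 0 < \<epsilon> \<longrightarrow> dist (\<Phi> Y) (\<Phi> 0) < \<eta>"
    using \<Phi>(2) \<open>\<eta> > 0\<close> unfolding continuous_on_iff by (metis UNIV_I)
  then obtain \<epsilon> where \<epsilon>: "\<epsilon> > 0" "\<And>Y. norm Y < \<epsilon> \<Longrightarrow> norm (\<Phi> Y - mat 1) < \<eta>"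
    by (auto simp: dist_norm \<Phi>)
  \<comment> \<open>The summand \<open>Y - skew_part Y\<close> fills the complement of the skew-Hermitian matrices, so that the
    derivative at \<open>0\<close> is the identity.\<close>
  define f where "f Y = skew_part (\<Phi> Y) + (Y - skew_part Y)" for Y
  have "f 0 \<in> interior (f ` ball 0 \<epsilon>)"
  proof (rule sussmann_open_mapping [where S = UNIV and f' = id and g' = id])
    show "continuous_on UNIV f"
      unfolding f_def by (intro continuous_intros P.continuous_on \<Phi>)
    have "(f has_derivative (\<lambda>h. skew_part (skew_part h) + (h - skew_part h))) (at 0)"
      unfolding f_def
      by (intro has_derivative_add has_derivative_diff P.has_derivative \<Phi> has_derivative_ident)
    then show "(f has_derivative id) (at 0)"
      by (simp add: skew_part_skew_part id_def)
    show "bounded_linear (id :: complex^'n^'n \<Rightarrow> _)"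
      by (simp add: id_def)
  qed (use \<epsilon> in auto)
  moreover have skew1: "skew_part (mat 1) = 0"
    by (simp add: skew_part_def)
  then have "f 0 = 0"
    by (simp add: f_def \<Phi>(3) P.zero)
  ultimately have "0 \<in> interior (f ` ball 0 \<epsilon>)"
    by simp
  then obtain \<rho> where \<rho>: "\<rho> > 0" "ball 0 \<rho> \<subseteq> f ` ball 0 \<epsilon>"
    by (auto simp: mem_interior)
  obtain L where L: "L > 0" "\<And>X :: complex^'n^'n. norm (skew_part X) \<le> norm X * L"
    using P.pos_bounded by blast
  show ?thesis
  proof (rule that)
    show "min \<eta> (\<rho> / L) > 0"
      using \<open>\<eta> > 0\<close> \<rho> L by simp
    fix A :: "complex^'n^'n"
    assume A: "unitary_matrix A" "norm (A - mat 1) < min \<eta> (\<rho> / L)"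
    have "norm (skew_part A) = norm (skew_part (A - mat 1))"
      by (simp add: P.diff skew1)
    also have "\<dots> \<le> norm (A - mat 1) * L"
      by (rule L)
    also have "\<dots> < \<rho>"
      using A L by (simp add: field_simps)
    finally have "skew_part A \<in> ball 0 \<rho>"
      by simp
    then obtain Y where Y: "skew_part A = f Y" "norm Y < \<epsilon>"
      using \<rho>(2) by auto
    \<comment> \<open>The auxiliary summand of \<open>f\<close> has zero skew part, so projecting
      the equation discards it.\<close>
    have "skew_part (f Y) = skew_part (\<Phi> Y)"
      by (simp add: f_def P.add P.diff skew_part_skew_part)
    then have "skew_part A = skew_part (\<Phi> Y)"
      using Y skew_part_skew_part by metis
    then have "A = \<Phi> Y"
      using inj [OF A(1) unitary _ \<epsilon>(2) [OF Y(2)]] A(2) subsetD [OF \<Phi>(1) rangeI] by simp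
    then show "A \<in> H"
      using subsetD [OF \<Phi>(1) rangeI] by simp
  qed
qed

text \<open>Brackets of two elements of row \<open>l\<close> reach the other entries up to a
  correction at the corner \<open>(l, l)\<close>. This yields everything of trace zero, and
  \<open>K\<^sub>0\<close> supplies the missing trace direction.\<close>

lemma skew_hermitian_in_tangent:
  fixes l :: 'n
  assumes row: "\<And>c v. v $ l = 0 \<Longrightarrow> skew_outer (c *s axis l 1) v \<in> tangent"
    and K0: "K\<^sub>0 \<in> tangent" "cadjoint K\<^sub>0 = - K\<^sub>0" "Im (trace K\<^sub>0) \<noteq> 0"
    and K: "cadjoint K = - K"
  shows "K \<in> tangent"
proof -
  let ?e = "\<lambda>j. axis j 1 :: complex^'n"
  \<comment> \<open>\<open>?Y\<close> has the single entry \<open>2 * \<i>\<close> at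
    \<open>(l, l)\<close>. Subtracting \<open>Im (trace L) / 2\<close> times it makes a
    skew-Hermitian \<open>L\<close> traceless.\<close>
  let ?Y = "skew_outer (\<i> *s ?e l) (?e l)"
  have cinner_e: "cinner (?e j) (?e k) = (if j = k then 1 else 0)" for j k
    by (simp only: cinner_axis) (simp add: axis_def)
  have e: "?e j $ l = 0" if "j \<noteq> l" for j
    using that by (simp add: axis_def)
  have corner: "skew_outer (c *s ?e l) (?e l) = Im c *\<^sub>R ?Y" for c
    by (simp add: skew_outer_def outer_def vec_eq_iff axis_def complex_eq_iff)
  have entry: "skew_outer (c *s ?e j) (?e k) - (if j = k then Im c else 0) *\<^sub>R ?Y \<in> tangent" for c j k
  proof -
    consider "j = l" "k = l" | "j = l" "k \<noteq> l" | "j \<noteq> l" "k = l" | "j \<noteq> l" "k \<noteq> l"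
      by blast
    then show ?thesis
    proof cases
      case 1
      then show ?thesis
        by (simp add: corner [of c] subspace_0 [OF subspace_tangent])
    next
      case 2
      then show ?thesis
        using row [OF e] by auto
    next
      case 3
      have "skew_outer (c *s ?e j) (?e l) = - skew_outer (cnj c *s ?e l) (?e j)"
        using skew_outer_commute [of "c *s ?e j" "?e l"] by (simp add: skew_outer_scale)
      then show ?thesis
        using 3 subspace_neg [OF subspace_tangent row [OF e]] by auto
    next
      case 4
      \<comment> \<open>The bracket cancels the common index \<open>l\<close>. The conjugate in
        \<open>?G\<close> becomes \<open>c\<close> on \<open>?e l\<close>, and for
        \<open>j = k\<close> the second term is exactly the corner correction in
        \<open>entry\<close>.\<close>
      let ?G = "skew_outer (cnj c *s ?e l) (?e j)" and ?F = "skew_outer (1 *s ?e l) (?e k)"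
      have "?G ** ?F + ?F ** cadjoint ?G \<in> tangent"
        by (intro tangent_bracket row e 4)
      moreover have "?G *v ?e l = - (c *s ?e j)" "?G *v ?e k = (if j = k then cnj c *s ?e l else 0)"
        using 4 by (auto simp: skew_outer_mult_vector cinner_e simp del: cinner_axis)
      ultimately have "- skew_outer (c *s ?e j) (?e k)
          + skew_outer (?e l) (if j = k then cnj c *s ?e l else 0) \<in> tangent"
        by (simp add: skew_outer_conj skew_outer_minus)
      then have "- (- skew_outer (c *s ?e j) (?e k)
          + skew_outer (?e l) (if j = k then cnj c *s ?e l else 0)) \<in> tangent"
        by (rule subspace_neg [OF subspace_tangent])
      then show ?thesis
        by (cases "j = k") (simp_all add: skew_outer_scale corner [of c])
    qed
  qed
  have decomp: "L - (Im (trace L) / 2) *\<^sub>R ?Y \<in> tangent" if "cadjoint L = - L" for L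
  proof -
    have "(\<Sum>j\<in>UNIV. \<Sum>k\<in>UNIV. skew_outer (L $ j $ k *s ?e j) (?e k)
        - (if j = k then Im (L $ j $ k) else 0) *\<^sub>R ?Y) \<in> tangent"
      by (intro subspace_sum subspace_tangent entry)
    also have "(\<Sum>j\<in>UNIV. \<Sum>k\<in>UNIV. skew_outer (L $ j $ k *s ?e j) (?e k)
        - (if j = k then Im (L $ j $ k) else 0) *\<^sub>R ?Y)
      = (\<Sum>j\<in>UNIV. \<Sum>k\<in>UNIV. skew_outer (L $ j $ k *s ?e j) (?e k)) - Im (trace L) *\<^sub>R ?Y"
    proof -
      have "(\<Sum>j\<in>UNIV. \<Sum>k\<in>UNIV. (if j = k then Im (L $ j $ k) else 0)) = Im (trace L)"
        by (simp add: trace_def)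
      then show ?thesis
        by (simp add: sum_subtractf flip: scaleR_sum_left)
    qed
    finally have "(1/2) *\<^sub>R ((\<Sum>j\<in>UNIV. \<Sum>k\<in>UNIV. skew_outer (L $ j $ k *s ?e j) (?e k))
        - Im (trace L) *\<^sub>R ?Y) \<in> tangent"
      by (rule subspace_scale [OF subspace_tangent])
    then show ?thesis
      by (simp add: scaleR_diff_right flip: skew_hermitian_decompose [OF that])
  qed
  have "K\<^sub>0 - (K\<^sub>0 - (Im (trace K\<^sub>0) / 2) *\<^sub>R ?Y) \<in> tangent"
    by (intro subspace_diff subspace_tangent K0 decomp)
  then have "(Im (trace K\<^sub>0) / 2) *\<^sub>R ?Y \<in> tangent"
    by simp
  then have "(2 / Im (trace K\<^sub>0)) *\<^sub>R ((Im (trace K\<^sub>0) / 2) *\<^sub>R ?Y) \<in> tangent"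
    by (rule subspace_scale [OF subspace_tangent])
  moreover have "(2 / Im (trace K\<^sub>0)) *\<^sub>R ((Im (trace K\<^sub>0) / 2) *\<^sub>R ?Y) = ?Y"
    using K0(3) by simp
  ultimately have "?Y \<in> tangent"
    by (simp only:)
  then have "(K - (Im (trace K) / 2) *\<^sub>R ?Y) + (Im (trace K) / 2) *\<^sub>R ?Y \<in> tangent"
    by (intro subspace_add subspace_scale subspace_tangent decomp K)
  then show ?thesis
    by simp
qed

text \<open>\<open>reflect v\<close> is multiplicative in the eigenvalue, so the reflection is a
  power of the one with angle \<open>\<phi> / Suc n\<close>, which for large \<open>n\<close> lies
  in the neighbourhood of the identity contained in \<open>H\<close>.\<close>

lemma contains_reflect:
  assumes full: "\<And>K. cadjoint K = - K \<Longrightarrow> K \<in> tangent" and v: "norm v = 1"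
  shows "reflect v (cis \<phi>) \<in> H"
proof -
  obtain \<delta> where \<delta>: "\<delta> > 0" "\<And>A. unitary_matrix A \<Longrightarrow> norm (A - mat 1) < \<delta> \<Longrightarrow> A \<in> H"
    using contains_neighbourhood [OF full] by blast
  have "(\<lambda>n. cis (\<phi> / real (Suc n))) \<longlonglongrightarrow> cis 0"
    by (intro tendsto_cis LIMSEQ_Suc [OF lim_const_over_n])
  then have "(\<lambda>n. reflect v (cis (\<phi> / real (Suc n)))) \<longlonglongrightarrow> reflect v 1"
    using tendsto_reflect [of v 1]
    by (intro isCont_tendsto_compose [of 1 "reflect v"]) (simp_all add: isCont_def)
  then have "\<forall>\<^sub>F n in sequentially. dist (reflect v (cis (\<phi> / real (Suc n)))) (reflect v 1) < \<delta>"
    using \<delta>(1) by (rule tendstoD)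
  then obtain n where "norm (reflect v (cis (\<phi> / real (Suc n))) - mat 1) < \<delta>"
    by (auto simp: dist_norm eventually_sequentially)
  then have n: "reflect v (cis (\<phi> / real (Suc n))) \<in> H"
    by (intro \<delta> unitary_reflect v) simp_all
  have "reflect v (cis (real k * (\<phi> / real (Suc n)))) \<in> H" for k
  proof (induction k)
    case 0
    show ?case by (simp add: one)
  next
    case (Suc k)
    have "reflect v (cis (real (Suc k) * (\<phi> / real (Suc n))))
        = reflect v (cis (real k * (\<phi> / real (Suc n)))) ** reflect v (cis (\<phi> / real (Suc n)))"
      by (simp only: reflect_mult [OF v] cis_mult) (simp only: of_nat_Suc distrib_right mult_1_left add.commute)
    then show ?case
      using mult [OF Suc n] by simp
  qed
  from this [of "Suc n"] show ?thesis by simp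
qed

text \<open>Every unitary matrix is a product of reflections: these are used to make it fix one more axis.\<close>

theorem all_unitary:
  assumes full: "\<And>K. cadjoint K = - K \<Longrightarrow> K \<in> tangent" and "unitary_matrix A"
  shows "A \<in> H"
proof -
  have "A \<in> H" if "finite S" "unitary_matrix A" "\<And>j. j \<notin> S \<Longrightarrow> A *v axis j 1 = axis j 1"
    for S A using that
  proof (induction S arbitrary: A rule: finite_induct)
    case empty
    have "column j A = column j (mat 1)" for j
    proof -
      have "A $ i $ k * axis j 1 $ k = (if k = j then A $ i $ k else 0)" for i k
        by (simp add: axis_def)
      then have "A *v axis j 1 = column j A"
        by (simp add: matrix_vector_mult_def column_def vec_eq_iff)
      moreover have "column j (mat 1 :: complex^'n^'n) = axis j 1"
        by (auto simp: column_def mat_def axis_def vec_eq_iff)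
      ultimately show ?thesis
        using empty(2) [of j] by simp
    qed
    then have "A = mat 1"
      by (simp add: column_def vec_eq_iff)
    then show ?case
      by (simp add: one)
  next
    case (insert k S)
    let ?x = "axis k 1 :: complex^'n"
    show ?case
    proof (cases "A *v ?x = ?x")
      case True
      then show ?thesis
        using insert by (metis insert_iff)
    next
      case False
      have nx: "norm ?x = 1"
        by (simp add: norm_axis_1)
      have ny: "norm (A *v ?x) = 1"
        by (simp add: unitary_norm [OF insert.prems(1)] nx)
      obtain v c where R: "norm v = 1" "norm c = 1" "reflect v c *v ?x = A *v ?x"
          "\<And>u. cinner u ?x = 0 \<Longrightarrow> cinner u (A *v ?x) = 0 \<Longrightarrow> reflect v c *v u = u"
        using reflect_transitive [OF nx ny] False by metis
      let ?R = "reflect v c"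
      have U: "unitary_matrix ?R"
        by (rule unitary_reflect) (use R in auto)
      then have RR: "cadjoint ?R *v (?R *v u) = u" for u
        by (simp add: matrix_vector_mul_assoc unitary_matrix_def)
      have "cadjoint ?R ** A \<in> H"
      proof (rule insert.IH)
        show "unitary_matrix (cadjoint ?R ** A)"
          by (intro unitary_matrix_mult unitary_matrix_cadjoint U insert.prems)
        fix j assume j: "j \<notin> S"
        show "(cadjoint ?R ** A) *v axis j 1 = axis j 1"
        proof (cases "j = k")
          case True
          then show ?thesis
            using RR [of ?x] by (simp add: R flip: matrix_vector_mul_assoc)
        next
          case jk: False
          then have Aj: "A *v axis j 1 = axis j 1"
            using j insert.prems by simp
          \<comment> \<open>An axis fixed by \<open>A\<close> is orthogonal to \<open>?x\<close>
            and, as \<open>A\<close> is unitary, to \<open>A *v ?x\<close>; the reflection taking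
            one to the other does not move it.\<close>
          have "cinner (axis j 1) ?x = 0"
            using jk by (simp only: cinner_axis) (simp add: axis_def)
          moreover from this have "cinner (axis j 1) (A *v ?x) = 0"
            using unitary_cinner [OF insert.prems(1), of "axis j 1" ?x] by (simp add: Aj)
          ultimately have "?R *v axis j 1 = axis j 1"
            by (rule R)
          then show ?thesis
            using RR [of "axis j 1"] by (simp add: Aj flip: matrix_vector_mul_assoc)
        qed
      qed
      moreover have "?R \<in> H"
        using contains_reflect [OF full R(1), of "Arg c"] rcis_cmod_Arg [of c] R(2)
        by (simp add: rcis_def)
      ultimately have "?R ** (cadjoint ?R ** A) \<in> H"
        by (simp add: mult)
      then show ?thesis
        by (simp add: matrix_mul_assoc unitary_matrix_right [OF U])
    qed
  qed
  from this [of UNIV] assms show ?thesis by auto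
qed

end

section \<open>One-parameter groups of unitary matrices\<close>

primrec matrix_pow :: "complex^'n::finite^'n \<Rightarrow> nat \<Rightarrow> complex^'n^'n" where
  "matrix_pow A 0 = mat 1"
| "matrix_pow A (Suc k) = A ** matrix_pow A k"

lemma matrix_pow_commute: "matrix_pow A k ** A = A ** matrix_pow A k"
  by (induction k) (simp_all flip: matrix_mul_assoc)

lemma norm_vec_nth_nth_le: "norm (A $ i $ j) \<le> norm A" for A :: "complex^'n::finite^'m::finite"
  using Finite_Cartesian_Product.norm_nth_le [of "A $ i" j]
    Finite_Cartesian_Product.norm_nth_le [of A i] by linarith

text \<open>Domination by a real exponential series; \<open>M\<close> is the norm of the identity
  matrix, which need not be 1.\<close>

lemma summable_matrix_pow: "summable (\<lambda>k. (matrix_pow A k $ i $ j / fact k) * x ^ k)"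
proof -
  from matrix_mult.pos_bounded [where 'n = 'a] obtain C
    where C: "C > 0" "\<And>(X :: complex^'a^'a) (Y :: complex^'a^'a). norm (X ** Y) \<le> norm X * norm Y * C"
    by auto
  define K where "K = norm A * C"
  define M where "M = norm (mat 1 :: complex^'a^'a)"
  have "K \<ge> 0"
    using C by (simp add: K_def)
  have bound: "norm (matrix_pow A k) \<le> K ^ k * M" for k
  proof (induction k)
    case 0
    show ?case by (simp add: M_def)
  next
    case (Suc k)
    have "norm (matrix_pow A (Suc k)) \<le> norm A * norm (matrix_pow A k) * C"
      using C by simp
    also have "\<dots> = K * norm (matrix_pow A k)"
      by (simp add: K_def mult_ac)
    also have "\<dots> \<le> K * (K ^ k * M)"
      by (rule mult_left_mono [OF Suc \<open>K \<ge> 0\<close>])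
    finally show ?case by (simp add: mult_ac)
  qed
  show ?thesis
  proof (rule summable_comparison_test)
    show "summable (\<lambda>k. M * (inverse (fact k) * (K * norm x) ^ k))"
      by (intro summable_mult summable_exp)
    have "norm ((matrix_pow A k $ i $ j / fact k) * x ^ k) \<le> M * (inverse (fact k) * (K * norm x) ^ k)" for k
    proof -
      have "norm (matrix_pow A k $ i $ j) \<le> K ^ k * M"
        using norm_vec_nth_nth_le bound by (rule order_trans)
      then have "norm (matrix_pow A k $ i $ j) * (norm x ^ k / fact k) \<le> K ^ k * M * (norm x ^ k / fact k)"
        by (rule mult_right_mono) simp
      then show ?thesis
        by (simp add: norm_mult norm_divide norm_power power_mult_distrib field_simps)
    qed
    then show "\<exists>N. \<forall>k\<ge>N. norm ((matrix_pow A k $ i $ j / fact k) * x ^ k) \<le> M * (inverse (fact k) * (K * norm x) ^ k)"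
      by blast
  qed
qed

text \<open>The exponential is summed entry by entry as a complex power series at real arguments.
  Termwise differentiation shifts the coefficients, and the shifted series is the entry of both
  \<open>A ** T t\<close> and \<open>T t ** A\<close>, because \<open>A\<close> commutes with its
  powers.\<close>

lemma matrix_exp_exists:
  fixes A :: "complex^'n::finite^'n"
  obtains T :: "real \<Rightarrow> complex^'n^'n"
  where "T 0 = mat 1" "\<And>t. (T has_vector_derivative A ** T t) (at t)" "\<And>t. T t ** A = A ** T t"
proof -
  define c where "c i j k = matrix_pow A k $ i $ j / fact k" for i j k
  define f where "f i j x = (\<Sum>k. c i j k * x ^ k)" for i j and x :: complex
  define T where "T t = (\<chi> i j. f i j (of_real t))" for t :: real
  have summable: "summable (\<lambda>k. c i j k * x ^ k)" for i j x
    unfolding c_def by (rule summable_matrix_pow)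
  have diffs_c: "diffs (c i j) k = (\<Sum>l\<in>UNIV. A $ i $ l * c l j k)" for i j k
  proof -
    have "of_nat (Suc k) * (x / fact (Suc k)) = x / fact k" for x :: complex
      by (simp add: field_simps del: of_nat_Suc)
    then show ?thesis
      by (simp add: diffs_def c_def matrix_matrix_mult_def sum_divide_distrib sum_distrib_left
          mult.left_commute [of "of_nat (Suc k)"] times_divide_eq_right [symmetric]
          del: of_nat_Suc fact_Suc times_divide_eq_right)
  qed
  have AT: "(A ** T t) $ i $ j = (\<Sum>k. diffs (c i j) k * of_real t ^ k)" for i j t
  proof -
    have "(A ** T t) $ i $ j = (\<Sum>l\<in>UNIV. A $ i $ l * (\<Sum>k. c l j k * of_real t ^ k))"
      by (simp add: matrix_matrix_mult_def T_def f_def)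
    also have "\<dots> = (\<Sum>l\<in>UNIV. \<Sum>k. A $ i $ l * (c l j k * of_real t ^ k))"
      by (simp add: suminf_mult summable)
    also have "\<dots> = (\<Sum>k. \<Sum>l\<in>UNIV. A $ i $ l * (c l j k * of_real t ^ k))"
      by (rule suminf_sum [symmetric]) (intro summable_mult summable)
    finally show ?thesis
      by (simp only: diffs_c sum_distrib_right mult.assoc)
  qed
  have TA: "(T t ** A) $ i $ j = (\<Sum>k. diffs (c i j) k * of_real t ^ k)" for i j t
  proof -
    have "(T t ** A) $ i $ j = (\<Sum>l\<in>UNIV. (\<Sum>k. c i l k * of_real t ^ k) * A $ l $ j)"
      by (simp add: matrix_matrix_mult_def T_def f_def)
    also have "\<dots> = (\<Sum>l\<in>UNIV. \<Sum>k. (c i l k * of_real t ^ k) * A $ l $ j)"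
      by (simp add: suminf_mult2 summable)
    also have "\<dots> = (\<Sum>k. \<Sum>l\<in>UNIV. (c i l k * of_real t ^ k) * A $ l $ j)"
      by (rule suminf_sum [symmetric]) (intro summable_mult2 summable)
    also have "\<dots> = (\<Sum>k. diffs (c i j) k * of_real t ^ k)"
    proof (rule suminf_cong)
      fix k
      have "(\<Sum>l\<in>UNIV. (c i l k * of_real t ^ k) * A $ l $ j)
          = (matrix_pow A k ** A) $ i $ j / fact k * of_real t ^ k"
        by (simp add: c_def matrix_matrix_mult_def sum_divide_distrib sum_distrib_left mult_ac)
      also have "\<dots> = (\<Sum>l\<in>UNIV. A $ i $ l * c l j k) * of_real t ^ k"
        unfolding matrix_pow_commute
        by (simp add: c_def matrix_matrix_mult_def sum_divide_distrib)
      finally show "(\<Sum>l\<in>UNIV. (c i l k * of_real t ^ k) * A $ l $ j) = diffs (c i j) k * of_real t ^ k"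
        by (simp add: diffs_c)
    qed
    finally show ?thesis .
  qed
  show ?thesis
  proof (rule that)
    show "T 0 = mat 1"
      by (simp add: T_def f_def powser_zero) (simp add: c_def vec_eq_iff)
    show "T t ** A = A ** T t" for t
      by (simp add: vec_eq_iff AT TA)
    show "(T has_vector_derivative A ** T t) (at t)" for t
    proof -
      have entry: "((\<lambda>t. f i j (of_real t)) has_vector_derivative (A ** T t) $ i $ j) (at t)" for i j
        unfolding AT f_def
        by (rule has_vector_derivative_real_field [OF termdiffs_strong_converges_everywhere])
           (rule summable)
      \<comment> \<open>Elementary matrices assemble the derivatives of the entries into a
        derivative of \<open>T\<close>.\<close>
      define E where "E i j z = (\<chi> a b. if a = i \<and> b = j then z else 0)" for i j :: 'n and z :: complex
      have bl: "bounded_linear (E i j)" for i j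
        unfolding linear_conv_bounded_linear [symmetric]
        by (rule linearI) (auto simp: E_def vec_eq_iff)
      have "((\<lambda>t. \<Sum>i\<in>UNIV. \<Sum>j\<in>UNIV. E i j (f i j (of_real t))) has_vector_derivative
          (\<Sum>i\<in>UNIV. \<Sum>j\<in>UNIV. E i j ((A ** T t) $ i $ j))) (at t)"
        by (intro has_vector_derivative_sum bounded_linear.has_vector_derivative [OF bl entry])
      moreover have sum_E: "(\<Sum>i\<in>UNIV. \<Sum>j\<in>UNIV. E i j (X $ i $ j)) = X" for X
      proof -
        have "E i j z $ a $ b = (if j = b then if i = a then z else 0 else 0)" for i j z a b
          by (simp add: E_def)
        then have "(\<Sum>i\<in>UNIV. \<Sum>j\<in>UNIV. E i j (X $ i $ j)) $ a $ b = X $ a $ b" for a b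
          by (simp only: sum_component sum.delta sum.delta' finite UNIV_I if_True)
        then show ?thesis
          by (simp add: vec_eq_iff)
      qed
      moreover have "(\<lambda>t. \<Sum>i\<in>UNIV. \<Sum>j\<in>UNIV. E i j (f i j (of_real t))) = T"
      proof
        fix t
        show "(\<Sum>i\<in>UNIV. \<Sum>j\<in>UNIV. E i j (f i j (of_real t))) = T t"
          using sum_E [of "T t"] by (simp add: T_def)
      qed
      ultimately show ?thesis
        by (simp only:)
    qed
  qed
qed

text \<open>Both \<open>cadjoint (T t) ** T t\<close> and \<open>T (- t) ** T t\<close> have zero
  derivative. The first constant gives unitarity, the second identifies the inverse with
  \<open>T (- t)\<close>.\<close>

lemma skew_hermitian_exp:
  fixes A :: "complex^'n::finite^'n"
  assumes "cadjoint A = - A"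
  obtains T :: "real \<Rightarrow> complex^'n^'n"
  where "T 0 = mat 1" "\<And>t. (T has_vector_derivative A ** T t) (at t)"
    "\<And>t. unitary_matrix (T t)" "\<And>t. cadjoint (T t) = T (- t)"
proof -
  obtain T :: "real \<Rightarrow> complex^'n^'n" where T: "T 0 = mat 1"
      "\<And>t. (T has_vector_derivative A ** T t) (at t)" "\<And>t. T t ** A = A ** T t"
    using matrix_exp_exists by blast
  have const: "F t = F 0" if "\<And>t. (F has_vector_derivative 0) (at t)"
    for F :: "real \<Rightarrow> complex^'n^'n" and t
    using has_vector_derivative_zero_constant [of UNIV F] that by (metis convex_UNIV UNIV_I)
  have "((\<lambda>t. cadjoint (T t) ** T t) has_vector_derivative
      cadjoint (T t) ** (A ** T t) + cadjoint (A ** T t) ** T t) (at t)" for t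
    by (intro matrix_mult.has_vector_derivative bounded_linear.has_vector_derivative
        [OF bounded_linear_cadjoint] T)
  then have "((\<lambda>t. cadjoint (T t) ** T t) has_vector_derivative 0) (at t)" for t
    by (simp add: cadjoint_mult assms matrix_mult.minus_right matrix_mult.minus_left matrix_mul_assoc)
  from const [OF this] have U: "unitary_matrix (T t)" for t
    by (simp add: unitary_matrix_def T)
  have "((\<lambda>t. T (- t)) has_vector_derivative - (A ** T (- t))) (at t)" for t
  proof -
    have "(uminus has_vector_derivative - 1) (at t)"
      by (auto intro!: derivative_eq_intros)
    from vector_diff_chain_at [OF this T(2)] show ?thesis
      by (simp add: o_def)
  qed
  then have "((\<lambda>t. T (- t) ** T t) has_vector_derivative
      T (- t) ** (A ** T t) + (- (A ** T (- t))) ** T t) (at t)" for t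
    by (intro matrix_mult.has_vector_derivative T)
  then have "((\<lambda>t. T (- t) ** T t) has_vector_derivative 0) (at t)" for t
    by (simp add: matrix_mult.minus_left matrix_mul_assoc T(3))
  from const [OF this] have "T (- t) ** T t = mat 1" for t
    by (simp add: T)
  moreover have "T (- t) = (T (- t) ** T t) ** cadjoint (T t)" for t
    using unitary_matrix_right [OF U] by (simp flip: matrix_mul_assoc)
  ultimately have "cadjoint (T t) = T (- t)" for t
    by simp
  with T U that show ?thesis by blast
qed

section \<open>Smooth maps\<close>

lemma Ck_cong_derivative:
  assumes "\<And>x. (f has_derivative f' x) (at x)" "\<And>v. Ck k (\<lambda>x. f' x v)"
  shows "Ck (Suc k) f"
proof -
  have "frechet_derivative f (at x) = f' x" for x
    using frechet_derivative_at [OF assms(1)] by simp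
  then show ?thesis
    using assms by (auto simp: differentiable_def)
qed

lemma Ck_Suc_has_derivative:
  "Ck (Suc k) f \<Longrightarrow> (f has_derivative frechet_derivative f (at x)) (at x)"
  by (simp add: frechet_derivative_works)

lemma Ck_Suc_imp_Ck: "Ck (Suc k) f \<Longrightarrow> Ck k f"
proof (induction k arbitrary: f)
  case 0
  then show ?case
    by (simp add: differentiable_imp_continuous_within continuous_at_imp_continuous_on)
next
  case (Suc k)
  then have "Ck k (\<lambda>x. frechet_derivative f (at x) v)" for v
    by simp
  with Suc show ?case
    by simp
qed

lemma Ck_const [simp]: "Ck k (\<lambda>x. c)"
proof (induction k arbitrary: c)
  case (Suc k)
  show ?case
    by (rule Ck_cong_derivative [OF has_derivative_const Suc])
qed simp

lemma Ck_bounded_linear: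
  assumes "bounded_linear L"
  shows "Ck k L"
proof (cases k)
  case 0
  then show ?thesis
    using assms by (simp add: linear_continuous_on)
next
  case (Suc j)
  show ?thesis
    unfolding Suc
    by (rule Ck_cong_derivative [OF bounded_linear_imp_has_derivative [OF assms] Ck_const])
qed

lemma Ck_add: "Ck k f \<Longrightarrow> Ck k g \<Longrightarrow> Ck k (\<lambda>x. f x + g x)"
proof (induction k arbitrary: f g)
  case 0
  then show ?case
    by (simp add: continuous_on_add)
next
  case (Suc k)
  show ?case
    by (rule Ck_cong_derivative [OF has_derivative_add
          [OF Ck_Suc_has_derivative [OF Suc.prems(1)] Ck_Suc_has_derivative [OF Suc.prems(2)]]])
       (use Suc in auto)
qed

lemma Ck_sum: "(\<And>i. i \<in> I \<Longrightarrow> Ck k (f i)) \<Longrightarrow> Ck k (\<lambda>x. \<Sum>i\<in>I. f i x)"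
  by (induction I rule: infinite_finite_induct) (auto intro: Ck_add)

lemma Ck_bilinear:
  assumes "bounded_bilinear B"
  shows "Ck k f \<Longrightarrow> Ck k g \<Longrightarrow> Ck k (\<lambda>x. B (f x) (g x))"
proof (induction k arbitrary: f g)
  case 0
  then show ?case
    by (simp add: bounded_bilinear.continuous_on [OF assms])
next
  case (Suc k)
  show ?case
  proof (rule Ck_cong_derivative [OF bounded_bilinear.FDERIV [OF assms
          Ck_Suc_has_derivative [OF Suc.prems(1)] Ck_Suc_has_derivative [OF Suc.prems(2)]]])
    fix v
    have "Ck k (\<lambda>x. frechet_derivative f (at x) v)" "Ck k (\<lambda>x. frechet_derivative g (at x) v)"
      using Suc.prems by auto
    then show "Ck k (\<lambda>x. B (f x) (frechet_derivative g (at x) v)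
        + B (frechet_derivative f (at x) v) (g x))"
      by (intro Ck_add Suc.IH Ck_Suc_imp_Ck [OF Suc.prems(1)] Ck_Suc_imp_Ck [OF Suc.prems(2)])
  qed
qed

lemma Ck_compose_linear:
  assumes "bounded_linear L"
  shows "Ck k f \<Longrightarrow> Ck k (\<lambda>x. L (f x))"
proof (induction k arbitrary: f)
  case 0
  then show ?case
    using assms by (simp add: bounded_linear.continuous_on)
next
  case (Suc k)
  show ?case
    by (rule Ck_cong_derivative [OF bounded_linear.has_derivative [OF assms
            Ck_Suc_has_derivative [OF Suc.prems]]])
       (use Suc in auto)
qed

text \<open>The factor \<open>c\<close> makes the induction close: the derivative in direction
  \<open>v\<close> has the same shape with \<open>L v * c\<close> in place of
  \<open>c\<close>.\<close>

lemma Ck_exp: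
  fixes L :: "'a::real_normed_vector \<Rightarrow> 'b::{real_normed_field,banach}"
  assumes L: "bounded_linear L"
  shows "Ck k (\<lambda>x. exp (L x) * c)"
proof (induction k arbitrary: c)
  case 0
  show ?case
    by (simp, intro continuous_intros linear_continuous_on L)
next
  case (Suc k)
  have "((\<lambda>x. exp (L x)) has_derivative (\<lambda>h. exp (L x) * L h)) (at x)" for x
    using has_derivative_compose [OF bounded_linear_imp_has_derivative [OF L]
        DERIV_exp [unfolded has_field_derivative_def]] .
  then have "((\<lambda>x. exp (L x) * c) has_derivative (\<lambda>h. exp (L x) * L h * c)) (at x)" for x
    by (rule has_derivative_mult_left)
  then show ?case
    by (rule Ck_cong_derivative) (simp add: Suc mult.assoc)
qed

lemma smooth_imp_has_derivative:
  "smooth f \<Longrightarrow> (f has_derivative frechet_derivative f (at x)) (at x)"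
  using Ck_Suc_has_derivative [of 0 f x] by (auto simp: smooth_def)

section \<open>Left trivialisation\<close>

text \<open>This is \<open>ad (a, 0, 0)\<close>, the derivative of \<open>ot_scale r t y\<close>
  with respect to \<open>t\<close> at \<open>t = 0\<close> in direction \<open>a\<close>.\<close>

definition ot_delta :: "real^'s::finite \<Rightarrow> real^'s \<Rightarrow> 's ot_group \<Rightarrow> 's ot_group" where
  "ot_delta r a y = (0, (\<chi> i. a $ i * fst (snd y) $ i), ot_weight r a * snd (snd y))"

lemma ot_scale_ot_scale: "ot_scale r s (ot_scale r t v) = ot_scale r (s + t) v"
  by (simp add: ot_scale_def ot_char_add exp_add vec_eq_iff)

lemma ot_scale_0 [simp]: "ot_scale r 0 v = v"
  by (cases v) (simp add: ot_scale_def vec_eq_iff)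

lemma ot_scale_cancel [simp]: "ot_scale r (- t) (ot_scale r t v) = v"
  "ot_scale r t (ot_scale r (- t) v) = v"
  by (simp_all add: ot_scale_ot_scale)

lemma fst_ot_scale [simp]: "fst (ot_scale r t v) = fst v"
  by (simp add: ot_scale_def)

lemma linear_ot_scale: "linear (ot_scale r t)"
  by (rule linearI) (auto simp: ot_scale_def vec_eq_iff algebra_simps)

lemmas ot_scale_linear_simps =
  linear_add [OF linear_ot_scale] linear_diff [OF linear_ot_scale]
  linear_scale [OF linear_ot_scale] linear_neg [OF linear_ot_scale] linear_0 [OF linear_ot_scale]

lemma maurer_cartan_eq: "maurer_cartan r p u = ot_scale r (- fst p) u"
  by (cases p) (simp add: maurer_cartan_def frechet_derivative_ot_mult)

lemma bilinear_ot_delta: "bilinear (ot_delta r)"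
  unfolding bilinear_def
  by (auto intro!: linearI simp: ot_delta_def vec_eq_iff algebra_simps
      linear_add [OF linear_ot_weight] linear_scale [OF linear_ot_weight] scaleR_conv_of_real [where 'a = complex])

lemma ot_delta_ot_scale: "ot_delta r a (ot_scale r t v) = ot_scale r t (ot_delta r a v)"
  by (simp add: ot_delta_def ot_scale_def vec_eq_iff)

text \<open>Each summand is a scalar function of \<open>t\<close> times a fixed linear map of
  \<open>y\<close>, so that differentiation and \<open>Ck\<close> reduce to product rules.\<close>

lemma ot_scale_expand:
  "ot_scale r t y = (fst y, 0, 0) + (\<Sum>i\<in>UNIV. exp (t $ i) *\<^sub>R (0, axis i (fst (snd y) $ i), 0))
     + (0, 0, ot_char r t * snd (snd y))"
proof -
  have "(\<Sum>i\<in>UNIV. exp (t $ i) *\<^sub>R axis i (fst (snd y) $ i)) $ j = exp (t $ j) * fst (snd y) $ j" for j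
  proof -
    have "exp (t $ i) * axis i (fst (snd y) $ i) $ j = (if i = j then exp (t $ i) * fst (snd y) $ i else 0)" for i
      by (simp add: axis_def)
    then show ?thesis
      by simp
  qed
  then have "(\<Sum>i\<in>UNIV. exp (t $ i) *\<^sub>R axis i (fst (snd y) $ i)) = (\<chi> j. exp (t $ j) * fst (snd y) $ j)"
    by (simp add: vec_eq_iff)
  then show ?thesis
    by (simp add: ot_scale_def prod_eq_iff fst_sum snd_sum)
qed

lemma has_derivative_ot_scale:
  fixes f :: "'a::real_normed_vector \<Rightarrow> real^'s::finite"
  assumes f: "(f has_derivative f') (at x within S)" and y: "(y has_derivative y') (at x within S)"
  shows "((\<lambda>x. ot_scale r (f x) (y x)) has_derivative
     (\<lambda>h. ot_scale r (f x) (ot_delta r (f' h) (y x) + y' h))) (at x within S)"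
proof -
  have fi: "((\<lambda>x. f x $ i) has_derivative (\<lambda>h. f' h $ i)) (at x within S)" for i
    by (rule bounded_linear.has_derivative [OF bounded_linear_vec_nth f])
  have 1: "((\<lambda>x. exp (f x $ i)) has_derivative (\<lambda>h. f' h $ i * exp (f x $ i))) (at x within S)" for i
    using has_derivative_exp [OF fi] by (simp add: mult.commute)
  have 2: "((\<lambda>x. ot_char r (f x)) has_derivative (\<lambda>h. ot_weight r (f' h) * ot_char r (f x))) (at x within S)"
    by (rule has_derivative_compose [OF f has_derivative_ot_char])
  have lin: "bounded_linear (\<lambda>y :: 's ot_group. (0, axis i (fst (snd y) $ i), 0) :: 's ot_group)"
    "bounded_linear (\<lambda>y :: 's ot_group. (fst y, 0, 0) :: 's ot_group)"
    "bounded_linear (\<lambda>y :: 's ot_group. snd (snd y))"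
    "bounded_linear (\<lambda>z. (0, 0, z) :: 's ot_group)" for i
    unfolding linear_conv_bounded_linear [symmetric]
    by (auto intro!: linearI simp: axis_def vec_eq_iff)
  have "((\<lambda>x. ot_scale r (f x) (y x)) has_derivative
     (\<lambda>h. (fst (y' h), 0, 0) + (\<Sum>i\<in>UNIV. exp (f x $ i) *\<^sub>R (0, axis i (fst (snd (y' h)) $ i), 0)
        + (f' h $ i * exp (f x $ i)) *\<^sub>R (0, axis i (fst (snd (y x)) $ i), 0))
     + (0, 0, ot_char r (f x) * snd (snd (y' h)) + ot_weight r (f' h) * ot_char r (f x) * snd (snd (y x)))))
     (at x within S)"
    unfolding ot_scale_expand
    by (intro has_derivative_add has_derivative_sum has_derivative_scaleR has_derivative_mult 1 2
        bounded_linear.has_derivative [OF lin(1)] bounded_linear.has_derivative [OF lin(2)]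
        bounded_linear.has_derivative [OF lin(3)] bounded_linear.has_derivative [OF lin(4)] y)
  moreover have "(\<Sum>i\<in>UNIV. exp (f x $ i) *\<^sub>R (0, axis i (fst (snd (y' h)) $ i), 0)
        + (f' h $ i * exp (f x $ i)) *\<^sub>R (0, axis i (fst (snd (y x)) $ i), 0) :: 's ot_group)
     = (\<Sum>i\<in>UNIV. exp (f x $ i) *\<^sub>R (0, axis i (fst (snd (ot_delta r (f' h) (y x) + y' h)) $ i), 0))" for h
    by (intro sum.cong refl) (simp add: ot_delta_def vec_eq_iff axis_def algebra_simps)
  ultimately show ?thesis
    by (elim has_derivative_eq_rhs) (simp add: ot_scale_expand ot_delta_def algebra_simps fun_eq_iff)
qed

lemma Ck_ot_scale:
  fixes f :: "'a::real_normed_vector \<Rightarrow> real^'s::finite"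
  assumes f: "bounded_linear f" and y: "Ck k y"
  shows "Ck k (\<lambda>x. ot_scale r (f x) (y x))"
proof -
  have fi: "bounded_linear (\<lambda>x. f x $ i)" for i
    by (rule bounded_linear_compose [OF bounded_linear_vec_nth f])
  have w: "bounded_linear (\<lambda>x. ot_weight r (f x))"
    using bounded_linear_compose [OF linear_ot_weight [of r, unfolded linear_conv_bounded_linear] f] .
  have lin: "bounded_linear (\<lambda>y :: 's ot_group. (0, axis i (fst (snd y) $ i), 0) :: 's ot_group)"
    "bounded_linear (\<lambda>y :: 's ot_group. (fst y, 0, 0) :: 's ot_group)"
    "bounded_linear (\<lambda>y :: 's ot_group. snd (snd y))"
    "bounded_linear (\<lambda>z. (0, 0, z) :: 's ot_group)" for i
    unfolding linear_conv_bounded_linear [symmetric]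
    by (auto intro!: linearI simp: axis_def vec_eq_iff)
  have 1: "Ck k (\<lambda>x. exp (f x $ i))" for i
    using Ck_exp [OF fi, where k = k and c = 1] by simp
  have 2: "Ck k (\<lambda>x. ot_char r (f x))"
    using Ck_exp [OF w, where k = k and c = 1] by (simp add: ot_char_def)
  show ?thesis
    unfolding ot_scale_expand
    by (intro Ck_add Ck_sum Ck_bilinear [OF bounded_bilinear_scaleR] Ck_bilinear [OF bounded_bilinear_mult]
       1 2 Ck_compose_linear [OF lin(1)] Ck_compose_linear [OF lin(2)]
       Ck_compose_linear [OF lin(3)] Ck_compose_linear [OF lin(4)] y)
qed

lemma smooth_left_invariant_field: "smooth (left_invariant_field r v)"
  unfolding smooth_def left_invariant_field_eq [abs_def]
  by (intro allI Ck_ot_scale bounded_linear_fst Ck_const)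

section \<open>The Hermitian structure on the Lie algebra\<close>

definition coord_sum :: "real^'s::finite \<Rightarrow> real" where
  "coord_sum a = (\<Sum>i\<in>UNIV. a $ i)"

lemma coord_sum_simps [simp]:
  "coord_sum (a + b) = coord_sum a + coord_sum b" "coord_sum (a - b) = coord_sum a - coord_sum b" "coord_sum (- a) = - coord_sum a"
  "coord_sum (c *\<^sub>R a) = c * coord_sum a" "coord_sum 0 = 0"
  by (simp_all add: coord_sum_def sum.distrib sum_subtractf sum_negf sum_distrib_left)

lemma lie_metric_eq:
  "lie_metric x y = fst x \<bullet> fst y + coord_sum (fst x) * coord_sum (fst y)
     + fst (snd x) \<bullet> fst (snd y) + coord_sum (fst (snd x)) * coord_sum (fst (snd y)) + snd (snd x) \<bullet> snd (snd y)"
proof (cases x; cases y)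
  fix a b z a' b' z' assume xy: "x = (a, b, z)" "y = (a', b', z')"
  have "(\<Sum>i\<in>UNIV. \<Sum>j\<in>UNIV. (if i = j then 2 else 1) * (a $ i * a' $ j + b $ i * b' $ j))
      = (\<Sum>i\<in>UNIV. \<Sum>j\<in>UNIV. (if i = j then a $ i * a' $ j + b $ i * b' $ j else 0)
           + (a $ i * a' $ j + b $ i * b' $ j))"
    by (intro sum.cong refl) auto
  also have "\<dots> = a \<bullet> a' + b \<bullet> b' + coord_sum a * coord_sum a' + coord_sum b * coord_sum b'"
    by (simp add: sum.distrib inner_vec_def coord_sum_def sum_product)
  finally show ?thesis
    by (simp add: xy inner_complex_def)
qed

declare lie_metric.simps [simp del]

text \<open>The Sherman-Morrison inverse of the Gram matrix \<open>I + 1 1^T\<close> of the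
  \<open>A_i\<close> (and of the \<open>B_i\<close>).\<close>

definition metric_inv :: "real^'s::finite \<Rightarrow> real^'s" where
  "metric_inv u = (\<chi> i. u $ i - coord_sum u / (real CARD('s) + 1))"

lemma coord_sum_metric_inv: "coord_sum (metric_inv u) = coord_sum u / (real CARD('s) + 1)" for u :: "real^'s::finite"
proof -
  have "coord_sum (metric_inv u) = coord_sum u - real CARD('s) * (coord_sum u / (real CARD('s) + 1))"
    by (simp add: metric_inv_def coord_sum_def sum_subtractf)
  also have "\<dots> = coord_sum u / (real CARD('s) + 1)"
    by (simp add: field_simps)
  finally show ?thesis .
qed

lemma inner_metric_inv: "metric_inv u \<bullet> v + coord_sum (metric_inv u) * coord_sum v = u \<bullet> v"
proof -
  have "metric_inv u \<bullet> v = u \<bullet> v - coord_sum (metric_inv u) * coord_sum v"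
    unfolding coord_sum_metric_inv
    by (simp add: metric_inv_def inner_vec_def left_diff_distrib sum_subtractf coord_sum_def [of v] sum_distrib_left)
  then show ?thesis
    by simp
qed

lemma linear_metric_inv: "linear metric_inv"
  by (rule linearI) (auto simp: metric_inv_def vec_eq_iff add_divide_distrib algebra_simps)

lemma metric_inv_0 [simp]: "metric_inv 0 = 0"
  by (rule linear_0 [OF linear_metric_inv])

text \<open>\<open>metric_inv\<close> raises an index and the metric lowers it again. As the
  \<open>A\<close> and \<open>B\<close> components of \<open>lie_bismut\<close> are values of
  \<open>metric_inv\<close>, its identities become polynomial ones in the coordinates.\<close>

lemma lie_metric_metric_inv:
  "lie_metric (metric_inv u, metric_inv v, z) (a, b, z') = u \<bullet> a + v \<bullet> b + z \<bullet> z'"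
  using inner_metric_inv [of u a] inner_metric_inv [of v b] by (simp add: lie_metric_eq)

lemma lie_metric_commute: "lie_metric x y = lie_metric y x"
  by (simp add: lie_metric_eq inner_commute mult.commute)

lemma lie_metric_simps [simp]:
  "lie_metric (x + y) z = lie_metric x z + lie_metric y z"
  "lie_metric z (x + y) = lie_metric z x + lie_metric z y"
  "lie_metric (x - y) z = lie_metric x z - lie_metric y z"
  "lie_metric z (x - y) = lie_metric z x - lie_metric z y"
  "lie_metric (- x) z = - lie_metric x z" "lie_metric z (- x) = - lie_metric z x"
  "lie_metric (c *\<^sub>R x) z = c * lie_metric x z" "lie_metric z (c *\<^sub>R x) = c * lie_metric z x"
  "lie_metric 0 z = 0" "lie_metric z 0 = 0"
  by (simp_all add: lie_metric_eq inner_simps algebra_simps)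

lemma bounded_bilinear_lie_metric: "bounded_bilinear lie_metric"
  unfolding bilinear_conv_bounded_bilinear [symmetric] bilinear_def
  by (intro conjI allI linearI) simp_all

lemma lie_metric_eq_0: "lie_metric x x = 0 \<longleftrightarrow> x = 0"
proof
  assume "lie_metric x x = 0"
  then have "fst x \<bullet> fst x + fst (snd x) \<bullet> fst (snd x) + snd (snd x) \<bullet> snd (snd x) \<le> 0"
    using zero_le_square [of "coord_sum (fst x)"] zero_le_square [of "coord_sum (fst (snd x))"]
    unfolding lie_metric_eq by linarith
  then have "fst x \<bullet> fst x = 0" "fst (snd x) \<bullet> fst (snd x) = 0" "snd (snd x) \<bullet> snd (snd x) = 0"
    using inner_ge_zero [of "fst x"] inner_ge_zero [of "fst (snd x)"] inner_ge_zero [of "snd (snd x)"]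
    by linarith+
  then show "x = 0"
    by (simp add: prod_eq_iff)
qed simp

lemma lie_metric_nondegenerate: "(\<And>z. lie_metric x z = 0) \<Longrightarrow> x = 0"
  using lie_metric_eq_0 by blast

lemma linear_lie_complex_structure: "linear lie_complex_structure"
  by (rule linearI) (auto simp: algebra_simps scaleR_conv_of_real split_paired_all)

lemma lie_metric_complex_structure:
  "lie_metric (lie_complex_structure x) (lie_complex_structure y) = lie_metric x y"
  by (cases x; cases y) (simp add: lie_metric_eq inner_complex_def)

lemma lie_complex_structure_square [simp]: "lie_complex_structure (lie_complex_structure v) = - v"
  by (rule lie_complex_structure_basis)

section \<open>The Bismut connection\<close>

text \<open>\<open>lie_bismut r x y\<close> is the covariant derivative of the left invariant field \<open>y\<close> along \<open>x\<close>,
  obtained from the Koszul formula and the torsion term \<open>d\<omega>(J\<cdot>, J\<cdot>, J\<cdot>) / 2\<close>.\<close>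

fun lie_bismut :: "real^'s::finite \<Rightarrow> 's ot_group \<Rightarrow> 's ot_group \<Rightarrow> 's ot_group" where
  "lie_bismut r (a, b, c) (a', b', z) =
     (metric_inv (\<chi> i. b $ i * b' $ i + coord_sum b * b' $ i - Re (cnj c * z) / 2),
      metric_inv (\<chi> i. - (b $ i * a' $ i) - coord_sum b * a' $ i - Im (cnj c * z) / 2),
      \<i> * complex_of_real (r \<bullet> a - coord_sum b / 2) * z + Complex (coord_sum a') (coord_sum b') * c / 2)"

lemma bilinear_lie_bismut: "bilinear (lie_bismut r)"
proof -
  have "lie_bismut r (x + x') y = lie_bismut r x y + lie_bismut r x' y"
    "lie_bismut r y (x + x') = lie_bismut r y x + lie_bismut r y x'"
    "lie_bismut r (k *\<^sub>R x) y = k *\<^sub>R lie_bismut r x y"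
    "lie_bismut r y (k *\<^sub>R x) = k *\<^sub>R lie_bismut r y x" for x x' y k
    by (cases x; cases x'; cases y;
      simp add: linear_add [OF linear_metric_inv, symmetric] linear_scale [OF linear_metric_inv, symmetric]
        inner_simps complex_eq_iff;
      intro conjI arg_cong [of _ _ metric_inv];
      simp add: vec_eq_iff field_simps)+
  then show ?thesis
    by (auto simp: bilinear_def intro!: linearI)
qed

lemma lie_bismut_skew: "lie_metric (lie_bismut r x y) z = - lie_metric y (lie_bismut r x z)"
proof (cases x; cases y; cases z)
  fix a b c a' b' c' a'' b'' c''
  assume "x = (a, b, c)" "y = (a', b', c')" "z = (a'', b'', c'')"
  then show ?thesis
    by (simp only: lie_bismut.simps lie_metric_commute [of "(a', b', c')"] lie_metric_metric_inv)
       (simp add: inner_vec_def inner_complex_def coord_sum_def algebra_simps sum.distrib sum_subtractf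
          sum_negf sum_distrib_left sum_distrib_right sum_divide_distrib diff_divide_distrib add_divide_distrib)
qed

lemma lie_bismut_complex:
  "lie_bismut r x (lie_complex_structure y) = lie_complex_structure (lie_bismut r x y)"
  by (cases x; cases y;
      simp add: complex_eq_iff linear_neg [OF linear_metric_inv, symmetric];
      intro conjI arg_cong [of _ _ metric_inv]; simp add: vec_eq_iff field_simps)

text \<open>Christoffel symbols at the neutral element: the left invariant field of \<open>y\<close>
  has coordinate derivative \<open>ot_delta r (fst x) y\<close> there, which has to be taken off its
  covariant derivative.\<close>

definition lie_christoffel :: "real^'s::finite \<Rightarrow> 's ot_group \<Rightarrow> 's ot_group \<Rightarrow> 's ot_group" where
  "lie_christoffel r x y = lie_bismut r x y - ot_delta r (fst x) y"

lemma ot_weight_eq: "ot_weight r a = Complex (- coord_sum a / 2) (r \<bullet> a)"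
  by (simp add: ot_weight_def complex_eq_iff coord_sum_def inner_vec_def sum_negf sum_divide_distrib)

text \<open>The antisymmetrised Christoffel symbols are the torsion, because antisymmetrising
  \<open>ot_delta\<close> gives the Lie bracket.\<close>

lemma lie_christoffel_torsion_skew:
  "lie_metric (lie_christoffel r x y - lie_christoffel r y x) z
   = - lie_metric (lie_christoffel r x z - lie_christoffel r z x) y"
proof (cases x; cases y; cases z)
  fix a b c a' b' c' a'' b'' c''
  assume xyz: "x = (a, b, c)" "y = (a', b', c')" "z = (a'', b'', c'')"
  have delta: "lie_metric (ot_delta r a1 (a2, b2, c2)) (a3, b3, c3)
      = (\<chi> i. a1 $ i * b2 $ i) \<bullet> b3 + (a1 \<bullet> b2) * coord_sum b3 + (ot_weight r a1 * c2) \<bullet> c3"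
    for a1 a2 b2 c2 a3 b3 c3
    by (simp add: ot_delta_def lie_metric_eq coord_sum_def inner_vec_def)
  show ?thesis
    by (simp only: xyz lie_christoffel_def fst_conv lie_metric_simps delta lie_bismut.simps lie_metric_metric_inv)
       (simp add: inner_vec_def ot_weight_eq inner_complex_def coord_sum_def algebra_simps sum.distrib sum_subtractf
          sum_negf sum_distrib_left sum_distrib_right sum_divide_distrib diff_divide_distrib add_divide_distrib)
qed

lemma bilinear_lie_christoffel: "bilinear (lie_christoffel r)"
  unfolding bilinear_def lie_christoffel_def
  by (intro conjI allI linearI)
     (simp_all add: bilinear_ladd [OF bilinear_lie_bismut] bilinear_radd [OF bilinear_lie_bismut]
        bilinear_lmul [OF bilinear_lie_bismut] bilinear_rmul [OF bilinear_lie_bismut]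
        bilinear_ladd [OF bilinear_ot_delta] bilinear_radd [OF bilinear_ot_delta]
        bilinear_lmul [OF bilinear_ot_delta] bilinear_rmul [OF bilinear_ot_delta] scaleR_diff_right)

definition bismut_christoffel :: "real^'s::finite \<Rightarrow> 's ot_group christoffel" where
  "bismut_christoffel r p u v =
     ot_scale r (fst p) (lie_christoffel r (ot_scale r (- fst p) u) (ot_scale r (- fst p) v))"

lemma affine_connection_bismut_christoffel: "affine_connection (bismut_christoffel r)"
  unfolding affine_connection_def smooth_def
proof (intro conjI allI)
  fix p :: "'a ot_group"
  show "bilinear (bismut_christoffel r p)"
    unfolding bilinear_def bismut_christoffel_def
    by (intro conjI allI linearI)
       (simp_all add: ot_scale_linear_simps
          bilinear_ladd [OF bilinear_lie_christoffel] bilinear_radd [OF bilinear_lie_christoffel]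
          bilinear_lmul [OF bilinear_lie_christoffel] bilinear_rmul [OF bilinear_lie_christoffel])
next
  fix u v :: "'a ot_group" and k
  have "bounded_linear (\<lambda>p :: 'a ot_group. - fst p)"
    by (intro bounded_linear_minus bounded_linear_fst)
  then show "Ck k (\<lambda>p. bismut_christoffel r p u v)"
    unfolding bismut_christoffel_def
    by (intro Ck_ot_scale bounded_linear_fst Ck_const
        Ck_bilinear [OF bilinear_lie_christoffel [unfolded bilinear_conv_bounded_bilinear]])
qed

lemma ot_delta_minus: "ot_delta r (- a) y = - ot_delta r a y"
  by (simp add: ot_delta_def vec_eq_iff linear_neg [OF linear_ot_weight])

lemma ot_delta_cancel: "ot_scale r (- t) (ot_delta r a (ot_scale r t y)) = ot_delta r a y"
  "ot_scale r t (ot_delta r a (ot_scale r (- t) y)) = ot_delta r a y"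
  by (simp_all add: ot_delta_ot_scale)

lemma has_derivative_ot_scale_fst:
  fixes Y :: "'s::finite ot_group \<Rightarrow> 's ot_group"
  assumes "(Y has_derivative Y') (at p)"
  shows "((\<lambda>q. ot_scale r (fst q) (Y q)) has_derivative
      (\<lambda>h. ot_scale r (fst p) (ot_delta r (fst h) (Y p) + Y' h))) (at p)"
    and "((\<lambda>q. ot_scale r (- fst q) (Y q)) has_derivative
      (\<lambda>h. ot_scale r (- fst p) (Y' h - ot_delta r (fst h) (Y p)))) (at p)"
proof -
  show "((\<lambda>q. ot_scale r (fst q) (Y q)) has_derivative
      (\<lambda>h. ot_scale r (fst p) (ot_delta r (fst h) (Y p) + Y' h))) (at p)"
    by (intro has_derivative_ot_scale assms has_derivative_fst has_derivative_ident)
  have "((\<lambda>q. ot_scale r (- fst q) (Y q)) has_derivative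
      (\<lambda>h. ot_scale r (- fst p) (ot_delta r (- fst h) (Y p) + Y' h))) (at p)"
    by (intro has_derivative_ot_scale assms has_derivative_minus has_derivative_fst has_derivative_ident)
  then show "((\<lambda>q. ot_scale r (- fst q) (Y q)) has_derivative
      (\<lambda>h. ot_scale r (- fst p) (Y' h - ot_delta r (fst h) (Y p)))) (at p)"
    by (simp add: ot_delta_minus)
qed

text \<open>In the left invariant frame the connection has constant coefficients, as the derivative
  of the frame cancels the \<open>ot_delta\<close> term. Any derivative \<open>y'\<close> of the
  trivialised field is accepted, so the one at hand can be used when \<open>Y\<close> is multiplied
  by the complex structure.\<close>

lemma cov_deriv_bismut_christoffel:
  fixes Y :: "'s::finite ot_group \<Rightarrow> 's ot_group"
  assumes Y: "(Y has_derivative Y') (at p)" and y: "((\<lambda>q. ot_scale r (- fst q) (Y q)) has_derivative y') (at p)"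
  shows "cov_deriv (bismut_christoffel r) X Y p =
     ot_scale r (fst p) (y' (X p) + lie_bismut r (ot_scale r (- fst p) (X p)) (ot_scale r (- fst p) (Y p)))"
proof -
  have y': "y' = (\<lambda>h. ot_scale r (- fst p) (Y' h - ot_delta r (fst h) (Y p)))"
    by (rule has_derivative_unique [OF y has_derivative_ot_scale_fst(2) [OF Y]])
  have Y': "frechet_derivative Y (at p) = Y'"
    using frechet_derivative_at [OF Y] by simp
  show ?thesis
    by (simp add: cov_deriv_def Y' y' bismut_christoffel_def lie_christoffel_def ot_scale_linear_simps
        ot_delta_cancel)
qed

lemma ot_complex_structure_eq:
  "ot_complex_structure r q u = ot_scale r (fst q) (lie_complex_structure (ot_scale r (- fst q) u))"
  by (simp add: ot_complex_structure_def left_invariant_field_eq maurer_cartan_eq)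

lemma metric_parallel_bismut_christoffel: "metric_parallel (ot_metric r) (bismut_christoffel r)"
  unfolding metric_parallel_def
proof (intro allI impI)
  fix X Y Z :: "'a ot_group \<Rightarrow> 'a ot_group" and p
  assume smooth: "smooth X" "smooth Y" "smooth Z"
  let ?y = "\<lambda>q. ot_scale r (- fst q) (Y q)" and ?z = "\<lambda>q. ot_scale r (- fst q) (Z q)"
  obtain y' z' where y: "(?y has_derivative y') (at p)" and z: "(?z has_derivative z') (at p)"
    using has_derivative_ot_scale_fst(2) [OF smooth_imp_has_derivative [OF smooth(2)]]
      has_derivative_ot_scale_fst(2) [OF smooth_imp_has_derivative [OF smooth(3)]] by blast
  have "((\<lambda>q. ot_metric r q (Y q) (Z q)) has_derivative
      (\<lambda>h. lie_metric (?y p) (z' h) + lie_metric (y' h) (?z p))) (at p)"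
    unfolding ot_metric_def maurer_cartan_eq
    by (rule bounded_bilinear.FDERIV [OF bounded_bilinear_lie_metric y z])
  then show "frechet_derivative (\<lambda>q. ot_metric r q (Y q) (Z q)) (at p) (X p)
      = ot_metric r p (cov_deriv (bismut_christoffel r) X Y p) (Z p)
        + ot_metric r p (Y p) (cov_deriv (bismut_christoffel r) X Z p)"
    unfolding cov_deriv_bismut_christoffel [OF smooth_imp_has_derivative [OF smooth(2)] y]
      cov_deriv_bismut_christoffel [OF smooth_imp_has_derivative [OF smooth(3)] z]
    by (simp add: frechet_derivative_at [symmetric] ot_metric_def maurer_cartan_eq lie_bismut_skew)
qed

lemma endomorphism_parallel_bismut_christoffel:
  "endomorphism_parallel (ot_complex_structure r) (bismut_christoffel r)"
  unfolding endomorphism_parallel_def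
proof (intro allI impI)
  fix X Y :: "'a ot_group \<Rightarrow> 'a ot_group" and p
  assume smooth: "smooth X" "smooth Y"
  let ?y = "\<lambda>q. ot_scale r (- fst q) (Y q)"
  note Y = smooth_imp_has_derivative [OF smooth(2)]
  obtain y' where y: "(?y has_derivative y') (at p)"
    using has_derivative_ot_scale_fst(2) [OF Y] by blast
  have jy: "((\<lambda>q. lie_complex_structure (?y q)) has_derivative (\<lambda>h. lie_complex_structure (y' h))) (at p)"
    by (rule bounded_linear.has_derivative
        [OF linear_lie_complex_structure [unfolded linear_conv_bounded_linear] y])
  have JY: "((\<lambda>q. ot_complex_structure r q (Y q)) has_derivative
      (\<lambda>h. ot_scale r (fst p) (ot_delta r (fst h) (lie_complex_structure (?y p)) + lie_complex_structure (y' h)))) (at p)"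
    unfolding ot_complex_structure_eq by (rule has_derivative_ot_scale_fst(1) [OF jy])
  have "((\<lambda>q. ot_scale r (- fst q) (ot_complex_structure r q (Y q))) has_derivative
      (\<lambda>h. lie_complex_structure (y' h))) (at p)"
    using jy by (simp add: ot_complex_structure_eq)
  from cov_deriv_bismut_christoffel [OF JY this] cov_deriv_bismut_christoffel [OF Y y]
  show "cov_deriv (bismut_christoffel r) X (\<lambda>q. ot_complex_structure r q (Y q)) p
      = ot_complex_structure r p (cov_deriv (bismut_christoffel r) X Y p)"
    by (simp add: ot_complex_structure_eq lie_bismut_complex linear_add [OF linear_lie_complex_structure])
qed

lemma torsion_eq:
  "torsion D X Y p = D p (X p) (Y p) - D p (Y p) (X p)"
  by (simp add: torsion_def cov_deriv_def lie_bracket_def)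

lemma skew_torsion_bismut_christoffel: "skew_torsion (ot_metric r) (bismut_christoffel r)"
proof -
  have "ot_metric r p (torsion (bismut_christoffel r) X Y p) (Z p)
      = - ot_metric r p (torsion (bismut_christoffel r) X Z p) (Y p)" for X Y Z p
    using lie_christoffel_torsion_skew [of r "ot_scale r (- fst p) (X p)" "ot_scale r (- fst p) (Y p)"
        "ot_scale r (- fst p) (Z p)"]
    by (simp add: torsion_eq bismut_christoffel_def ot_metric_def maurer_cartan_eq ot_scale_linear_simps)
  then show ?thesis
    unfolding skew_torsion_def by blast
qed

text \<open>The difference of two such connections is totally skew-symmetric by metricity and skew torsion,
  and \<open>k(Jx,y,z) = - k(x,Jy,z) = k(x,y,Jz) = - k(Jx,y,z)\<close> makes it vanish.\<close>

lemma skew_complex_trilinear_zero: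
  fixes K :: "'s::finite ot_group \<Rightarrow> 's ot_group \<Rightarrow> 's ot_group"
  assumes metric: "\<And>x y z. lie_metric (K x y) z + lie_metric y (K x z) = 0"
    and torsion: "\<And>x y z. lie_metric (K x y - K y x) z = - lie_metric (K x z - K z x) y"
    and complex: "\<And>x y. K x (lie_complex_structure y) = lie_complex_structure (K x y)"
  shows "K x y = 0"
proof -
  let ?J = lie_complex_structure
  let ?k = "\<lambda>x y z. lie_metric (K x y) z"
  have s23: "?k x y z = - ?k x z y" for x y z
    using metric [of x y z] by (simp add: lie_metric_commute [of y])
  have s13: "?k x y z = - ?k z y x" for x y z
    using torsion [of y x z] s23 [of y x z] by simp
  have J: "lie_metric (?J u) v = - lie_metric u (?J v)" for u v :: "'s ot_group"
    using lie_metric_complex_structure [of u "?J v"] by simp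
  have J23: "?k x (?J y) z = - ?k x y (?J z)" for x y z
    by (simp add: complex J)
  have J12: "?k (?J x) y z = - ?k x (?J y) z" for x y z
    using s13 [of "?J x" y z] s23 [of z y "?J x"] J23 [of z x y] s23 [of z x "?J y"] s13 [of z "?J y" x] by simp
  have J13: "?k (?J x) y z = - ?k x y (?J z)" for x y z
    using s23 [of "?J x" y z] J12 [of x z y] s23 [of x "?J z" y] by simp
  have "?k (?J x) y z = 0" for x z
    using J12 [of x y z] J23 [of x y z] J13 [of x y z] by linarith
  from this [of "?J (- x)"] show ?thesis
    by (intro lie_metric_nondegenerate) (simp add: linear_neg [OF linear_lie_complex_structure])
qed

lemma cov_deriv_left_invariant:
  fixes p :: "'s::finite ot_group"
  shows
  "cov_deriv D (left_invariant_field r x) (left_invariant_field r y) p =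
     ot_scale r (fst p) (ot_delta r (fst x) y) + D p (ot_scale r (fst p) x) (ot_scale r (fst p) y)"
proof -
  have "(left_invariant_field r y has_derivative
      (\<lambda>h. ot_scale r (fst p) (ot_delta r (fst h) y + 0))) (at p)"
    unfolding left_invariant_field_eq [abs_def]
    by (rule has_derivative_ot_scale_fst(1) [OF has_derivative_const])
  then show ?thesis
    by (simp add: cov_deriv_def frechet_derivative_at [symmetric] left_invariant_field_eq)
qed

text \<open>For uniqueness a competitor is tested on left invariant fields, on which the metric and
  the complex structure are constant. Its difference \<open>K\<close> from the candidate, moved to
  the Lie algebra, then satisfies purely algebraic conditions.\<close>

theorem bismut_connection_eq:
  fixes r :: "real^'s::finite"
  shows
  "bismut_connection (ot_metric r) (ot_complex_structure r) = bismut_christoffel r"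
  unfolding bismut_connection_def
proof (rule the_equality)
  show "affine_connection (bismut_christoffel r) \<and> metric_parallel (ot_metric r) (bismut_christoffel r) \<and>
      endomorphism_parallel (ot_complex_structure r) (bismut_christoffel r) \<and>
      skew_torsion (ot_metric r) (bismut_christoffel r)"
    using affine_connection_bismut_christoffel metric_parallel_bismut_christoffel
      endomorphism_parallel_bismut_christoffel skew_torsion_bismut_christoffel by blast
next
  fix D
  assume "affine_connection D \<and> metric_parallel (ot_metric r) D \<and>
      endomorphism_parallel (ot_complex_structure r) D \<and> skew_torsion (ot_metric r) D"
  then have metric: "metric_parallel (ot_metric r) D" 
    and complex: "endomorphism_parallel (ot_complex_structure r) D"
    and torsion: "skew_torsion (ot_metric r) D"
    by auto
  show "D = bismut_christoffel r"
  proof (intro ext)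
    fix p u v :: "'s ot_group"
    let ?S = "ot_scale r (fst p)" and ?S' = "ot_scale r (- fst p)" and ?F = "left_invariant_field r"
    define K where "K x y = ?S' (D p (?S x) (?S y)) - lie_christoffel r x y" for x y
    have D: "D p (?S x) (?S y) = ?S (K x y + lie_christoffel r x y)" for x y
      by (simp add: K_def)
    have cov: "cov_deriv D (?F x) (?F y) p = ?S (K x y + lie_bismut r x y)" for x y
      by (simp add: cov_deriv_left_invariant D lie_christoffel_def ot_scale_linear_simps)
    have g: "ot_metric r q (?F x q) (?F y q) = lie_metric x y" for q x y
      by (simp add: ot_metric_def maurer_cartan_eq left_invariant_field_eq)
    have gS: "ot_metric r p (?S x) (?F y p) = lie_metric x y" "ot_metric r p (?F y p) (?S x) = lie_metric y x" for x y
      using g [of p x y] g [of p y x] by (simp_all add: left_invariant_field_eq)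
    have "K x y = 0" for x y
    proof (rule skew_complex_trilinear_zero [of K])
      fix x y z
      have "frechet_derivative (\<lambda>q. ot_metric r q (?F y q) (?F z q)) (at p) (?F x p)
          = ot_metric r p (cov_deriv D (?F x) (?F y) p) (?F z p) + ot_metric r p (?F y p) (cov_deriv D (?F x) (?F z) p)"
        using metric smooth_left_invariant_field unfolding metric_parallel_def by blast
      then show "lie_metric (K x y) z + lie_metric y (K x z) = 0"
        by (simp add: g cov gS lie_bismut_skew)
    next
      fix x y z
      have "ot_metric r p (torsion D (?F x) (?F y) p) (?F z p) = - ot_metric r p (torsion D (?F x) (?F z) p) (?F y p)"
        using torsion smooth_left_invariant_field unfolding skew_torsion_def by blast
      moreover have "torsion D (?F x) (?F y) p = ?S ((K x y - K y x) + (lie_christoffel r x y - lie_christoffel r y x))" for x y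
        by (simp add: torsion_eq left_invariant_field_eq D ot_scale_linear_simps)
      ultimately have "lie_metric ((K x y - K y x) + (lie_christoffel r x y - lie_christoffel r y x)) z
          = - lie_metric ((K x z - K z x) + (lie_christoffel r x z - lie_christoffel r z x)) y"
        by (simp only: gS)
      then show "lie_metric (K x y - K y x) z = - lie_metric (K x z - K z x) y"
        using lie_christoffel_torsion_skew [of r x y z] by simp
    next
      fix x y
      have F: "ot_complex_structure r q (?F y q) = ?F (lie_complex_structure y) q" for q
        by (simp add: ot_complex_structure_eq left_invariant_field_eq)
      have "cov_deriv D (?F x) (\<lambda>q. ot_complex_structure r q (?F y q)) p
          = ot_complex_structure r p (cov_deriv D (?F x) (?F y) p)"
        using complex smooth_left_invariant_field unfolding endomorphism_parallel_def by blast
      then have "?S (K x (lie_complex_structure y) + lie_bismut r x (lie_complex_structure y))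
          = ?S (lie_complex_structure (K x y + lie_bismut r x y))"
        unfolding F cov by (simp add: ot_complex_structure_eq)
      then have "?S' (?S (K x (lie_complex_structure y) + lie_bismut r x (lie_complex_structure y)))
          = ?S' (?S (lie_complex_structure (K x y + lie_bismut r x y)))"
        by (rule arg_cong)
      then show "K x (lie_complex_structure y) = lie_complex_structure (K x y)"
        by (simp add: lie_bismut_complex linear_add [OF linear_lie_complex_structure])
    qed
    then show "D p u v = bismut_christoffel r p u v"
      using D [of "?S' u" "?S' v"] by (simp add: bismut_christoffel_def)
  qed
qed

section \<open>Parallel transport in the left trivialisation\<close>

lemma continuous_on_ot_scale:
  assumes "continuous_on S f" "continuous_on S y"
  shows "continuous_on S (\<lambda>x. ot_scale r (f x) (y x))"
proof -
  have c: "continuous_on UNIV (ot_char r)"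
    by (rule has_derivative_continuous_on [OF has_derivative_ot_char])
  show ?thesis
    unfolding ot_scale_def
    by (intro continuous_intros assms continuous_on_compose2 [OF c]) auto
qed

text \<open>The equation of parallel transport for \<open>y = ot_scale r (- fst c) V\<close>; the
  first argument of \<open>lie_bismut\<close> is the left logarithmic derivative of
  \<open>c\<close>.\<close>

definition lie_transport :: "real^'s::finite \<Rightarrow> (real \<Rightarrow> 's ot_group) \<Rightarrow> (real \<Rightarrow> 's ot_group) \<Rightarrow> bool" where
  "lie_transport r c y \<longleftrightarrow>
     continuous_on {0..1} y \<and>
     (\<exists>S. finite S \<and>
       (\<forall>t\<in>{0..1} - S. \<exists>w. (c has_vector_derivative w) (at t within {0..1}) \<and>
          (y has_vector_derivative - lie_bismut r (ot_scale r (- fst (c t)) w) (y t)) (at t within {0..1})))"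

lemma has_vector_derivative_ot_scale:
  assumes "(f has_vector_derivative f') (at t within S)" "(y has_vector_derivative y') (at t within S)"
  shows "((\<lambda>t. ot_scale r (f t) (y t)) has_vector_derivative
     ot_scale r (f t) (ot_delta r f' (y t) + y')) (at t within S)"
proof -
  have "ot_delta r (h *\<^sub>R f') (y t) + h *\<^sub>R y' = h *\<^sub>R (ot_delta r f' (y t) + y')" for h
    by (simp add: bilinear_lmul [OF bilinear_ot_delta] scaleR_add_right)
  then show ?thesis
    using has_derivative_ot_scale [OF assms [unfolded has_vector_derivative_def], of r]
    by (simp add: has_vector_derivative_def linear_scale [OF linear_ot_scale])
qed

lemma has_vector_derivative_fst:
  "(c has_vector_derivative w) F \<Longrightarrow> ((\<lambda>t. fst (c t)) has_vector_derivative fst w) F"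
  by (rule bounded_linear.has_vector_derivative [OF bounded_linear_fst])

lemma parallel_along_imp_lie_transport:
  assumes c: "continuous_on {0..1} c" and V: "parallel_along (bismut_christoffel r) c V"
  shows "lie_transport r c (\<lambda>t. ot_scale r (- fst (c t)) (V t))"
proof -
  obtain S where S: "finite S" "\<And>t. t \<in> {0..1} - S \<Longrightarrow> \<exists>w. (c has_vector_derivative w) (at t within {0..1}) \<and>
          (V has_vector_derivative - bismut_christoffel r (c t) w (V t)) (at t within {0..1})"
    using V unfolding parallel_along_def by blast
  have "\<exists>w. (c has_vector_derivative w) (at t within {0..1}) \<and>
      ((\<lambda>t. ot_scale r (- fst (c t)) (V t)) has_vector_derivative
        - lie_bismut r (ot_scale r (- fst (c t)) w) (ot_scale r (- fst (c t)) (V t))) (at t within {0..1})"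
    if t: "t \<in> {0..1} - S" for t
  proof -
    obtain w where w: "(c has_vector_derivative w) (at t within {0..1})"
      "(V has_vector_derivative - bismut_christoffel r (c t) w (V t)) (at t within {0..1})"
      using S(2) t by blast
    from has_vector_derivative_ot_scale [OF has_vector_derivative_minus [OF has_vector_derivative_fst [OF w(1)]] w(2), of r]
    have "((\<lambda>t. ot_scale r (- fst (c t)) (V t)) has_vector_derivative
        - lie_bismut r (ot_scale r (- fst (c t)) w) (ot_scale r (- fst (c t)) (V t))) (at t within {0..1})"
      by (simp add: bismut_christoffel_def lie_christoffel_def ot_scale_linear_simps ot_delta_minus ot_delta_ot_scale)
    with w(1) show ?thesis by blast
  qed
  moreover have "continuous_on {0..1} (\<lambda>t. ot_scale r (- fst (c t)) (V t))"
    using V unfolding parallel_along_def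
    by (intro continuous_on_ot_scale continuous_intros c) auto
  ultimately show ?thesis
    using S(1) unfolding lie_transport_def by blast
qed

lemma lie_transport_imp_parallel_along:
  assumes c: "continuous_on {0..1} c" and y: "lie_transport r c y"
  shows "parallel_along (bismut_christoffel r) c (\<lambda>t. ot_scale r (fst (c t)) (y t))"
proof -
  obtain S where S: "finite S" "\<And>t. t \<in> {0..1} - S \<Longrightarrow> \<exists>w. (c has_vector_derivative w) (at t within {0..1}) \<and>
          (y has_vector_derivative - lie_bismut r (ot_scale r (- fst (c t)) w) (y t)) (at t within {0..1})"
    using y unfolding lie_transport_def by blast
  have "\<exists>w. (c has_vector_derivative w) (at t within {0..1}) \<and>
      ((\<lambda>t. ot_scale r (fst (c t)) (y t)) has_vector_derivative
        - bismut_christoffel r (c t) w (ot_scale r (fst (c t)) (y t))) (at t within {0..1})"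
    if t: "t \<in> {0..1} - S" for t
  proof -
    obtain w where w: "(c has_vector_derivative w) (at t within {0..1})"
      "(y has_vector_derivative - lie_bismut r (ot_scale r (- fst (c t)) w) (y t)) (at t within {0..1})"
      using S(2) t by blast
    from has_vector_derivative_ot_scale [OF has_vector_derivative_fst [OF w(1)] w(2), of r]
    have "((\<lambda>t. ot_scale r (fst (c t)) (y t)) has_vector_derivative
        - bismut_christoffel r (c t) w (ot_scale r (fst (c t)) (y t))) (at t within {0..1})"
      by (simp add: bismut_christoffel_def lie_christoffel_def ot_scale_linear_simps)
    with w(1) show ?thesis by blast
  qed
  moreover have "continuous_on {0..1} (\<lambda>t. ot_scale r (fst (c t)) (y t))"
    using y unfolding lie_transport_def
    by (intro continuous_on_ot_scale continuous_intros c) auto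
  ultimately show ?thesis
    using S(1) unfolding parallel_along_def by blast
qed

text \<open>Each transport comes with its own witness for the velocity of \<open>c\<close>.
  Derivatives within \<open>{0..1}\<close> are unique, so a single \<open>\<xi>\<close> serves
  both.\<close>

lemma lie_transport_common_velocity:
  assumes "lie_transport r c x" "lie_transport r c y"
  obtains S \<xi> where "finite S"
    "\<And>t. t \<in> {0..1} - S \<Longrightarrow> (x has_vector_derivative - lie_bismut r (\<xi> t) (x t)) (at t within {0..1})"
    "\<And>t. t \<in> {0..1} - S \<Longrightarrow> (y has_vector_derivative - lie_bismut r (\<xi> t) (y t)) (at t within {0..1})"
    "\<And>t. t \<in> {0..1} - S \<Longrightarrow> \<exists>w. (c has_vector_derivative w) (at t within {0..1}) \<and> \<xi> t = ot_scale r (- fst (c t)) w"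
proof -
  obtain S S' where S: "finite S" "finite S'"
      "\<And>t. t \<in> {0..1} - S \<Longrightarrow> \<exists>w. (c has_vector_derivative w) (at t within {0..1}) \<and>
          (x has_vector_derivative - lie_bismut r (ot_scale r (- fst (c t)) w) (x t)) (at t within {0..1})"
      "\<And>t. t \<in> {0..1} - S' \<Longrightarrow> \<exists>w. (c has_vector_derivative w) (at t within {0..1}) \<and>
          (y has_vector_derivative - lie_bismut r (ot_scale r (- fst (c t)) w) (y t)) (at t within {0..1})"
    using assms unfolding lie_transport_def by blast
  let ?\<xi> = "\<lambda>t. ot_scale r (- fst (c t)) (vector_derivative c (at t within {0..1}))"
  have eq: "vector_derivative c (at t within {0..1}) = w"
    if "t \<in> {0..1}" "(c has_vector_derivative w) (at t within {0..1})" for t w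
    using that vector_derivative_within_cbox [of 0 1 t c w] by simp
  show ?thesis
  proof (rule that [of "S \<union> S'" ?\<xi>])
    show "finite (S \<union> S')"
      using S by simp
    fix t assume t: "t \<in> {0..1} - (S \<union> S')"
    obtain w where w: "(c has_vector_derivative w) (at t within {0..1})"
        "(x has_vector_derivative - lie_bismut r (ot_scale r (- fst (c t)) w) (x t)) (at t within {0..1})"
      using S(3) t by blast
    obtain w' where w': "(c has_vector_derivative w') (at t within {0..1})"
        "(y has_vector_derivative - lie_bismut r (ot_scale r (- fst (c t)) w') (y t)) (at t within {0..1})"
      using S(4) t by blast
    show "(x has_vector_derivative - lie_bismut r (?\<xi> t) (x t)) (at t within {0..1})"
      using eq [OF _ w(1)] w(2) t by simp
    show "(y has_vector_derivative - lie_bismut r (?\<xi> t) (y t)) (at t within {0..1})"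
      using eq [OF _ w'(1)] w'(2) t by simp
    show "\<exists>w. (c has_vector_derivative w) (at t within {0..1}) \<and> ?\<xi> t = ot_scale r (- fst (c t)) w"
      using eq [OF _ w(1)] w(1) t by (intro exI [of _ w]) simp
  qed
qed

text \<open>The product has zero derivative by \<open>lie_bismut_skew\<close> off a finite set, and
  continuity carries it across the exceptional points.\<close>

lemma lie_transport_metric:
  assumes "lie_transport r c x" "lie_transport r c y"
  shows "lie_metric (x 1) (y 1) = lie_metric (x 0) (y 0)"
proof -
  obtain S \<xi> where S: "finite S"
    "\<And>t. t \<in> {0..1} - S \<Longrightarrow> (x has_vector_derivative - lie_bismut r (\<xi> t) (x t)) (at t within {0..1})"
    "\<And>t. t \<in> {0..1} - S \<Longrightarrow> (y has_vector_derivative - lie_bismut r (\<xi> t) (y t)) (at t within {0..1})"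
    using lie_transport_common_velocity [OF assms] by metis
  show ?thesis
  proof (rule has_derivative_zero_unique_strong_interval
      [OF S(1), where a = 0 and b = 1 and f = "\<lambda>t. lie_metric (x t) (y t)" and x = 1])
    show "continuous_on {0..1} (\<lambda>t. lie_metric (x t) (y t))"
      using assms unfolding lie_transport_def
      by (intro bounded_bilinear.continuous_on [OF bounded_bilinear_lie_metric]) auto
    fix t assume t: "t \<in> {0..1} - S"
    have "((\<lambda>t. lie_metric (x t) (y t)) has_vector_derivative
        lie_metric (x t) (- lie_bismut r (\<xi> t) (y t)) + lie_metric (- lie_bismut r (\<xi> t) (x t)) (y t))
        (at t within {0..1})"
      by (intro bounded_bilinear.has_vector_derivative [OF bounded_bilinear_lie_metric] S t)
    then show "((\<lambda>t. lie_metric (x t) (y t)) has_derivative (\<lambda>h. 0)) (at t within {0..1})"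
      by (simp add: has_vector_derivative_def lie_bismut_skew)
  qed auto
qed

lemma lie_transport_combination:
  assumes "lie_transport r c x" "lie_transport r c y"
  shows "lie_transport r c (\<lambda>t. a *\<^sub>R x t + b *\<^sub>R y t)"
proof -
  obtain S \<xi> where S: "finite S"
    "\<And>t. t \<in> {0..1} - S \<Longrightarrow> (x has_vector_derivative - lie_bismut r (\<xi> t) (x t)) (at t within {0..1})"
    "\<And>t. t \<in> {0..1} - S \<Longrightarrow> (y has_vector_derivative - lie_bismut r (\<xi> t) (y t)) (at t within {0..1})"
    "\<And>t. t \<in> {0..1} - S \<Longrightarrow> \<exists>w. (c has_vector_derivative w) (at t within {0..1}) \<and> \<xi> t = ot_scale r (- fst (c t)) w"
    using lie_transport_common_velocity [OF assms] by metis
  have lin: "- lie_bismut r \<eta> (a *\<^sub>R u + b *\<^sub>R v) = a *\<^sub>R (- lie_bismut r \<eta> u) + b *\<^sub>R (- lie_bismut r \<eta> v)" for \<eta> u v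
    by (simp add: bilinear_radd [OF bilinear_lie_bismut] bilinear_rmul [OF bilinear_lie_bismut])
  have deriv: "((\<lambda>t. a *\<^sub>R x t + b *\<^sub>R y t) has_vector_derivative
      - lie_bismut r (\<xi> t) (a *\<^sub>R x t + b *\<^sub>R y t)) (at t within {0..1})" if "t \<in> {0..1} - S" for t
    unfolding lin
    by (intro has_vector_derivative_add S(2) S(3) that
        bounded_linear.has_vector_derivative [OF bounded_linear_scaleR_right])
  moreover have "continuous_on {0..1} (\<lambda>t. a *\<^sub>R x t + b *\<^sub>R y t)"
    using assms unfolding lie_transport_def by (intro continuous_intros) auto
  moreover have "\<exists>w. (c has_vector_derivative w) (at t within {0..1}) \<and>
      ((\<lambda>t. a *\<^sub>R x t + b *\<^sub>R y t) has_vector_derivative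
        - lie_bismut r (ot_scale r (- fst (c t)) w) (a *\<^sub>R x t + b *\<^sub>R y t)) (at t within {0..1})"
    if t: "t \<in> {0..1} - S" for t
    using S(4) [OF t] deriv [OF t] by (elim exE conjE) (simp only:, blast)
  ultimately show ?thesis
    using S(1) unfolding lie_transport_def by blast
qed

lemma lie_transport_complex_structure:
  assumes "lie_transport r c x"
  shows "lie_transport r c (\<lambda>t. lie_complex_structure (x t))"
proof -
  note bl = linear_lie_complex_structure [unfolded linear_conv_bounded_linear]
  have "- lie_bismut r \<xi> (lie_complex_structure u) = lie_complex_structure (- lie_bismut r \<xi> u)" for \<xi> u
    by (simp add: lie_bismut_complex linear_neg [OF linear_lie_complex_structure])
  then show ?thesis
    using assms bounded_linear.has_vector_derivative [OF bl] bounded_linear.continuous_on [OF bl]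
    unfolding lie_transport_def by metis
qed

text \<open>No uniqueness theorem for differential equations is involved: the difference is again a
  transport, and its length is preserved.\<close>

lemma lie_transport_unique:
  assumes "lie_transport r c x" "lie_transport r c y" "x 0 = y 0"
  shows "x 1 = y 1"
proof -
  let ?z = "\<lambda>t. 1 *\<^sub>R x t + (-1) *\<^sub>R y t"
  have z: "lie_transport r c ?z"
    by (rule lie_transport_combination [OF assms(1,2)])
  have "lie_metric (?z 1) (?z 1) = 0"
    using lie_transport_metric [OF z z] assms(3) by simp
  then have "?z 1 = 0"
    unfolding lie_metric_eq_0 .
  then show ?thesis
    by simp
qed

text \<open>Nothing is assumed of \<open>T\<close> but that it gives the end values of transports;
  its linearity and compatibility with the complex structure come from uniqueness.\<close>

lemma lie_transport_unitary:
  assumes "\<And>x. \<exists>y. lie_transport r c y \<and> y 0 = x \<and> y 1 = T x"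
  shows "T \<in> unitary_group lie_metric lie_complex_structure"
proof -
  obtain y where y: "\<And>x. lie_transport r c (y x)" "\<And>x. y x 0 = x" "\<And>x. y x 1 = T x"
    using assms by metis
  have comb: "T (a *\<^sub>R u + b *\<^sub>R v) = a *\<^sub>R T u + b *\<^sub>R T v" for a b u v
    using lie_transport_unique [OF y(1) lie_transport_combination [OF y(1) y(1)],
        of "a *\<^sub>R u + b *\<^sub>R v" a u b v] by (simp add: y)
  have "linear T"
    using comb [of 1 _ 1] comb [of _ _ 0] by (intro linearI) simp_all
  moreover have "lie_metric (T u) (T v) = lie_metric u v" for u v
    using lie_transport_metric [OF y(1) y(1), of u v] by (simp add: y)
  moreover have "T (lie_complex_structure u) = lie_complex_structure (T u)" for u
    using lie_transport_unique [OF y(1) lie_transport_complex_structure [OF y(1)],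
        of "lie_complex_structure u" u] by (simp add: y)
  ultimately show ?thesis
    unfolding unitary_group_def by blast
qed

lemma unitary_group_left_trivialisation:
  "A \<in> unitary_group (ot_metric r p) (ot_complex_structure r p) \<longleftrightarrow>
   (\<lambda>x. ot_scale r (- fst p) (A (ot_scale r (fst p) x))) \<in> unitary_group lie_metric lie_complex_structure"
  (is "_ \<longleftrightarrow> ?B \<in> _")
proof -
  let ?S = "ot_scale r (fst p)" and ?S' = "ot_scale r (- fst p)"
  have A: "A = (\<lambda>u. ?S (?B (?S' u)))"
    by simp
  have "linear A \<longleftrightarrow> linear ?B"
  proof
    assume "linear A"
    then show "linear ?B"
      using linear_compose [OF linear_compose [OF linear_ot_scale [of r "fst p"] \<open>linear A\<close>] linear_ot_scale [of r "- fst p"]]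
      by (simp add: o_def)
  next
    assume B: "linear ?B"
    show "linear A"
      using linear_compose [OF linear_compose [OF linear_ot_scale [of r "- fst p"] B] linear_ot_scale [of r "fst p"]]
      by (simp add: o_def)
  qed
  moreover have "(\<forall>u v. ot_metric r p (A u) (A v) = ot_metric r p u v) \<longleftrightarrow>
      (\<forall>x y. lie_metric (?B x) (?B y) = lie_metric x y)"
    unfolding ot_metric_def maurer_cartan_eq by (metis ot_scale_cancel)
  moreover have "(\<forall>u. A (ot_complex_structure r p u) = ot_complex_structure r p (A u)) \<longleftrightarrow>
      (\<forall>x. ?B (lie_complex_structure x) = lie_complex_structure (?B x))"
    unfolding ot_complex_structure_eq by (metis ot_scale_cancel)
  ultimately show ?thesis
    by (simp add: unitary_group_def)
qed

lemma piecewise_smooth_path_continuous: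
  assumes "piecewise_smooth_path c"
  shows "continuous_on {0..1} c"
proof -
  obtain S where S: "finite S" "\<And>a b. 0 \<le> a \<Longrightarrow> a < b \<Longrightarrow> b \<le> 1 \<Longrightarrow> {a<..<b} \<inter> S = {} \<Longrightarrow>
      \<exists>f. smooth f \<and> (\<forall>t\<in>{a..b}. c t = f t)"
    using assms unfolding piecewise_smooth_path_def by blast
  have piece: "continuous_on {a..b} c" if ab: "0 \<le> a" "b \<le> 1" "{a<..<b} \<inter> S = {}" for a b
  proof (cases "a < b")
    case True
    then obtain f where f: "smooth f" "\<And>t. t \<in> {a..b} \<Longrightarrow> c t = f t"
      using S(2) [OF ab(1) True ab(2,3)] by blast
    have "Ck 0 f"
      using f(1) unfolding smooth_def by blast
    then have "continuous_on {a..b} f"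
      by (auto intro: continuous_on_subset)
    then show ?thesis
      by (rule continuous_on_eq) (simp add: f(2))
  next
    case False
    then have "{a..b} = {} \<or> {a..b} = {a}"
      by auto
    then show ?thesis
      by auto
  qed
  show ?thesis
    unfolding continuous_on_eq_continuous_within
  proof
    fix t :: real assume t: "t \<in> {0..1}"
    \<comment> \<open>\<open>d\<close> separates \<open>t\<close> from all other break points, so
      each one-sided interval at \<open>t\<close> is a smooth piece; at \<open>0\<close> or
      \<open>1\<close> one of them degenerates to a point.\<close>
    obtain d where d: "d > 0" "\<And>x. x \<in> S \<Longrightarrow> x \<noteq> t \<Longrightarrow> d \<le> dist t x"
      using finite_set_avoid [OF S(1), of t] by auto
    define a b where "a = max 0 (t - d)" and "b = min 1 (t + d)"
    have "{a<..<t} \<inter> S = {}" "{t<..<b} \<inter> S = {}"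
      using d(2) unfolding a_def b_def by (fastforce simp: dist_real_def)+
    then have "continuous_on {a..t} c" "continuous_on {t..b} c"
      using t d(1) by (auto intro!: piece simp: a_def b_def)
    then have "continuous_on ({a..t} \<union> {t..b}) c"
      by (intro continuous_on_closed_Un) auto
    moreover have "{a..t} \<union> {t..b} = {a..b}"
      using t d(1) by (auto simp: a_def b_def)
    ultimately have "continuous (at t within {a..b}) c"
      using t d(1) by (auto simp: continuous_on_eq_continuous_within a_def b_def)
    moreover have "at t within {a..b} = at t within {0..1}"
      by (rule at_within_nhd [of _ "{t - d<..<t + d}"]) (use d(1) in \<open>auto simp: a_def b_def\<close>)
    ultimately show "continuous (at t within {0..1}) c"
      by simp
  qed
qed

text \<open>Left translations preserve the left invariant frame, so in the trivialisation the
  differential of a deck transformation is the identity and \<open>A\<close> becomes the transport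
  itself.\<close>

lemma quotient_holonomy_subset:
  "quotient_holonomy_group (ot_mult r ` G) (bismut_christoffel r) p
     \<subseteq> unitary_group (ot_metric r p) (ot_complex_structure r p)"
proof
  fix A assume "A \<in> quotient_holonomy_group (ot_mult r ` G) (bismut_christoffel r) p"
  then obtain g c where c: "piecewise_smooth_path c" "c 0 = p" "c 1 = ot_mult r g p"
    and V: "\<And>v. \<exists>V. parallel_along (bismut_christoffel r) c V \<and> V 0 = v \<and> V 1 = ot_scale r (fst g) (A v)"
    unfolding quotient_holonomy_group_def by (auto simp: frechet_derivative_ot_mult)
  have c1: "fst (c 1) = fst g + fst p"
    unfolding c by (cases g; cases p) simp
  show "A \<in> unitary_group (ot_metric r p) (ot_complex_structure r p)"
    unfolding unitary_group_left_trivialisation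
  proof (rule lie_transport_unitary)
    fix x
    obtain V where V: "parallel_along (bismut_christoffel r) c V" "V 0 = ot_scale r (fst p) x"
      "V 1 = ot_scale r (fst g) (A (ot_scale r (fst p) x))"
      using V by blast
    show "\<exists>y. lie_transport r c y \<and> y 0 = x \<and> y 1 = ot_scale r (- fst p) (A (ot_scale r (fst p) x))"
    proof (intro exI conjI)
      show "lie_transport r c (\<lambda>t. ot_scale r (- fst (c t)) (V t))"
        by (rule parallel_along_imp_lie_transport [OF piecewise_smooth_path_continuous [OF c(1)] V(1)])
    qed (simp_all add: V c1, simp_all add: c ot_scale_ot_scale)
  qed
qed

section \<open>Transport along concatenated paths\<close>

lemma Ck_compose_affine:
  fixes f :: "real \<Rightarrow> 'a::real_normed_vector"
  shows "Ck k f \<Longrightarrow> Ck k (\<lambda>t. f (m * t + d))"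
proof (induction k arbitrary: f)
  case 0
  then show ?case
    by (auto intro!: continuous_on_compose2 [of UNIV f] continuous_intros)
next
  case (Suc k)
  have "((\<lambda>t. m * t + d) has_derivative (\<lambda>h. m * h)) (at t)" for t
    by (auto intro!: derivative_eq_intros)
  from has_derivative_compose [OF this Ck_Suc_has_derivative [OF Suc.prems]]
  show ?case
    by (rule Ck_cong_derivative) (use Suc in auto)
qed

lemma piecewise_smooth_path_join:
  assumes "piecewise_smooth_path c" "piecewise_smooth_path c'" "c 1 = c' 0"
  shows "piecewise_smooth_path (c +++ c')"
proof -
  obtain S S' where S: "finite S" "\<And>a b. 0 \<le> a \<Longrightarrow> a < b \<Longrightarrow> b \<le> 1 \<Longrightarrow> {a<..<b} \<inter> S = {} \<Longrightarrow>
      \<exists>f. smooth f \<and> (\<forall>t\<in>{a..b}. c t = f t)"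
    and S': "finite S'" "\<And>a b. 0 \<le> a \<Longrightarrow> a < b \<Longrightarrow> b \<le> 1 \<Longrightarrow> {a<..<b} \<inter> S' = {} \<Longrightarrow>
      \<exists>f. smooth f \<and> (\<forall>t\<in>{a..b}. c' t = f t)"
    using assms(1,2) unfolding piecewise_smooth_path_def by blast
  let ?R = "{1/2} \<union> (\<lambda>s. s / 2) ` S \<union> (\<lambda>s. (s + 1) / 2) ` S'"
  have piece: "\<exists>f. smooth f \<and> (\<forall>t\<in>{a..b}. (c +++ c') t = f t)"
    if ab: "0 \<le> a" "a < b" "b \<le> 1" "{a<..<b} \<inter> ?R = {}" for a b
  proof -
    have "1/2 \<notin> {a<..<b}"
      using ab(4) by blast
    then consider "b \<le> 1/2" | "1/2 \<le> a"
      by fastforce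
    then show ?thesis
    proof cases
      case 1
      have "s / 2 \<in> {a<..<b} \<inter> ?R" if "s \<in> {2*a<..<2*b} \<inter> S" for s
        using that by auto
      then have "{2*a<..<2*b} \<inter> S = {}"
        using ab(4) by blast
      then obtain f where f: "smooth f" "\<And>t. t \<in> {2*a..2*b} \<Longrightarrow> c t = f t"
        using S(2) [of "2*a" "2*b"] ab 1 by auto
      have "smooth (\<lambda>t. f (2 * t + 0))"
        using f(1) Ck_compose_affine unfolding smooth_def by blast
      moreover have "(c +++ c') t = f (2 * t + 0)" if "t \<in> {a..b}" for t
        using that 1 f(2) [of "2 * t"] by (simp add: joinpaths_def)
      ultimately show ?thesis by blast
    next
      case 2
      have "(s + 1) / 2 \<in> {a<..<b} \<inter> ?R" if "s \<in> {2*a-1<..<2*b-1} \<inter> S'" for s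
        using that by auto
      then have "{2*a-1<..<2*b-1} \<inter> S' = {}"
        using ab(4) by blast
      then obtain f where f: "smooth f" "\<And>t. t \<in> {2*a-1..2*b-1} \<Longrightarrow> c' t = f t"
        using S'(2) [of "2*a-1" "2*b-1"] ab 2 by auto
      have "smooth (\<lambda>t. f (2 * t + (-1)))"
        using f(1) Ck_compose_affine unfolding smooth_def by blast
      moreover have "(c +++ c') t = f (2 * t + (-1))" if "t \<in> {a..b}" for t
      \<comment> \<open>At \<open>1/2\<close> a joined path takes the value of its first component,
        so the matching end points are used here.\<close>
      proof (cases "t = 1/2")
        case True
        show ?thesis
          using that f(2) [of 0] assms(3) unfolding True by (simp add: joinpaths_def)
      next
        case False
        then show ?thesis
          using that 2 f(2) [of "2 * t - 1"] by (simp add: joinpaths_def)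
      qed
      ultimately show ?thesis by blast
    qed
  qed
  have "finite ?R"
    using S(1) S'(1) by simp
  then show ?thesis
    unfolding piecewise_smooth_path_def by (intro exI [of _ ?R] conjI allI impI piece)
qed

lemma has_vector_derivative_join_left:
  assumes f: "(f has_vector_derivative f') (at (2 * t) within {0..1})" and t: "0 \<le> t" "t < 1/2"
  shows "((f +++ g) has_vector_derivative 2 *\<^sub>R f') (at t within {0..1})"
proof -
  have img: "(\<lambda>t. 2 * t) ` {0..1/2} = {0..1::real}"
    by (simp add: image_mult_atLeastAtMost)
  have "((\<lambda>t. 2 * t) has_vector_derivative 2) (at t within {0..1/2})"
    by (auto intro!: derivative_eq_intros)
  from vector_diff_chain_within [OF this, of f f'] f img
  have "((\<lambda>t. f (2 * t)) has_vector_derivative 2 *\<^sub>R f') (at t within {0..1/2})"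
    by (simp add: o_def)
  then have "((f +++ g) has_vector_derivative 2 *\<^sub>R f') (at t within {0..1/2})"
    by (rule has_vector_derivative_transform [rotated 2]) (use t in \<open>auto simp: joinpaths_def\<close>)
  moreover have "at t within {0..1/2} = at t within {0..1}"
    by (rule at_within_nhd [of _ "{..<1/2}"]) (use t in auto)
  ultimately show ?thesis by simp
qed

lemma has_vector_derivative_join_right:
  assumes g: "(g has_vector_derivative g') (at (2 * t - 1) within {0..1})" and t: "1/2 < t" "t \<le> 1"
    and fg: "f 1 = g 0"
  shows "((f +++ g) has_vector_derivative 2 *\<^sub>R g') (at t within {0..1})"
proof -
  have img: "(\<lambda>t. 2 * t - 1) ` {1/2..1} = {0..1::real}"
    by (simp add: image_affinity_atLeastAtMost_diff)
  have "((\<lambda>t. 2 * t - 1) has_vector_derivative 2) (at t within {1/2..1})"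
    by (auto intro!: derivative_eq_intros)
  from vector_diff_chain_within [OF this, of g g'] g img
  have "((\<lambda>t. g (2 * t - 1)) has_vector_derivative 2 *\<^sub>R g') (at t within {1/2..1})"
    by (simp add: o_def)
  moreover have "(f +++ g) x = g (2 * x - 1)" if "x \<in> {1/2..1}" for x
  proof (cases "x = 1/2")
    case True
    show ?thesis
      unfolding True using fg by (simp add: joinpaths_def)
  qed (use that in \<open>auto simp: joinpaths_def\<close>)
  ultimately have "((f +++ g) has_vector_derivative 2 *\<^sub>R g') (at t within {1/2..1})"
    by (intro has_vector_derivative_transform [of t "{1/2..1}" "f +++ g" "\<lambda>t. g (2 * t - 1)"]) (use t in auto)
  moreover have "at t within {1/2..1} = at t within {0..1}"
    by (rule at_within_nhd [of _ "{1/2<..}"]) (use t in auto)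
  ultimately show ?thesis by simp
qed

text \<open>Running each half at double speed doubles the velocity of the path and that of the
  transport alike, as \<open>lie_bismut\<close> is linear in its first argument. The junction joins
  the exceptional set.\<close>

lemma lie_transport_join:
  assumes y: "lie_transport r c y" and y': "lie_transport r c' y'"
    and c: "c 1 = c' 0" and yy: "y 1 = y' 0"
  shows "lie_transport r (c +++ c') (y +++ y')"
proof -
  obtain S S' where S: "finite S" "finite S'"
      "\<And>t. t \<in> {0..1} - S \<Longrightarrow> \<exists>w. (c has_vector_derivative w) (at t within {0..1}) \<and>
          (y has_vector_derivative - lie_bismut r (ot_scale r (- fst (c t)) w) (y t)) (at t within {0..1})"
      "\<And>t. t \<in> {0..1} - S' \<Longrightarrow> \<exists>w. (c' has_vector_derivative w) (at t within {0..1}) \<and>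
          (y' has_vector_derivative - lie_bismut r (ot_scale r (- fst (c' t)) w) (y' t)) (at t within {0..1})"
    using y y' unfolding lie_transport_def by blast
  have scale: "2 *\<^sub>R (- lie_bismut r (ot_scale r a w) u) = - lie_bismut r (ot_scale r a (2 *\<^sub>R w)) u" for a w u
    by (simp add: ot_scale_linear_simps bilinear_lmul [OF bilinear_lie_bismut])
  let ?R = "{1/2} \<union> (\<lambda>s. s / 2) ` S \<union> (\<lambda>s. (s + 1) / 2) ` S'"
  have deriv: "\<exists>w. ((c +++ c') has_vector_derivative w) (at t within {0..1}) \<and>
      ((y +++ y') has_vector_derivative
        - lie_bismut r (ot_scale r (- fst ((c +++ c') t)) w) ((y +++ y') t)) (at t within {0..1})"
    if t: "t \<in> {0..1} - ?R" for t
  proof (cases "t < 1/2")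
    case True
    have "t \<in> (\<lambda>s. s / 2) ` S" if "2 * t \<in> S"
      using that by (rule rev_image_eqI) simp
    then have "2 * t \<notin> S"
      using t by blast
    then obtain w where w: "(c has_vector_derivative w) (at (2 * t) within {0..1})"
        "(y has_vector_derivative - lie_bismut r (ot_scale r (- fst (c (2 * t))) w) (y (2 * t))) (at (2 * t) within {0..1})"
      using S(3) [of "2 * t"] t True by auto
    have "(c +++ c') t = c (2 * t)" "(y +++ y') t = y (2 * t)"
      using True by (simp_all add: joinpaths_def)
    then show ?thesis
      using has_vector_derivative_join_left [OF w(1) _ True, of c']
        has_vector_derivative_join_left [OF w(2) _ True, of y'] t
      by (intro exI [of _ "2 *\<^sub>R w"]) (simp del: scaleR_minus_right add: scale)
  next
    case False
    then have gt: "1/2 < t"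
      using t by auto
    have "t \<in> (\<lambda>s. (s + 1) / 2) ` S'" if "2 * t - 1 \<in> S'"
      using that by (rule rev_image_eqI) simp
    then have "2 * t - 1 \<notin> S'"
      using t by blast
    then obtain w where w: "(c' has_vector_derivative w) (at (2 * t - 1) within {0..1})"
        "(y' has_vector_derivative - lie_bismut r (ot_scale r (- fst (c' (2 * t - 1))) w) (y' (2 * t - 1))) (at (2 * t - 1) within {0..1})"
      using S(4) [of "2 * t - 1"] t gt by auto
    have "(c +++ c') t = c' (2 * t - 1)" "(y +++ y') t = y' (2 * t - 1)"
      using gt by (simp_all add: joinpaths_def)
    then show ?thesis
      using has_vector_derivative_join_right [where f = c, OF w(1) gt] c
        has_vector_derivative_join_right [where f = y, OF w(2) gt] yy t
      by (intro exI [of _ "2 *\<^sub>R w"]) (simp del: scaleR_minus_right add: scale)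
  qed
  have "finite ?R"
    using S by simp
  moreover have "continuous_on {0..1} (y +++ y')"
    using path_join_imp [of y y'] y y' yy
    by (simp add: lie_transport_def path_def pathstart_def pathfinish_def)
  ultimately show ?thesis
    unfolding lie_transport_def by (intro conjI exI [of _ ?R] ballI deriv)
qed

text \<open>The end point is written as a right translate of \<open>p\<close>, so that consecutive
  legs multiply in the group and, by left invariance, the same \<open>T\<close> serves every
  \<open>p\<close>.\<close>

definition transports ::
  "real^'s::finite \<Rightarrow> 's ot_group \<Rightarrow> 's ot_group \<Rightarrow> ('s ot_group \<Rightarrow> 's ot_group) \<Rightarrow> bool" where
  "transports r p g T \<longleftrightarrow>
     (\<exists>c. piecewise_smooth_path c \<and> c 0 = p \<and> c 1 = ot_mult r p g \<and>
        (\<forall>x. \<exists>y. lie_transport r c y \<and> y 0 = x \<and> y 1 = T x))"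

lemma transports_compose:
  assumes "transports r p g T" "transports r (ot_mult r p g) h U"
  shows "transports r p (ot_mult r g h) (\<lambda>x. U (T x))"
proof -
  obtain c where c: "piecewise_smooth_path c" "c 0 = p" "c 1 = ot_mult r p g"
    "\<And>x. \<exists>y. lie_transport r c y \<and> y 0 = x \<and> y 1 = T x"
    using assms(1) unfolding transports_def by blast
  obtain c' where c': "piecewise_smooth_path c'" "c' 0 = ot_mult r p g" "c' 1 = ot_mult r (ot_mult r p g) h"
    "\<And>x. \<exists>y. lie_transport r c' y \<and> y 0 = x \<and> y 1 = U x"
    using assms(2) unfolding transports_def by blast
  have "\<exists>y. lie_transport r (c +++ c') y \<and> y 0 = x \<and> y 1 = U (T x)" for x
  proof -
    obtain y where y: "lie_transport r c y" "y 0 = x" "y 1 = T x"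
      using c(4) by blast
    obtain y' where y': "lie_transport r c' y'" "y' 0 = T x" "y' 1 = U (T x)"
      using c'(4) by blast
    have "lie_transport r (c +++ c') (y +++ y')"
      using c c' y y' by (intro lie_transport_join) simp_all
    then show ?thesis
      using y y' by (intro exI [of _ "y +++ y'"]) (simp add: joinpaths_def)
  qed
  moreover have "piecewise_smooth_path (c +++ c')"
    using c c' by (intro piecewise_smooth_path_join) simp_all
  ultimately show ?thesis
    unfolding transports_def
    by (intro exI [of _ "c +++ c'"]) (simp add: joinpaths_def c c' ot_mult_assoc)
qed

lemma ot_mult_eq: "ot_mult r p x = p + ot_scale r (fst p) x"
  by (cases p; cases x) (simp add: ot_scale_def vec_eq_iff)

text \<open>The hypothesis on \<open>X\<close> says that its one-parameter subgroup is a straight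
  line in the chart, as for \<open>X\<close> in the span of the \<open>A_i\<close> or with
  \<open>fst X = 0\<close>. The segment then has constant left logarithmic derivative
  \<open>X\<close>.\<close>

lemma transports_segment:
  assumes X: "\<And>t. ot_scale r (t *\<^sub>R fst X) X = X"
    and T: "\<And>x. \<exists>y. y 0 = x \<and> y 1 = T x \<and> (\<forall>t. (y has_vector_derivative - lie_bismut r X (y t)) (at t))"
  shows "transports r p X T"
proof -
  let ?c = "\<lambda>t. p + t *\<^sub>R ot_scale r (fst p) X"
  have "smooth ?c"
    unfolding smooth_def by (intro allI Ck_add Ck_const Ck_bounded_linear bounded_linear_scaleR_left)
  then have "piecewise_smooth_path ?c"
    unfolding piecewise_smooth_path_def by (intro exI [of _ "{}"]) auto
  moreover have "\<exists>y. lie_transport r ?c y \<and> y 0 = x \<and> y 1 = T x" for x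
  proof -
    obtain y where y: "y 0 = x" "y 1 = T x" "\<And>t. (y has_vector_derivative - lie_bismut r X (y t)) (at t)"
      using T by blast
    have "ot_scale r (- fst (?c t)) (ot_scale r (fst p) X) = X" for t
      using X [of "- t"] by (simp add: ot_scale_ot_scale)
    moreover have "(?c has_vector_derivative ot_scale r (fst p) X) (at t within {0..1})" for t
      by (auto intro!: derivative_eq_intros)
    ultimately have "lie_transport r ?c y"
      unfolding lie_transport_def
      by (intro conjI exI [of _ "{}"] continuous_on_vector_derivative [OF has_vector_derivative_at_within [OF y(3)]]
          ballI exI [of _ "ot_scale r (fst p) X"])
         (simp_all only: has_vector_derivative_at_within [OF y(3)] finite.emptyI)
    then show ?thesis
      using y by blast
  qed
  ultimately show ?thesis
    unfolding transports_def by (intro exI [of _ ?c]) (auto simp: ot_mult_eq)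
qed

section \<open>Unitary coordinates on the Lie algebra\<close>

text \<open>With \<open>k\<close> solving \<open>2 k + k\<^sup>2 s = 1\<close>, the shear \<open>I + k 1 1\<^sup>T\<close> is the square root of the Gram
  matrix \<open>I + 1 1\<^sup>T\<close>.\<close>

definition shear :: "real \<Rightarrow> real^'s::finite \<Rightarrow> real^'s" where
  "shear k a = (\<chi> i. a $ i + k * coord_sum a)"

lemma coord_sum_const: "coord_sum (\<chi> i. k :: real^'s::finite) = real CARD('s) * k" for k
  by (simp add: coord_sum_def)

lemma coord_sum_shear: "coord_sum (shear k a) = (1 + k * real CARD('s)) * coord_sum a" for a :: "real^'s::finite"
proof -
  have "coord_sum (shear k a) = coord_sum a + real CARD('s) * (k * coord_sum a)"
    by (simp add: shear_def coord_sum_def sum.distrib)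
  then show ?thesis
    by (simp add: algebra_simps)
qed

lemma shear_shear: "shear k (shear l a) = shear (k + l + k * l * real CARD('s)) a" for a :: "real^'s::finite"
  unfolding shear_def [of k "shear l a"] coord_sum_shear by (simp add: shear_def vec_eq_iff algebra_simps)

lemma shear_0 [simp]: "shear 0 a = a"
  by (simp add: shear_def vec_eq_iff)

lemma inner_shear:
  "shear k a \<bullet> shear k b = a \<bullet> b + (2 * k + k\<^sup>2 * real CARD('s)) * (coord_sum a * coord_sum b)"
  for a :: "real^'s::finite"
proof -
  have "shear k a \<bullet> shear k b = (\<Sum>i\<in>UNIV. a $ i * b $ i + k * coord_sum b * a $ i + k * coord_sum a * b $ i
      + k\<^sup>2 * (coord_sum a * coord_sum b))"
    unfolding inner_vec_def by (rule sum.cong) (simp_all add: shear_def algebra_simps power2_eq_square)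
  also have "\<dots> = a \<bullet> b + k * coord_sum b * coord_sum a + k * coord_sum a * coord_sum b + real CARD('s) * (k\<^sup>2 * (coord_sum a * coord_sum b))"
    by (simp add: sum.distrib inner_vec_def coord_sum_def [of a] coord_sum_def [of b] flip: sum_distrib_left)
  finally show ?thesis
    by (simp add: algebra_simps)
qed

lemma linear_shear: "linear (shear k)"
  by (rule linearI) (auto simp: shear_def vec_eq_iff algebra_simps)

text \<open>The positive root of \<open>s k^2 + 2 k = 1\<close>, in rationalised form.\<close>

definition shear_root :: "'s::finite itself \<Rightarrow> real" where
  "shear_root _ = 1 / (1 + sqrt (1 + real CARD('s)))"

lemma shear_root:
  fixes T :: "'s::finite itself"
  defines "k \<equiv> shear_root T"
  shows "2 * k + k\<^sup>2 * real CARD('s) = 1" "1 + k * real CARD('s) > 0"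
proof -
  define q where "q = sqrt (1 + real CARD('s))"
  have "q > 0"
    by (simp add: q_def)
  have s: "real CARD('s) = q\<^sup>2 - 1"
    by (simp add: q_def)
  have k: "k = 1 / (1 + q)"
    by (simp add: k_def shear_root_def q_def)
  have "2 * k + k\<^sup>2 * (q\<^sup>2 - 1) = (2 * (1 + q) + (q\<^sup>2 - 1)) / (1 + q)\<^sup>2"
    using \<open>q > 0\<close> by (simp add: k power2_eq_square divide_simps)
  also have "2 * (1 + q) + (q\<^sup>2 - 1) = (1 + q)\<^sup>2"
    by (simp add: power2_eq_square algebra_simps)
  finally show "2 * k + k\<^sup>2 * real CARD('s) = 1"
    using \<open>q > 0\<close> by (simp add: s)
  have "k \<ge> 0"
    using \<open>q > 0\<close> by (simp add: k)
  then show "1 + k * real CARD('s) > 0"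
    by (simp add: add_pos_nonneg)
qed

text \<open>A complex linear isometry onto standard Hermitian space: \<open>None\<close> indexes the
  line of \<open>C_1, C_2\<close>, and \<open>Some j\<close> pairs the \<open>A\<close> and
  \<open>B\<close> coordinates after the shear that makes the metric standard.\<close>

definition ot_coord :: "'s::finite ot_group \<Rightarrow> complex^('s option)" where
  "ot_coord x = (\<chi> k. case k of None \<Rightarrow> snd (snd x)
     | Some j \<Rightarrow> Complex (shear (shear_root TYPE('s)) (fst x) $ j) (shear (shear_root TYPE('s)) (fst (snd x)) $ j))"

definition ot_coord_inv :: "complex^('s option) \<Rightarrow> 's::finite ot_group" where
  "ot_coord_inv u =
     (let k = - shear_root TYPE('s) / (1 + shear_root TYPE('s) * real CARD('s))
      in (shear k (\<chi> j. Re (u $ Some j)), shear k (\<chi> j. Im (u $ Some j)), u $ None))"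

lemma vec_option_eq_iff: "u = v \<longleftrightarrow> u $ None = v $ None \<and> (\<forall>j. u $ Some j = v $ Some j)"
  by (metis vec_eq_iff option.exhaust)

lemma ot_coord_nth [simp]:
  "ot_coord x $ None = snd (snd x)"
  "ot_coord (x :: 's::finite ot_group) $ Some j =
     Complex (shear (shear_root TYPE('s)) (fst x) $ j) (shear (shear_root TYPE('s)) (fst (snd x)) $ j)"
  by (simp_all add: ot_coord_def)

text \<open>By \<open>shear_shear\<close> the parameter of the inverse solves
  \<open>k + l + k l s = 0\<close>.\<close>

lemma shear_inverse:
  fixes a :: "real^'s::finite"
  defines "k \<equiv> shear_root TYPE('s)"
  shows "shear k (shear (- (k / (1 + k * real CARD('s)))) a) = a"
    "shear (- (k / (1 + k * real CARD('s)))) (shear k a) = a"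
proof -
  have "k + - k / (1 + k * real CARD('s)) + k * (- (k / (1 + k * real CARD('s)))) * real CARD('s) = 0"
    using shear_root(2) [of "TYPE('s)"] by (simp add: k_def field_simps)
  then show "shear k (shear (- (k / (1 + k * real CARD('s)))) a) = a"
    "shear (- (k / (1 + k * real CARD('s)))) (shear k a) = a"
    by (simp_all add: shear_shear algebra_simps)
qed

lemma ot_coord_ot_coord_inv [simp]: "ot_coord (ot_coord_inv u) = u"
  unfolding vec_option_eq_iff
  by (simp only: ot_coord_nth) (simp add: ot_coord_inv_def Let_def shear_inverse)

lemma ot_coord_inv_ot_coord [simp]: "ot_coord_inv (ot_coord x) = x"
  by (simp add: ot_coord_inv_def Let_def shear_inverse)

lemma linear_ot_coord: "linear ot_coord"
  by (rule linearI)
     (simp_all add: vec_option_eq_iff complex_eq_iff linear_add [OF linear_shear] linear_scale [OF linear_shear])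

lemma linear_ot_coord_inv: "linear ot_coord_inv"
proof (rule linearI)
  fix u v :: "complex^('a option)" and c
  have "ot_coord (ot_coord_inv u + ot_coord_inv v) = u + v" "ot_coord (c *\<^sub>R ot_coord_inv u) = c *\<^sub>R u"
    by (simp_all add: linear_add [OF linear_ot_coord] linear_scale [OF linear_ot_coord])
  then show "ot_coord_inv (u + v) = ot_coord_inv u + ot_coord_inv v"
    "ot_coord_inv (c *\<^sub>R u) = c *\<^sub>R ot_coord_inv u"
    by (metis ot_coord_inv_ot_coord)+
qed

lemma ot_coord_complex_structure: "ot_coord (lie_complex_structure x) = \<i> *s ot_coord x"
  by (cases x) (simp add: vec_option_eq_iff complex_eq_iff linear_neg [OF linear_shear])

lemma ot_coord_inv_complex_structure: "ot_coord_inv (\<i> *s u) = lie_complex_structure (ot_coord_inv u)"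
  by (metis ot_coord_complex_structure ot_coord_inv_ot_coord ot_coord_ot_coord_inv)

lemma inner_ot_coord: "ot_coord x \<bullet> ot_coord y = lie_metric x y"
proof -
  have "ot_coord x \<bullet> ot_coord y = ot_coord x $ None \<bullet> ot_coord y $ None
      + (\<Sum>j\<in>UNIV. ot_coord x $ Some j \<bullet> ot_coord y $ Some j)"
    by (simp add: inner_vec_def UNIV_option_conv sum.reindex)
  also have "\<dots> = snd (snd x) \<bullet> snd (snd y) + shear (shear_root TYPE('a)) (fst x) \<bullet> shear (shear_root TYPE('a)) (fst y)
      + shear (shear_root TYPE('a)) (fst (snd x)) \<bullet> shear (shear_root TYPE('a)) (fst (snd y))"
    by (simp add: inner_complex_def [of "Complex _ _"] inner_vec_def sum.distrib)
  finally show ?thesis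
    by (simp add: inner_shear shear_root lie_metric_eq)
qed

lemma cinner_ot_coord: "cinner (ot_coord x) (ot_coord y) = Complex (lie_metric x y) (lie_metric x (lie_complex_structure y))"
proof -
  have "Im (cinner (ot_coord x) (ot_coord y)) = Re (cinner (ot_coord x) (\<i> *s ot_coord y))"
    by simp
  then show ?thesis
    unfolding ot_coord_complex_structure [symmetric] Re_cinner inner_ot_coord
    by (simp add: complex_eq_iff Re_cinner inner_ot_coord)
qed

lemma vec_scale_complex: "c *s u = Re c *\<^sub>R u + Im c *\<^sub>R (\<i> *s u)" for u :: "complex^'n"
  by (simp add: vec_eq_iff complex_eq_iff)

lemma matrix_vector_mult_uminus: "(- A) *v x = - (A *v x)" for A :: "complex^'n::finite^'m"
  by (simp add: matrix_vector_mult_def vec_eq_iff sum_negf)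

lemma matrix_vector_mult_scaleR_left: "(c *\<^sub>R A) *v x = c *\<^sub>R (A *v x)" for A :: "complex^'n::finite^'m"
  by (simp add: matrix_vector_mult_def vec_eq_iff scaleR_sum_right)

section \<open>Complex matrices of operators on the Lie algebra\<close>

definition ot_matrix :: "('s::finite ot_group \<Rightarrow> 's ot_group) \<Rightarrow> complex^('s option)^('s option)" where
  "ot_matrix F = matrix (\<lambda>u. ot_coord (F (ot_coord_inv u)))"

definition ot_operator :: "complex^('s option)^('s option) \<Rightarrow> 's::finite ot_group \<Rightarrow> 's ot_group" where
  "ot_operator N x = ot_coord_inv (N *v ot_coord x)"

text \<open>A real linear map commuting with the complex structure is complex linear in the
  coordinates, so its complex matrix represents it.\<close>

lemma ot_matrix_mult_vector:
  assumes F: "linear F" "\<And>x. F (lie_complex_structure x) = lie_complex_structure (F x)"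
  shows "ot_matrix F *v ot_coord x = ot_coord (F x)"
proof -
  let ?f = "\<lambda>u. ot_coord (F (ot_coord_inv u))"
  have f: "linear ?f"
    using linear_compose [OF linear_compose [OF linear_ot_coord_inv F(1)] linear_ot_coord] by (simp add: o_def)
  have "?f (\<i> *s u) = \<i> *s ?f u" for u
    by (simp add: ot_coord_inv_complex_structure F ot_coord_complex_structure)
  then have "?f (c *s u) = c *s ?f u" for c u
    using vec_scale_complex [of c u] vec_scale_complex [of c "?f u"] linear_add [OF f] linear_scale [OF f] by metis
  then have "Vector_Spaces.linear (*s) (*s) ?f"
    by (simp add: Vector_Spaces.linear_iff vec.vector_space_axioms linear_add [OF f])
  then show ?thesis
    unfolding ot_matrix_def by (simp add: matrix_works)
qed

lemma ot_operator_ot_matrix: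
  assumes "linear F" "\<And>x. F (lie_complex_structure x) = lie_complex_structure (F x)"
  shows "ot_operator (ot_matrix F) = F"
  by (simp add: ot_operator_def ot_matrix_mult_vector [OF assms] fun_eq_iff)

lemma matrix_eq_on_coord:
  assumes "\<And>x. A *v ot_coord x = B *v ot_coord x"
  shows "A = B"
  unfolding matrix_eq by (metis assms ot_coord_ot_coord_inv)

lemma cadjoint_unique:
  fixes A B :: "complex^'n::finite^'n"
  assumes "\<And>u v. (A *v u) \<bullet> v = u \<bullet> (B *v v)"
  shows "cadjoint A = B"
proof -
  have "u \<bullet> (cadjoint A *v v - B *v v) = 0" for u v
    using assms [of u v] cinner_cadjoint [of A u v] by (simp add: inner_diff_right flip: Re_cinner)
  then have "cadjoint A *v v - B *v v = 0" for v
    by (metis inner_eq_zero_iff)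
  then show ?thesis
    by (simp add: matrix_eq)
qed

lemma unitary_ot_matrix:
  assumes "F \<in> unitary_group lie_metric lie_complex_structure"
  shows "unitary_matrix (ot_matrix F)"
proof -
  have F: "linear F" "\<And>x. F (lie_complex_structure x) = lie_complex_structure (F x)"
      "\<And>x y. lie_metric (F x) (F y) = lie_metric x y"
    using assms unfolding unitary_group_def by blast+
  let ?N = "ot_matrix F"
  have iso: "(?N *v u) \<bullet> (?N *v v) = u \<bullet> v" for u v
    using ot_matrix_mult_vector [OF F(1,2)] F(3) inner_ot_coord ot_coord_ot_coord_inv by metis
  have "(mat 1 *v u) \<bullet> v = u \<bullet> ((cadjoint ?N ** ?N) *v v)" for u v
    using iso [of u v] cinner_cadjoint [of ?N u "?N *v v"]
    by (simp add: matrix_vector_mul_assoc flip: Re_cinner)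
  from cadjoint_unique [OF this] show ?thesis
    by (simp add: unitary_matrix_def)
qed

abbreviation bismut_matrix :: "real^'s::finite \<Rightarrow> 's ot_group \<Rightarrow> complex^('s option)^('s option)" where
  "bismut_matrix r X \<equiv> ot_matrix (lie_bismut r X)"

lemma bismut_matrix_mult_vector: "bismut_matrix r X *v ot_coord x = ot_coord (lie_bismut r X x)"
  by (rule ot_matrix_mult_vector)
     (use bilinear_lie_bismut [of r] in \<open>simp_all add: bilinear_def lie_bismut_complex del: split_paired_All\<close>)

lemma cadjoint_bismut_matrix: "cadjoint (bismut_matrix r X) = - bismut_matrix r X"
proof (rule cadjoint_unique)
  fix u v :: "complex^('a option)"
  have "(bismut_matrix r X *v ot_coord x) \<bullet> ot_coord y = ot_coord x \<bullet> (- bismut_matrix r X *v ot_coord y)" for x y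
    by (simp add: matrix_vector_mult_uminus bismut_matrix_mult_vector inner_ot_coord lie_bismut_skew)
  from this [of "ot_coord_inv u" "ot_coord_inv v"]
  show "(bismut_matrix r X *v u) \<bullet> v = u \<bullet> (- bismut_matrix r X *v v)"
    by simp
qed

lemma bismut_matrix_linear:
  "bismut_matrix r (X + Y) = bismut_matrix r X + bismut_matrix r Y"
  "bismut_matrix r (X - Y) = bismut_matrix r X - bismut_matrix r Y"
  "bismut_matrix r (c *\<^sub>R X) = c *\<^sub>R bismut_matrix r X"
  by (rule matrix_eq_on_coord;
      simp add: bismut_matrix_mult_vector matrix_vector_mult_add_rdistrib matrix_vector_mult_diff_rdistrib
        matrix_vector_mult_scaleR_left
        bilinear_ladd [OF bilinear_lie_bismut] bilinear_lsub [OF bilinear_lie_bismut]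
        bilinear_lmul [OF bilinear_lie_bismut] linear_add [OF linear_ot_coord]
        linear_diff [OF linear_ot_coord] linear_scale [OF linear_ot_coord])+

lemma ot_operator_mult: "ot_operator (M ** N) x = ot_operator M (ot_operator N x)"
  by (simp add: ot_operator_def matrix_vector_mul_assoc)

lemma ot_operator_1 [simp]: "ot_operator (mat 1) x = x"
  by (simp add: ot_operator_def)

lemma linear_ot_operator: "linear (\<lambda>N. ot_operator N x)"
proof -
  have "linear (\<lambda>N :: complex^('a option)^('a option). N *v ot_coord x)"
    by (rule linearI) (simp_all add: matrix_vector_mult_add_rdistrib matrix_vector_mult_scaleR_left)
  from linear_compose [OF this linear_ot_coord_inv] show ?thesis
    by (simp add: o_def ot_operator_def)
qed

section \<open>Holonomy of loops in the group\<close>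

lemma ot_mult_0_right [simp]: "ot_mult r p 0 = p"
  by (simp add: ot_mult_eq ot_scale_linear_simps)

text \<open>Transport solves \<open>y' = - lie_bismut r X y\<close>, whence the sign in
  \<open>E (- x)\<close>.\<close>

lemma transports_exp:
  assumes X: "\<And>t. ot_scale r (t *\<^sub>R fst X) X = X"
    and E: "E 0 = mat 1" "\<And>t. (E has_vector_derivative bismut_matrix r X ** E t) (at t)"
  shows "transports r p (x *\<^sub>R X) (ot_operator (E (- x)))"
proof (rule transports_segment)
  show "ot_scale r (t *\<^sub>R fst (x *\<^sub>R X)) (x *\<^sub>R X) = x *\<^sub>R X" for t
    using X [of "t * x"] by (simp add: ot_scale_linear_simps)
  fix z
  let ?y = "\<lambda>t. ot_operator (E (- x * t)) z"
  have "(?y has_vector_derivative - lie_bismut r (x *\<^sub>R X) (?y t)) (at t)" for t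
  proof -
    have "((\<lambda>t. - x * t) has_vector_derivative - x) (at t)"
      by (auto intro!: derivative_eq_intros)
    from vector_diff_chain_at [OF this E(2)]
    have "((\<lambda>t. E (- x * t)) has_vector_derivative (- x) *\<^sub>R (bismut_matrix r X ** E (- x * t))) (at t)"
      by (simp add: o_def)
    from bounded_linear.has_vector_derivative [OF linear_ot_operator [of z, unfolded linear_conv_bounded_linear] this]
    have "(?y has_vector_derivative ot_operator ((- x) *\<^sub>R (bismut_matrix r X ** E (- x * t))) z) (at t)" .
    moreover have "ot_operator (bismut_matrix r X ** E (- x * t)) z = lie_bismut r X (?y t)"
      using bismut_matrix_mult_vector [of r X "?y t"]
      by (simp add: ot_operator_mult) (simp add: ot_operator_def)
    ultimately show ?thesis
      by (simp add: linear_scale [OF linear_ot_operator] linear_neg [OF linear_ot_operator]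
          bilinear_lmul [OF bilinear_lie_bismut])
  qed
  then show "\<exists>y. y 0 = z \<and> y 1 = ot_operator (E (- x)) z \<and>
      (\<forall>t. (y has_vector_derivative - lie_bismut r (x *\<^sub>R X) (y t)) (at t))"
    by (intro exI [of _ ?y]) (simp add: E(1))
qed

definition rotation :: "real \<Rightarrow> complex^('s::finite option)^('s option)" where
  "rotation \<phi> = reflect (axis None 1) (cis \<phi>)"

lemma rotation_mult_coord: "rotation \<phi> *v ot_coord (a, b, z) = ot_coord (a, b, cis \<phi> * z)"
  by (simp add: rotation_def reflect_mult_vector vec_option_eq_iff axis_def algebra_simps del: cinner_axis)
     (simp add: axis_def algebra_simps flip: axis_def)

lemma ot_operator_rotation: "ot_operator (rotation \<phi>) (a, b, z) = (a, b, cis \<phi> * z)"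
  by (simp add: ot_operator_def rotation_mult_coord)

lemma norm_axis_None: "norm (axis None 1 :: complex^('s::finite option)) = 1"
  by (simp add: norm_axis_1)

lemma unitary_rotation: "unitary_matrix (rotation \<phi>)"
  unfolding rotation_def by (rule unitary_reflect) (simp_all add: norm_axis_None)

lemma cadjoint_rotation: "cadjoint (rotation \<phi>) = rotation (- \<phi>)"
  by (simp add: rotation_def cadjoint_reflect cis_cnj)

lemma rotation_inverse: "rotation \<phi> ** rotation (- \<phi>) = mat 1"
  by (simp add: rotation_def reflect_mult norm_axis_None cis_mult)

text \<open>\<open>lie_bismut r (a, 0, 0)\<close> vanishes on the \<open>A\<close> and
  \<open>B\<close> directions and is multiplication by \<open>\<i> * (r \<bullet> a)\<close> on the
  \<open>C\<close> line.\<close>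

lemma transports_rotation: "transports r p (a, 0, 0) (ot_operator (rotation (- (r \<bullet> a))))"
proof (rule transports_segment)
  show "ot_scale r (t *\<^sub>R fst (a, 0, 0)) (a, 0, 0) = (a, 0, 0)" for t
    by (simp add: ot_scale_def vec_eq_iff)
  fix x :: "'a ot_group"
  obtain \<alpha> \<beta> z where x: "x = (\<alpha>, \<beta>, z)"
    by (metis prod_cases3)
  let ?y = "\<lambda>t. (\<alpha>, \<beta>, cis (- (r \<bullet> a) * t) * z)"
  have "((\<lambda>t. cis (- (r \<bullet> a) * t)) has_vector_derivative - (r \<bullet> a) *\<^sub>R (\<i> * cis (- (r \<bullet> a) * t))) (at t)" for t
    unfolding has_vector_derivative_def by (auto intro!: derivative_eq_intros)
  then have "(?y has_vector_derivative (0, 0, (- (r \<bullet> a) *\<^sub>R (\<i> * cis (- (r \<bullet> a) * t))) * z)) (at t)" for t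
    by (intro has_vector_derivative_Pair has_vector_derivative_const has_vector_derivative_mult_left)
  moreover have "(0, 0, (- (r \<bullet> a) *\<^sub>R (\<i> * cis (- (r \<bullet> a) * t))) * z) = - lie_bismut r (a, 0, 0) (?y t)" for t
    by (simp add: zero_vec_def [symmetric] complex_eq_iff algebra_simps)
  ultimately show "\<exists>y. y 0 = x \<and> y 1 = ot_operator (rotation (- (r \<bullet> a))) x \<and>
      (\<forall>t. (y has_vector_derivative - lie_bismut r (a, 0, 0) (y t)) (at t))"
    by (intro exI [of _ ?y]) (simp add: x ot_operator_rotation)
qed

text \<open>The adjoint is built in so that closure under inverses is immediate, without reversing
  arbitrary paths; the explicit loops below provide it by hand.\<close>

definition holonomy_matrices :: "real^'s::finite \<Rightarrow> (complex^('s option)^('s option)) set" where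
  "holonomy_matrices r = {N. unitary_matrix N \<and> (\<forall>p. transports r p 0 (ot_operator N)) \<and>
     (\<forall>p. transports r p 0 (ot_operator (cadjoint N)))}"

lemma transports_mult:
  assumes "transports r p g (ot_operator M)" "transports r (ot_mult r p g) h (ot_operator N)"
  shows "transports r p (ot_mult r g h) (ot_operator (N ** M))"
  using transports_compose [OF assms] by (simp add: ot_operator_mult [abs_def])

lemma transports_constant: "transports r p 0 (ot_operator (mat 1))"
proof (rule transports_segment)
  fix x :: "'a ot_group"
  show "\<exists>y. y 0 = x \<and> y 1 = ot_operator (mat 1) x \<and>
      (\<forall>t. (y has_vector_derivative - lie_bismut r 0 (y t)) (at t))"
    by (intro exI [of _ "\<lambda>_. x"]) (simp add: bilinear_lzero [OF bilinear_lie_bismut])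
qed (simp add: ot_scale_linear_simps)

interpretation holonomy: unitary_subgroup "holonomy_matrices r" for r :: "real^'s::finite"
proof
  show "mat 1 \<in> holonomy_matrices r"
    by (simp add: holonomy_matrices_def transports_constant unitary_matrix_def)
next
  fix A B assume "A \<in> holonomy_matrices r" "B \<in> holonomy_matrices r"
  then show "A ** B \<in> holonomy_matrices r"
    using transports_mult [of r _ 0 B 0 A] transports_mult [of r _ 0 "cadjoint A" 0 "cadjoint B"]
    by (simp add: holonomy_matrices_def unitary_matrix_mult cadjoint_mult)
next
  fix A assume "A \<in> holonomy_matrices r"
  then show "cadjoint A \<in> holonomy_matrices r"
    by (simp add: holonomy_matrices_def unitary_matrix_cadjoint)
qed (simp add: holonomy_matrices_def)

text \<open>The loop \<open>a \<cdot> xX \<cdot> (- a) \<cdot> (- x Ad(a) X)\<close>, whose transport is differentiated at \<open>x = 0\<close>.\<close>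

lemma loop_in_tangent:
  fixes r a :: "real^'s::finite" and X :: "'s ot_group"
  assumes X: "fst X = 0"
  shows "bismut_matrix r (ot_scale r a X)
    - rotation (r \<bullet> a) ** bismut_matrix r X ** rotation (- (r \<bullet> a)) \<in> holonomy.tangent r"
proof -
  define X' where "X' = ot_scale r a X"
  have X': "fst X' = 0"
    by (simp add: X'_def X)
  obtain b c where Xbc: "X = (0, b, c)"
    using X by (metis prod_cases3 fst_conv)
  let ?R = "rotation (r \<bullet> a)" and ?R' = "rotation (- (r \<bullet> a))"
  obtain E where E: "E 0 = mat 1" "\<And>t. (E has_vector_derivative bismut_matrix r X ** E t) (at t)"
    "\<And>t. unitary_matrix (E t)" "\<And>t. cadjoint (E t) = E (- t)"
    using skew_hermitian_exp [OF cadjoint_bismut_matrix] by metis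
  obtain E' where E': "E' 0 = mat 1" "\<And>t. (E' has_vector_derivative bismut_matrix r X' ** E' t) (at t)"
    "\<And>t. unitary_matrix (E' t)" "\<And>t. cadjoint (E' t) = E' (- t)"
    using skew_hermitian_exp [OF cadjoint_bismut_matrix] by metis
  have tE: "transports r p (x *\<^sub>R X) (ot_operator (E (- x)))" for p x
    by (rule transports_exp) (simp_all add: X E)
  have tE': "transports r p (x *\<^sub>R X') (ot_operator (E' (- x)))" for p x
    by (rule transports_exp) (simp_all add: X' E')
  have tR: "transports r p (a, 0, 0) (ot_operator ?R')" for p
    by (rule transports_rotation)
  have tR': "transports r p (- a, 0, 0) (ot_operator ?R)" for p
    using transports_rotation [of r p "- a"] by simp
  \<comment> \<open>Later legs multiply on the left. The last leg runs along \<open>- x\<close>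
    times \<open>X'\<close>, so its transport is \<open>E' x\<close>.\<close>
  define \<gamma> where "\<gamma> x = E' x ** ?R ** E (- x) ** ?R'" for x
  have "transports r p 0 (ot_operator (\<gamma> x))" for p x
  proof -
    have "transports r p (ot_mult r (a, 0, 0) (ot_mult r (x *\<^sub>R X) (ot_mult r (- a, 0, 0) ((- x) *\<^sub>R X'))))
        (ot_operator (E' (- (- x)) ** ?R ** E (- x) ** ?R'))"
      unfolding ot_mult_assoc [symmetric] matrix_mul_assoc [symmetric]
      by (intro transports_mult tE tE' tR tR')
    also have "ot_mult r (a, 0, 0) (ot_mult r (x *\<^sub>R X) (ot_mult r (- a, 0, 0) ((- x) *\<^sub>R X'))) = 0"
      using ot_char_minus [of r a]
      by (simp add: Xbc X'_def ot_scale_def zero_prod_def vec_eq_iff exp_minus field_simps)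
    finally show ?thesis
      by (simp add: \<gamma>_def)
  qed
  \<comment> \<open>The adjoint is the transport along the reversed loop.\<close>
  moreover have "transports r p 0 (ot_operator (cadjoint (\<gamma> x)))" for p x
  proof -
    have "transports r p (ot_mult r (x *\<^sub>R X') (ot_mult r (a, 0, 0) (ot_mult r ((- x) *\<^sub>R X) (- a, 0, 0))))
        (ot_operator (?R ** E (- (- x)) ** ?R' ** E' (- x)))"
      unfolding ot_mult_assoc [symmetric] matrix_mul_assoc [symmetric]
      by (intro transports_mult tE tE' tR tR')
    also have "ot_mult r (x *\<^sub>R X') (ot_mult r (a, 0, 0) (ot_mult r ((- x) *\<^sub>R X) (- a, 0, 0))) = 0"
      by (simp add: Xbc X'_def ot_scale_def zero_prod_def vec_eq_iff exp_minus field_simps)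
    also have "?R ** E (- (- x)) ** ?R' ** E' (- x) = cadjoint (\<gamma> x)"
      by (simp add: \<gamma>_def cadjoint_mult cadjoint_rotation E E' matrix_mul_assoc)
    finally show ?thesis .
  qed
  moreover have "unitary_matrix (\<gamma> x)" for x
    unfolding \<gamma>_def by (intro unitary_matrix_mult E E' unitary_rotation)
  ultimately have in_H: "\<gamma> x \<in> holonomy_matrices r" for x
    by (simp add: holonomy_matrices_def)
  have dE: "((\<lambda>x. E (- x)) has_vector_derivative - (bismut_matrix r X ** E (- t))) (at t)" for t
  proof -
    have "(uminus has_vector_derivative - 1) (at t)"
      by (auto intro!: derivative_eq_intros)
    from vector_diff_chain_at [OF this E(2)] show ?thesis
      by (simp add: o_def)
  qed
  have d\<gamma>: "(\<gamma> has_vector_derivative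
      (E' t ** ?R ** (- (bismut_matrix r X ** E (- t))) + (bismut_matrix r X' ** E' t) ** ?R ** E (- t)) ** ?R') (at t)" for t
    unfolding \<gamma>_def
    by (rule bounded_linear.has_vector_derivative [OF matrix_mult.bounded_linear_left],
        rule matrix_mult.has_vector_derivative [OF bounded_linear.has_vector_derivative
            [OF matrix_mult.bounded_linear_left E'(2)] dE])
  show ?thesis
  proof (rule holonomy.tangentI [of \<gamma>])
    show "continuous_on UNIV \<gamma>"
      by (rule continuous_on_vector_derivative) (rule d\<gamma>)
    show "\<gamma> 0 = mat 1"
      by (simp add: \<gamma>_def E E' rotation_inverse)
    show "(\<gamma> has_vector_derivative bismut_matrix r (ot_scale r a X) - ?R ** bismut_matrix r X ** ?R') (at 0)"
      using d\<gamma> [of 0]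
      by (simp add: E E' X'_def rotation_inverse matrix_mult.add_left matrix_mult.diff_left matrix_mult.minus_left matrix_mult.minus_right
          flip: matrix_mul_assoc)
  qed (rule in_H)
qed

section \<open>Tangent vectors of the holonomy group\<close>

text \<open>Rotating the \<open>C\<close> line is a symmetry of the connection form. It absorbs the
  phase that transport along \<open>a\<close> adds to the loop, so both terms of
  \<open>loop_in_tangent\<close> combine into one \<open>bismut_matrix\<close>.\<close>

lemma rotation_conj_bismut_matrix:
  "rotation \<phi> ** bismut_matrix r (a, b, c) ** rotation (- \<phi>) = bismut_matrix r (a, b, cis \<phi> * c)"
proof (rule matrix_eq_on_coord)
  fix x :: "'a ot_group"
  obtain \<alpha> \<beta> z where x: "x = (\<alpha>, \<beta>, z)"
    by (metis prod_cases3)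
  have "cnj c * (cis (- \<phi>) * z) = cnj (cis \<phi> * c) * z"
    by (simp add: cis_cnj)
  moreover have "cis \<phi> * (\<i> * k * (cis (- \<phi>) * z) + w * c / 2) = \<i> * k * z + w * (cis \<phi> * c) / 2" for k w
  proof -
    have "cis \<phi> * cis (- \<phi>) = 1"
      by (simp add: cis_mult)
    then have "cis \<phi> * (\<i> * k * (cis (- \<phi>) * z)) = \<i> * k * z"
      by (metis mult.assoc mult.commute mult.right_neutral)
    then show ?thesis
      by (simp add: distrib_left mult_ac)
  qed
  ultimately show "(rotation \<phi> ** bismut_matrix r (a, b, c) ** rotation (- \<phi>)) *v ot_coord x
      = bismut_matrix r (a, b, cis \<phi> * c) *v ot_coord x"
    by (simp only: x matrix_vector_mul_assoc [symmetric] rotation_mult_coord bismut_matrix_mult_vector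
        lie_bismut.simps)
qed

lemma bismut_matrix_loop_in_tangent:
  "bismut_matrix r (ot_scale r a (0, b, c) - (0, b, cis (r \<bullet> a) * c)) \<in> holonomy.tangent r"
  using loop_in_tangent [of "(0, b, c)" r a] by (simp add: rotation_conj_bismut_matrix bismut_matrix_linear)

lemma bismut_matrix_B_in_tangent: "bismut_matrix r (0, b, 0) \<in> holonomy.tangent r"
proof -
  \<comment> \<open>With all coordinates \<open>ln 2\<close> the scaling doubles \<open>b\<close>,
    so the difference is \<open>b\<close> itself.\<close>
  have "ot_scale r (\<chi> i. ln 2) (0, b, 0) - (0, b, cis (r \<bullet> (\<chi> i. ln 2)) * 0) = (0, b, 0)"
    by (simp add: ot_scale_def vec_eq_iff)
  then show ?thesis
    using bismut_matrix_loop_in_tangent [of r "\<chi> i. ln 2" b 0] by simp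
qed

lemma bismut_matrix_C_in_tangent: "bismut_matrix r (0, 0, c) \<in> holonomy.tangent r"
  for r :: "real^'s::finite"
proof -
  define a :: "real^'s" where "a = (\<chi> i. 1)"
  \<comment> \<open>\<open>m\<close> is the factor by which the loop multiplies the \<open>C\<close>
    component. Both terms have the phase \<open>r \<bullet> a\<close> but different moduli, so it is
    non-zero.\<close>
  define m where "m = complex_of_real (exp (- coord_sum a / 2)) * cis (r \<bullet> a) - cis (r \<bullet> a)"
  have "coord_sum a > 0"
    by (simp add: a_def coord_sum_const)
  then have "exp (- coord_sum a / 2) \<noteq> 1"
    by simp
  then have "m \<noteq> 0"
    by (auto simp: m_def)
  have "ot_char r a = complex_of_real (exp (- coord_sum a / 2)) * cis (r \<bullet> a)"
    by (simp add: ot_char_def ot_weight_eq exp_eq_polar exp_of_real)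
  then have "ot_scale r a (0, 0, c / m) - (0, 0, cis (r \<bullet> a) * (c / m)) = (0, 0, m * (c / m))"
    by (simp add: ot_scale_def vec_eq_iff m_def algebra_simps diff_divide_distrib)
  then show ?thesis
    using bismut_matrix_loop_in_tangent [of r a 0 "c / m"] \<open>m \<noteq> 0\<close> by simp
qed

lemma ot_coord_None: "ot_coord (0, 0, c) = c *s axis None 1"
  by (simp add: vec_option_eq_iff axis_def linear_0 [OF linear_shear] zero_complex.code)

text \<open>The metric dual of the Lee form, whose value at \<open>(a, b, z)\<close> is
  \<open>coord_sum a\<close>.\<close>

definition lee_vector :: "'s::finite ot_group" where
  "lee_vector = (metric_inv (\<chi> i. 1), 0, 0)"

lemma cinner_lee_vector: "cinner (ot_coord x) (ot_coord lee_vector) = Complex (coord_sum (fst x)) (coord_sum (fst (snd x)))"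
proof (cases x)
  fix a b z assume x: "x = (a, b, z)"
  have 0: "metric_inv 0 = 0"
    by (rule linear_0 [OF linear_metric_inv])
  have "lie_metric x lee_vector = coord_sum a"
    using lie_metric_metric_inv [of "\<chi> i. 1" 0 0 a b z]
    by (simp add: x 0 lee_vector_def lie_metric_commute [of "(a, b, z)"]) (simp add: inner_vec_def coord_sum_def)
  moreover have "lie_metric x (lie_complex_structure lee_vector) = coord_sum b"
    using lie_metric_metric_inv [of 0 "\<chi> i. 1" 0 a b z]
    by (simp add: x 0 lee_vector_def lie_metric_commute [of "(a, b, z)"]) (simp add: inner_vec_def coord_sum_def)
  ultimately show ?thesis
    by (simp add: cinner_ot_coord x)
qed

text \<open>This operator exchanges the \<open>C\<close> line with the complex line of the Lee
  vector and kills what is orthogonal to both, so a single \<open>skew_outer\<close> describes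
  it.\<close>

lemma bismut_matrix_C: "bismut_matrix r (0, 0, 2 * c) = skew_outer (c *s axis None 1) (ot_coord lee_vector)"
proof (rule matrix_eq_on_coord)
  fix x :: "'a ot_group"
  obtain \<alpha> \<beta> z where x: "x = (\<alpha>, \<beta>, z)"
    by (metis prod_cases3)
  let ?w = "cnj c * z"
  have lee: "w *s ot_coord (lee_vector :: 'a ot_group) = ot_coord (metric_inv (\<chi> i. Re w), metric_inv (\<chi> i. Im w), 0)" for w
  proof -
    have scale: "metric_inv (\<chi> i. k) = k *\<^sub>R metric_inv (\<chi> i. 1 :: real^'a)" for k
      by (simp add: linear_scale [OF linear_metric_inv, symmetric]) (simp add: scaleR_vec_def)
    have "(metric_inv (\<chi> i. Re w), metric_inv (\<chi> i. Im w), 0)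
        = Re w *\<^sub>R (lee_vector :: 'a ot_group) + Im w *\<^sub>R lie_complex_structure lee_vector"
      using scale [of "Re w"] scale [of "Im w"] by (simp add: lee_vector_def)
    then show ?thesis
      by (simp add: vec_scale_complex [of w] linear_add [OF linear_ot_coord] linear_scale [OF linear_ot_coord]
          ot_coord_complex_structure)
  qed
  have "skew_outer (c *s axis None 1) (ot_coord lee_vector) *v ot_coord x
      = ot_coord (0, 0, Complex (coord_sum \<alpha>) (coord_sum \<beta>) * c) - ot_coord (metric_inv (\<chi> i. Re ?w), metric_inv (\<chi> i. Im ?w), 0)"
    by (simp only: lee [symmetric]) (simp add: skew_outer_mult_vector cinner_lee_vector x ot_coord_None)
  also have "\<dots> = ot_coord (lie_bismut r (0, 0, 2 * c) x)"
  proof -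
    have neg: "metric_inv (\<chi> i. - k) = - metric_inv (\<chi> i. k)" for k
      by (simp add: linear_neg [OF linear_metric_inv, symmetric]) (simp add: uminus_vec_def)
    have "Re (cnj (2 * c) * z) / 2 = Re ?w" "Im (cnj (2 * c) * z) / 2 = Im ?w"
      by simp_all
    then have "lie_bismut r (0, 0, 2 * c) x = (0, 0, Complex (coord_sum \<alpha>) (coord_sum \<beta>) * c)
        - (metric_inv (\<chi> i. Re ?w), metric_inv (\<chi> i. Im ?w), 0)"
      unfolding x lie_bismut.simps using neg [of "Re ?w"] neg [of "Im ?w"]
      by (simp add: add_divide_distrib diff_divide_distrib)
    then show ?thesis
      by (simp only: linear_diff [OF linear_ot_coord])
  qed
  finally show "bismut_matrix r (0, 0, 2 * c) *v ot_coord x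
      = skew_outer (c *s axis None 1) (ot_coord lee_vector) *v ot_coord x"
    by (simp add: bismut_matrix_mult_vector)
qed

lemma skew_outer_lee_in_tangent:
  "skew_outer (c *s axis None 1) (ot_coord lee_vector) \<in> holonomy.tangent r"
  using bismut_matrix_C_in_tangent [of r "2 * c"] by (simp add: bismut_matrix_C)

lemma skew_outer_row_in_tangent:
  fixes r :: "real^'s::finite"
  assumes "v $ None = 0"
  shows "skew_outer (c *s axis None 1) v \<in> holonomy.tangent r"
proof -
  note sub = holonomy.subspace_tangent [of r]
  let ?f = "axis None 1 :: complex^('s option)" and ?e = "lee_vector :: 's ot_group"
  have B: "skew_outer (c *s ?f) (ot_coord (0, b, 0)) \<in> holonomy.tangent r" for b c
  proof -
    \<comment> \<open>The Lee vector has all its \<open>A\<close> coordinates equal to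
      \<open>- k\<close>. \<open>?G\<close> maps the \<open>C\<close> axis to a multiple of itself,
      so one term of the Leibniz rule is already known; the other has \<open>k\<close> times the
      \<open>B\<close> vector in place of the Lee vector.\<close>
    define k where "k = - 1 / (real CARD('s) + 1)"
    let ?G = "bismut_matrix r (0, b, 0)"
    have "?G ** skew_outer (c *s ?f) (ot_coord ?e) + skew_outer (c *s ?f) (ot_coord ?e) ** cadjoint ?G \<in> holonomy.tangent r"
      by (intro holonomy.tangent_bracket bismut_matrix_B_in_tangent skew_outer_lee_in_tangent)
    moreover have "?G *v (c *s ?f) = (- \<i> * complex_of_real (coord_sum b / 2) * c) *s ?f"
      unfolding ot_coord_None [symmetric] bismut_matrix_mult_vector
      by (simp add: zero_vec_def [symmetric])
    moreover have "?G *v ot_coord ?e = k *\<^sub>R ot_coord (0, b, 0)"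
    proof -
      have e: "metric_inv (\<chi> i. 1) = (\<chi> i. - k :: real^'s)"
        by (simp add: metric_inv_def coord_sum_const k_def vec_eq_iff field_simps)
      have "metric_inv (\<chi> i. b $ i * k + coord_sum b * k) = k *\<^sub>R b"
      proof -
        have "coord_sum (\<chi> i. b $ i * k + coord_sum b * k) = coord_sum b * k + real CARD('s) * (coord_sum b * k)"
          by (simp add: coord_sum_def sum.distrib sum_distrib_right)
        also have "\<dots> = coord_sum b * k * (real CARD('s) + 1)"
          by (simp add: algebra_simps)
        finally show ?thesis
          by (simp add: metric_inv_def vec_eq_iff)
      qed
      then have "lie_bismut r (0, b, 0) ?e = k *\<^sub>R (0, b, 0)"
        by (simp add: lee_vector_def e zero_vec_def [symmetric] complex_eq_iff)
      then show ?thesis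
        by (simp only: bismut_matrix_mult_vector linear_scale [OF linear_ot_coord])
    qed
    ultimately have "skew_outer ((- \<i> * complex_of_real (coord_sum b / 2) * c) *s ?f) (ot_coord ?e)
        + k *\<^sub>R skew_outer (c *s ?f) (ot_coord (0, b, 0)) \<in> holonomy.tangent r"
      by (simp add: skew_outer_conj skew_outer_scaleR)
    from subspace_diff [OF sub this
        skew_outer_lee_in_tangent [of "- \<i> * complex_of_real (coord_sum b / 2) * c"]]
    have "k *\<^sub>R skew_outer (c *s ?f) (ot_coord (0, b, 0)) \<in> holonomy.tangent r"
      by simp
    moreover have "real CARD('s) + 1 \<noteq> 0"
      using of_nat_0_le_iff [of "CARD('s)", where 'a = real] by linarith
    then have "k \<noteq> 0"
      by (simp add: k_def)
    ultimately show ?thesis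
      using subspace_scale [OF sub, of "k *\<^sub>R skew_outer (c *s ?f) (ot_coord (0, b, 0))" "1 / k"] by simp
  qed
  obtain a b z where x: "ot_coord_inv v = (a, b, z)"
    by (metis prod_cases3)
  have v: "v = ot_coord (a, b, z)"
    by (simp flip: x)
  then have "z = 0"
    using assms by simp
  \<comment> \<open>The complex structure sends \<open>B_i\<close> to \<open>- A_i\<close>, so the
    \<open>A\<close> part is a complex multiple of a \<open>B\<close> vector. The factor moves,
    conjugated, into the first slot, where \<open>c\<close> is arbitrary.\<close>
  then have "v = (- \<i>) *s ot_coord (0, a, 0) + ot_coord (0, b, 0)"
    unfolding v by (simp add: vec_option_eq_iff complex_eq_iff linear_0 [OF linear_shear])
  then show ?thesis
    using subspace_add [OF sub B [of "cnj (- \<i>) * c" a] B [of c b]]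
    by (simp add: skew_outer_add skew_outer_scale skew_outer_minus add.commute)
qed

text \<open>The operator is \<open>- \<i>\<close> times a positive definite Hermitian one, so every
  diagonal entry has negative imaginary part. Arguing by sign avoids computing the matrix in the
  sheared coordinates.\<close>

lemma trace_bismut_matrix:
  fixes r :: "real^'s::finite"
  shows "Im (trace (bismut_matrix r (0, \<chi> i. 1, 0))) < 0"
proof -
  let ?L = "bismut_matrix r (0, \<chi> i. 1, 0)"
  have "Im (?L $ k $ k) < 0" for k
  proof -
    obtain \<alpha> \<beta> z where x: "ot_coord_inv (axis k 1 :: complex^('s option)) = (\<alpha>, \<beta>, z)"
      by (metis prod_cases3)
    have k: "axis k 1 = ot_coord (\<alpha>, \<beta>, z)"
      by (simp flip: x)
    define m where "m = 1 + real CARD('s)"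
    have "(\<alpha>, \<beta>, z) \<noteq> 0"
    proof
      assume "(\<alpha>, \<beta>, z) = 0"
      then have "(axis k 1 :: complex^('s option)) = 0"
        unfolding k by (simp only: linear_0 [OF linear_ot_coord])
      then show False
        by (simp add: axis_eq_0_iff)
    qed
    then have pos: "\<alpha> \<bullet> \<alpha> + \<beta> \<bullet> \<beta> + z \<bullet> z > 0"
      using inner_ge_zero [of \<alpha>] inner_ge_zero [of \<beta>] inner_ge_zero [of z]
        inner_eq_zero_iff [of \<alpha>] inner_eq_zero_iff [of \<beta>] inner_eq_zero_iff [of z]
      by (auto simp: zero_prod_def less_le simp del: inner_ge_zero inner_eq_zero_iff)
    have "?L $ k $ k = cinner (?L *v axis k 1) (axis k 1)"
    proof -
      have "?L $ k $ j * axis k 1 $ j = (if j = k then ?L $ k $ j else 0)" for j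
        by (simp add: axis_def)
      then show ?thesis
        by (simp add: matrix_vector_mult_def)
    qed
    also have "\<dots> = cinner (ot_coord (lie_bismut r (0, \<chi> i. 1, 0) (\<alpha>, \<beta>, z))) (ot_coord (\<alpha>, \<beta>, z))"
      by (simp only: k bismut_matrix_mult_vector)
    finally have "Im (?L $ k $ k) = lie_metric (lie_bismut r (0, \<chi> i. 1, 0) (\<alpha>, \<beta>, z)) (- \<beta>, \<alpha>, \<i> * z)"
      by (simp add: cinner_ot_coord)
    also have "lie_bismut r (0, \<chi> i. 1, 0) (\<alpha>, \<beta>, z)
        = (metric_inv (m *\<^sub>R \<beta>), metric_inv (- m *\<^sub>R \<alpha>), - \<i> * complex_of_real ((m - 1) / 2) * z)"
      by (simp add: coord_sum_const m_def) (intro conjI arg_cong [of _ _ metric_inv]; simp add: vec_eq_iff algebra_simps)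
    also have "lie_metric \<dots> (- \<beta>, \<alpha>, \<i> * z) = - (m * (\<beta> \<bullet> \<beta>) + m * (\<alpha> \<bullet> \<alpha>) + (m - 1) / 2 * (z \<bullet> z))"
      unfolding lie_metric_metric_inv by (simp add: inner_complex_def field_simps)
    also have "\<dots> < 0"
    proof -
      have "m > 1"
        by (simp add: m_def)
      then have "0 < (m - 1) / 2 * (\<alpha> \<bullet> \<alpha> + \<beta> \<bullet> \<beta> + z \<bullet> z)"
        using pos by simp
      moreover have "(m - 1) / 2 * (\<alpha> \<bullet> \<alpha>) \<le> m * (\<alpha> \<bullet> \<alpha>)" "(m - 1) / 2 * (\<beta> \<bullet> \<beta>) \<le> m * (\<beta> \<bullet> \<beta>)"
        by (intro mult_right_mono; use \<open>m > 1\<close> in simp)+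
      ultimately show ?thesis
        by (simp add: distrib_left)
    qed
    finally show ?thesis .
  qed
  then have "(\<Sum>k\<in>UNIV. Im (?L $ k $ k)) < (\<Sum>k\<in>(UNIV :: 's option set). 0)"
    by (intro sum_strict_mono) simp_all
  then show ?thesis
    by (simp add: trace_def)
qed

text \<open>The distinguished row is that of \<open>None\<close>, the \<open>C\<close> axis, and the
  sum of the \<open>B_i\<close> provides the trace.\<close>

theorem holonomy_matrices_eq: "holonomy_matrices r = {N. unitary_matrix N}"
proof -
  have "K \<in> holonomy.tangent r" if "cadjoint K = - K" for K
    by (rule holonomy.skew_hermitian_in_tangent [OF skew_outer_row_in_tangent
          bismut_matrix_B_in_tangent [of r "\<chi> i. 1"] cadjoint_bismut_matrix _ that])
       (use trace_bismut_matrix [of r] in simp_all)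
  then show ?thesis
    using holonomy.all_unitary [of r] holonomy.unitary [of _ r] by blast
qed

section \<open>Passage to the quotient\<close>

text \<open>A loop in the group projects to a loop of the quotient that belongs to the identity deck
  transformation; conjugation by \<open>ot_scale\<close> moves the operator from the tangent space
  at \<open>p\<close> to the Lie algebra.\<close>

lemma unitary_group_subset_holonomy:
  assumes "(0 :: 's::finite ot_group) \<in> G"
  shows "unitary_group (ot_metric r p) (ot_complex_structure r p)
     \<subseteq> quotient_holonomy_group (ot_mult r ` G) (bismut_christoffel r) p"
proof
  fix A assume A: "A \<in> unitary_group (ot_metric r p) (ot_complex_structure r p)"
  define B where "B x = ot_scale r (- fst p) (A (ot_scale r (fst p) x))" for x
  have B: "B \<in> unitary_group lie_metric lie_complex_structure"
    using A unfolding unitary_group_left_trivialisation B_def .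
  then have "ot_matrix B \<in> holonomy_matrices r"
    by (simp add: holonomy_matrices_eq unitary_ot_matrix)
  moreover have "ot_operator (ot_matrix B) = B"
    using B unfolding unitary_group_def by (intro ot_operator_ot_matrix) blast+
  ultimately have "transports r p 0 B"
    unfolding holonomy_matrices_def by (metis (mono_tags, lifting) mem_Collect_eq)
  then obtain c where c: "piecewise_smooth_path c" "c 0 = p" "c 1 = p"
      "\<And>x. \<exists>y. lie_transport r c y \<and> y 0 = x \<and> y 1 = B x"
    unfolding transports_def by auto
  have "\<exists>V. parallel_along (bismut_christoffel r) c V \<and> V 0 = v \<and> V 1 = A v" for v
  proof -
    obtain y where y: "lie_transport r c y" "y 0 = ot_scale r (- fst p) v" "y 1 = B (ot_scale r (- fst p) v)"
      using c(4) by blast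
    show ?thesis
      using lie_transport_imp_parallel_along [OF piecewise_smooth_path_continuous [OF c(1)] y(1)] y c
      by (intro exI [of _ "\<lambda>t. ot_scale r (fst (c t)) (y t)"]) (simp add: B_def)
  qed
  then show "A \<in> quotient_holonomy_group (ot_mult r ` G) (bismut_christoffel r) p"
    unfolding quotient_holonomy_group_def mem_Collect_eq
    by (intro bexI [of _ "ot_mult r 0"] exI [of _ c] conjI c imageI assms)
       (simp_all add: frechet_derivative_ot_mult ot_mult_0_left c del: split_paired_All)
qed

lemma zero_in_ot_lattice:
  fixes \<sigma> :: "'s::finite \<Rightarrow> 'k::field_char_0 \<Rightarrow> complex"
  assumes "bij_betw \<sigma> UNIV {f. real_embedding f}"
    and "{f. field_embedding f \<and> \<not> real_embedding f} = {\<tau>, \<lambda>x. cnj (\<tau> x)}"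
    and "subgroup U positive_units"
  shows "0 \<in> ot_lattice \<sigma> \<tau> U"
proof -
  have "real_embedding (\<sigma> i)" for i
    using assms(1) by (auto simp: bij_betw_def)
  then have \<sigma>: "field_embedding (\<sigma> i)" for i
    by (simp add: real_embedding_def)
  have \<tau>: "field_embedding \<tau>"
    using assms(2) by blast
  have f0: "f 0 = 0" if "field_embedding f" for f :: "'k \<Rightarrow> complex"
    using that unfolding field_embedding_def by (metis add_cancel_right_right)
  have f1: "f 1 = 1" if "field_embedding f" for f :: "'k \<Rightarrow> complex"
    using that by (simp add: field_embedding_def)
  have "1 \<in> U"
    using subgroup.one_closed [OF assms(3)] by (simp add: positive_units_def)
  then show ?thesis
    unfolding ot_lattice_def mem_Collect_eq
    by - (rule exI [of _ "1 :: 'k"], rule exI [of _ "0 :: 'k"],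
        simp add: zero_prod_def vec_eq_iff f0 [OF \<sigma>] f1 [OF \<sigma>] f0 [OF \<tau>])
qed

theorem theorem6p10:
  fixes \<sigma> :: "'s::finite \<Rightarrow> 'k::field_char_0 \<Rightarrow> complex"
    and \<tau> :: "'k \<Rightarrow> complex"
    and U :: "'k set"
    and r :: "real^'s"
    and p :: "'s ot_group"
  assumes "number_field TYPE('k)"
    and "bij_betw \<sigma> UNIV {f. real_embedding f}"
    and "{f. field_embedding f \<and> \<not> real_embedding f} = {\<tau>, \<lambda>x. cnj (\<tau> x)}"
    and "subgroup U positive_units"
    and "finite (rcosets\<^bsub>positive_units\<^esub> U)"
    and "\<forall>u\<in>U. \<tau> u = ot_char r (\<chi> i. ln (Re (\<sigma> i u)))"
  shows "quotient_holonomy_group (ot_mult r ` ot_lattice \<sigma> \<tau> U)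
           (bismut_connection (ot_metric r) (ot_complex_structure r)) p
         = unitary_group (ot_metric r p) (ot_complex_structure r p)"
  unfolding bismut_connection_eq
  by (intro equalityI quotient_holonomy_subset unitary_group_subset_holonomy zero_in_ot_lattice assms)

end
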